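(* Let $W$ be a finite Coxeter group and $c$ a Coxeter element of $W$. The set of $c$-sortable elements of $W$ is a sublattice of the weak order on $W$, i.e. it is closed under the meet and join operations of the weak order.
   Context: A Coxeter system $(W,S)$ has $S=\{s_1,\dots,s_n\}$ and presentation $W=\langle S\mid s_i^2=1,\ (s_is_j)^{m(i,j)}=1\rangle$; here $W$ is finite. $\ell(w)$ is the length of a reduced word for $w$. The (right) weak order sets $u\le w$ iff a reduced word for $u$ is a prefix of a reduced word for $w$; for finite $W$ it is a lattice. A Coxeter element is a product $c=s_1\cdots s_n$ of all elements of $S$, each once. Sorting words: fix a reduced word $s_1\cdots s_n$ for $c$; the $(s_1,\dots,s_n)$-sorting word of $w$ is built greedily by testing letters in the cyclic order $s_1,\dots,s_n,s_1,\dots$ (continuing from the letter after the last tested), appending a tested letter $a$ and replacing the current element $w'$ (initially $w$) by $aw'$ whenever $\ell(aw')<\ell(w')$, until $w'=1$. Each full cycle through $(s_1,\dots,s_n)$ is a pass; $w$ is $c$-sortable if the sets of letters appended in successive passes are weakly decreasing under inclusion (this depends only on $c$). *)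

theory Defs
  imports Main
begin

text \<open>Coxeter system given by generators s_0,...,s_(n-1) (letters 0..<n) and a Coxeter
  matrix m. For i \<noteq> j, m i j = 0 encodes m(i,j) = infinity (no relation).
  The group W is realised as the set of classes of words over the alphabet {0..<n}
  modulo the congruence generated by the defining relations of the presentation.\<close>

definition coxeter_matrix :: "nat \<Rightarrow> (nat \<Rightarrow> nat \<Rightarrow> nat) \<Rightarrow> bool" where
  "coxeter_matrix n m \<longleftrightarrow>
     (\<forall>i<n. \<forall>j<n. m i j = m j i) \<and> (\<forall>i<n. m i i = 1) \<and>
     (\<forall>i<n. \<forall>j<n. i \<noteq> j \<longrightarrow> m i j \<noteq> 1)"

fun alt :: "nat \<Rightarrow> nat \<Rightarrow> nat \<Rightarrow> nat list" where
  "alt i j 0 = []"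
| "alt i j (Suc k) = i # alt j i k"

definition words :: "nat \<Rightarrow> nat list set" where
  "words n = {w. set w \<subseteq> {..<n}}"

inductive cox_rel :: "nat \<Rightarrow> (nat \<Rightarrow> nat \<Rightarrow> nat) \<Rightarrow> nat list \<Rightarrow> nat list \<Rightarrow> bool"
  for n m where
  invol: "i < n \<Longrightarrow> cox_rel n m [i, i] []"
| braid: "i < n \<Longrightarrow> j < n \<Longrightarrow> i \<noteq> j \<Longrightarrow> m i j \<noteq> 0 \<Longrightarrow>
           cox_rel n m (alt i j (2 * m i j)) []"
| refl: "w \<in> words n \<Longrightarrow> cox_rel n m w w"
| sym: "cox_rel n m a b \<Longrightarrow> cox_rel n m b a"
| trans: "cox_rel n m a b \<Longrightarrow> cox_rel n m b c \<Longrightarrow> cox_rel n m a c"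
| cong: "cox_rel n m a b \<Longrightarrow> u \<in> words n \<Longrightarrow> v \<in> words n \<Longrightarrow>
           cox_rel n m (u @ a @ v) (u @ b @ v)"

definition cox_class :: "nat \<Rightarrow> (nat \<Rightarrow> nat \<Rightarrow> nat) \<Rightarrow> nat list \<Rightarrow> nat list set" where
  "cox_class n m w = {v. cox_rel n m w v}"

definition coxW :: "nat \<Rightarrow> (nat \<Rightarrow> nat \<Rightarrow> nat) \<Rightarrow> nat list set set" where
  "coxW n m = cox_class n m ` words n"

definition ell :: "nat list set \<Rightarrow> nat" where
  "ell x = (LEAST k. \<exists>v\<in>x. length v = k)"

definition reduced_word :: "nat list set \<Rightarrow> nat list \<Rightarrow> bool" where
  "reduced_word x w \<longleftrightarrow> w \<in> x \<and> length w = ell x"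

definition weak_le :: "nat \<Rightarrow> (nat \<Rightarrow> nat \<Rightarrow> nat) \<Rightarrow> nat list set \<Rightarrow> nat list set \<Rightarrow> bool" where
  "weak_le n m u w \<longleftrightarrow> u \<in> coxW n m \<and> w \<in> coxW n m \<and>
     (\<exists>a b. reduced_word u a \<and> reduced_word w (a @ b))"

definition is_weak_meet :: "nat \<Rightarrow> (nat \<Rightarrow> nat \<Rightarrow> nat) \<Rightarrow> nat list set \<Rightarrow> nat list set \<Rightarrow> nat list set \<Rightarrow> bool" where
  "is_weak_meet n m u v x \<longleftrightarrow> weak_le n m x u \<and> weak_le n m x v \<and>
     (\<forall>y. weak_le n m y u \<and> weak_le n m y v \<longrightarrow> weak_le n m y x)"

definition is_weak_join :: "nat \<Rightarrow> (nat \<Rightarrow> nat \<Rightarrow> nat) \<Rightarrow> nat list set \<Rightarrow> nat list set \<Rightarrow> nat list set \<Rightarrow> bool" where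
  "is_weak_join n m u v x \<longleftrightarrow> weak_le n m u x \<and> weak_le n m v x \<and>
     (\<forall>y. weak_le n m u y \<and> weak_le n m v y \<longrightarrow> weak_le n m x y)"

definition coxeter_word :: "nat \<Rightarrow> nat list \<Rightarrow> bool" where
  "coxeter_word n p \<longleftrightarrow> distinct p \<and> set p = {..<n}"

definition clen :: "nat \<Rightarrow> (nat \<Rightarrow> nat \<Rightarrow> nat) \<Rightarrow> nat list \<Rightarrow> nat" where
  "clen n m w = ell (cox_class n m w)"

text \<open>Sorting procedure: at step t the letter p!(t mod n) is tested (pass number t div n);
  the current element is represented by a word.\<close>
fun sort_state :: "nat \<Rightarrow> (nat \<Rightarrow> nat \<Rightarrow> nat) \<Rightarrow> nat list \<Rightarrow> nat list \<Rightarrow> nat \<Rightarrow> nat list" where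
  "sort_state n m p w 0 = w"
| "sort_state n m p w (Suc t) =
     (let q = p ! (t mod n); v = sort_state n m p w t in
      if clen n m (q # v) < clen n m v then q # v else v)"

definition sort_appended :: "nat \<Rightarrow> (nat \<Rightarrow> nat \<Rightarrow> nat) \<Rightarrow> nat list \<Rightarrow> nat list \<Rightarrow> nat \<Rightarrow> bool" where
  "sort_appended n m p w t \<longleftrightarrow> 0 < n \<and>
     clen n m (p ! (t mod n) # sort_state n m p w t) < clen n m (sort_state n m p w t)"

definition pass_set :: "nat \<Rightarrow> (nat \<Rightarrow> nat \<Rightarrow> nat) \<Rightarrow> nat list \<Rightarrow> nat list \<Rightarrow> nat \<Rightarrow> nat set" where
  "pass_set n m p w j = {p ! (t mod n) | t. t div n = j \<and> sort_appended n m p w t}"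

definition c_sortable :: "nat \<Rightarrow> (nat \<Rightarrow> nat \<Rightarrow> nat) \<Rightarrow> nat list \<Rightarrow> nat list set \<Rightarrow> bool" where
  "c_sortable n m p x \<longleftrightarrow> x \<in> coxW n m \<and>
     (\<forall>w\<in>x. \<forall>j. pass_set n m p w (Suc j) \<subseteq> pass_set n m p w j)"

end

theory Submission
  imports Defs Complex_Main
begin

text \<open>
  The group is realised by its geometric representation, so that the weak order becomes inclusion of
  inversion sets. Following Reading and Speyer, an element is \<open>c\<close>-sortable iff it is aligned: whenever
  an inversion decomposes as a positive combination of two positive roots, the summand that comes first
  for the skew form of \<open>c\<close> is an inversion too. Hence sortability passes to parabolic projections,
  and closure under meets follows by induction: if the initial letter \<open>s\<close> of \<open>c\<close> lies below both
  elements, remove it; otherwise project both to the parabolic subgroup omitting \<open>s\<close>.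

  For joins, each lower wall of \<open>u \<or> v\<close> is an inversion of \<open>u\<close> or of \<open>v\<close>, so the alignment condition
  holds at the lower walls of the join, and it remains to see that this suffices for sortability. The
  crucial case is an element \<open>x\<close> that is not above \<open>s\<close> but has a lower wall \<open>\<gamma>\<close> with positive
  \<open>s\<close>-coordinate. For every positive root there is a sortable join-irreducible \<open>j\<close> with this single lower
  wall. Both \<open>x\<close> and \<open>j\<close> satisfy the alignment condition at \<open>\<gamma>\<close>, hence they lie in the same shard, which
  forces \<open>j \<le> x\<close>; but \<open>j\<close> is above \<open>s\<close>, a contradiction.
\<close>

section \<open>The geometric representation\<close>

text \<open>The inductions run over the number of letters plus the number of inversions. To make
  them possible, everything is stated for a word \<open>q\<close> of distinct letters that need not
  use all of them: \<open>E q\<close>, \<open>good q\<close> and \<open>sortable q\<close> live in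
  one ambient group, and membership in a parabolic subgroup is only a condition on the supports of
  inversions (\<open>inP\<close>). Accepting a letter rotates \<open>q\<close>, and alignment is
  transported by the invariance \<open>E_refl\<close>; rejecting it restricts \<open>E\<close>,
  which changes nothing on roots without that letter.

  Joins are harder than meets because no local rule gives the inversions of a join in terms of those
  of its arguments. Alignment is under control only at the lower walls, hence the detour through
  shards. Finiteness serves this detour: it makes every positive root an inversion of some sortable
  element, via a longest element, and it provides maximal coset representatives.

  The alignment inequality is non-strict, so on a tie both summands are required. This is forced by
  \<open>sortable_ray\<close>, the device that turns alignment into the recursive form of
  sortability: the comparison it supplies is only non-strict.\<close>

type_synonym vec = "nat \<Rightarrow> real"

definition lc :: "real \<Rightarrow> vec \<Rightarrow> real \<Rightarrow> vec \<Rightarrow> vec" where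
  "lc a u b v = (\<lambda>k. a * u k + b * v k)"

definition simple :: "nat \<Rightarrow> vec" where
  "simple i = (\<lambda>k. if k = i then 1 else 0)"

definition neg :: "vec \<Rightarrow> vec" where
  "neg v = (\<lambda>k. - v k)"

definition pos :: "vec \<Rightarrow> bool" where
  "pos v \<longleftrightarrow> (\<forall>k. 0 \<le> v k)"

definition supp_in :: "nat set \<Rightarrow> vec \<Rightarrow> bool" where
  "supp_in J v \<longleftrightarrow> (\<forall>k. k \<notin> J \<longrightarrow> v k = 0)"

lemma simple_same [simp]: "simple i i = 1" and simple_other: "k \<noteq> i \<Longrightarrow> simple i k = 0"
  by (simp_all add: simple_def)

lemma neg_neg [simp]: "neg (neg v) = v"
  by (simp add: neg_def)

lemma neg_eq_lc: "neg v = lc (- 1) v 0 v"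
  by (simp add: neg_def lc_def)

lemma lc_apply: "lc a u b v k = a * u k + b * v k"
  by (simp add: lc_def)

lemma neg_apply: "neg v k = - v k"
  by (simp add: neg_def)

lemma posD: "pos v \<Longrightarrow> 0 \<le> v k"
  by (simp add: pos_def)

lemma neg_lc: "neg (lc a u b v) = lc a (neg u) b (neg v)"
  by (simp add: lc_def neg_def)

lemma supp_in_mono: "supp_in I v \<Longrightarrow> I \<subseteq> J \<Longrightarrow> supp_in J v"
  by (auto simp: supp_in_def)

lemma supp_in_neg [simp]: "supp_in J (neg v) \<longleftrightarrow> supp_in J v"
  by (simp add: supp_in_def neg_def)

lemma supp_in_simple [simp]: "supp_in J (simple i) \<longleftrightarrow> i \<in> J"
  by (auto simp: supp_in_def simple_def)

lemma supp_in_pos_lc: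
  assumes "supp_in J (lc a u b v)" "pos u" "pos v" "0 < a" "0 < b"
  shows "supp_in J u" "supp_in J v"
proof -
  have "u k = 0 \<and> v k = 0" if "k \<notin> J" for k
  proof -
    have "a * u k + b * v k = 0" using assms(1) that by (simp add: supp_in_def lc_def)
    moreover have "0 \<le> a * u k" "0 \<le> b * v k" using assms by (simp_all add: pos_def)
    ultimately have "a * u k = 0" "b * v k = 0" by linarith+
    then show ?thesis using assms by simp
  qed
  then show "supp_in J u" "supp_in J v" by (auto simp: supp_in_def)
qed

section \<open>The Tits form and the simple reflections\<close>

locale coxeter =
  fixes n :: nat and m :: "nat \<Rightarrow> nat \<Rightarrow> nat"
  assumes coxeter_matrix: "coxeter_matrix n m"
begin

text \<open>The Tits form on simple roots, normalised to norm one. An infinite label, coded as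
  \<open>0\<close>, gets the limit \<open>- 1\<close> of \<open>- cos (pi / k)\<close>.\<close>

definition bm :: "nat \<Rightarrow> nat \<Rightarrow> real" where
  "bm i j = (if i = j then 1 else if m i j = 0 then - 1 else - cos (pi / m i j))"

definition bil :: "vec \<Rightarrow> vec \<Rightarrow> real" where
  "bil u v = (\<Sum>i<n. \<Sum>j<n. u i * v j * bm i j)"

definition refl :: "nat \<Rightarrow> vec \<Rightarrow> vec" where
  "refl i v = lc 1 v (- 2 * bil v (simple i)) (simple i)"

fun act :: "nat list \<Rightarrow> vec \<Rightarrow> vec" where
  "act [] = id"
| "act (i # w) = refl i \<circ> act w"

lemma bm_sym: "i < n \<Longrightarrow> j < n \<Longrightarrow> bm i j = bm j i"
  using coxeter_matrix by (auto simp: bm_def coxeter_matrix_def)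

lemma bm_same [simp]: "bm i i = 1"
  by (simp add: bm_def)

lemma m_ge_2: "i < n \<Longrightarrow> j < n \<Longrightarrow> i \<noteq> j \<Longrightarrow> m i j \<noteq> 0 \<Longrightarrow> 2 \<le> m i j"
  using coxeter_matrix unfolding coxeter_matrix_def
  by (metis One_nat_def Suc_1 Suc_leI less_one linorder_neqE_nat)

lemma bm_le_0: assumes "i < n" "j < n" "i \<noteq> j" shows "bm i j \<le> 0"
proof (cases "m i j = 0")
  case True then show ?thesis using assms by (simp add: bm_def)
next
  case False
  then have "2 \<le> m i j" using m_ge_2 assms by blast
  then have "pi / m i j \<le> pi / 2"
    by (intro divide_left_mono) auto
  moreover have "0 \<le> pi / m i j" by simp
  moreover from calculation(2) have "- (pi / 2) \<le> pi / m i j" using pi_ge_zero by linarith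
  ultimately have "0 \<le> cos (pi / m i j)" by (intro cos_ge_zero) auto
  then show ?thesis using False assms by (simp add: bm_def)
qed

lemma bil_sym: "bil u v = bil v u"
proof -
  have "bil u v = (\<Sum>j<n. \<Sum>i<n. u i * v j * bm i j)"
    unfolding bil_def by (rule sum.swap)
  also have "\<dots> = bil v u"
    unfolding bil_def by (intro sum.cong refl) (auto simp: bm_sym)
  finally show ?thesis .
qed

lemma bil_lc_left: "bil (lc a u b v) w = a * bil u w + b * bil v w"
  by (simp add: bil_def lc_def algebra_simps sum.distrib sum_distrib_left)

lemma bil_lc_right: "bil w (lc a u b v) = a * bil w u + b * bil w v"
  using bil_lc_left bil_sym by metis

lemma bil_simple: "i < n \<Longrightarrow> bil v (simple i) = (\<Sum>j<n. v j * bm j i)"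
proof -
  assume i: "i < n"
  have "(\<Sum>j<n. v k * simple i j * bm k j) = (\<Sum>j<n. if j = i then v k * bm k j else 0)" for k
    by (intro sum.cong) (auto simp: simple_other)
  then show ?thesis using i by (simp add: bil_def)
qed

lemma bil_simple_simple: "i < n \<Longrightarrow> j < n \<Longrightarrow> bil (simple i) (simple j) = bm i j"
proof -
  assume i: "i < n" "j < n"
  have "(\<Sum>k<n. simple i k * bm k j) = (\<Sum>k<n. if k = i then bm k j else 0)"
    by (intro sum.cong) (auto simp: simple_other)
  then show ?thesis using i by (simp add: bil_simple)
qed

lemma bil_neg_left [simp]: "bil (neg u) v = - bil u v"
  by (simp add: neg_eq_lc bil_lc_left)

lemma bil_neg_right [simp]: "bil u (neg v) = - bil u v"
  by (simp add: neg_eq_lc bil_lc_right)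

lemma refl_lc: "refl i (lc a u b v) = lc a (refl i u) b (refl i v)"
  unfolding refl_def by (simp add: bil_lc_left) (auto simp: lc_def algebra_simps)

lemma refl_refl: "i < n \<Longrightarrow> refl i (refl i v) = v"
  unfolding refl_def by (simp add: bil_lc_left bil_simple_simple) (simp add: lc_def algebra_simps)

lemma bil_refl: "i < n \<Longrightarrow> bil (refl i u) (refl i v) = bil u v"
  unfolding refl_def by (simp add: bil_lc_left bil_lc_right bil_simple_simple bil_sym algebra_simps)

lemma refl_other: "k \<noteq> i \<Longrightarrow> refl i v k = v k"
  by (simp add: refl_def lc_def simple_other)

lemma refl_simple: "i < n \<Longrightarrow> refl i (simple i) = neg (simple i)"
  by (simp add: refl_def bil_simple_simple) (simp add: lc_def neg_def)

lemma act_append: "act (u @ v) = act u \<circ> act v"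
  by (induction u) auto

lemma act_lc: "act w (lc a u b v) = lc a (act w u) b (act w v)"
  by (induction w) (auto simp: refl_lc)

lemma act_neg: "act w (neg v) = neg (act w v)"
  by (simp add: neg_eq_lc act_lc)

lemma bil_act: "w \<in> words n \<Longrightarrow> bil (act w u) (act w v) = bil u v"
  by (induction w) (auto simp: words_def bil_refl)

lemma act_rev: "w \<in> words n \<Longrightarrow> act (rev w) \<circ> act w = id"
  by (induction w) (auto simp: words_def act_append refl_refl fun_eq_iff)

lemma words_append [simp]: "u @ v \<in> words n \<longleftrightarrow> u \<in> words n \<and> v \<in> words n"
  by (auto simp: words_def)
lemma words_Cons [simp]: "i # v \<in> words n \<longleftrightarrow> i < n \<and> v \<in> words n"
  by (auto simp: words_def)
lemma words_Nil [simp]: "[] \<in> words n"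
  by (auto simp: words_def)
lemma words_rev [simp]: "rev v \<in> words n \<longleftrightarrow> v \<in> words n"
  by (auto simp: words_def)

text \<open>Chebyshev-type coefficients: alternating products of \<open>s\<^sub>i\<close> and \<open>s\<^sub>j\<close> applied to a simple root
  have consecutive values \<open>cheb d (k+1)\<close>, \<open>cheb d k\<close> as coordinates, where \<open>d = - 2 * bm i j\<close>.\<close>

fun cheb :: "real \<Rightarrow> nat \<Rightarrow> real" where
  "cheb d 0 = 0"
| "cheb d (Suc 0) = 1"
| "cheb d (Suc (Suc k)) = d * cheb d (Suc k) - cheb d k"

text \<open>So \<open>cheb (2 * cos t) k\<close> is the Chebyshev value
  \<open>sin (k t) / sin t\<close>; at \<open>t = pi / m i j\<close> the sine gives the signs up to
  \<open>k = m i j\<close> and the period behind the braid relation.\<close>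

lemma cheb_sin: "sin t * cheb (2 * cos t) k = sin (real k * t)"
proof (induction "2 * cos t" k rule: cheb.induct)
  case (3 k)
  have *: "2 * cos t * sin (t + real k * t) - sin (real k * t) = sin (t + (t + real k * t))"
    unfolding sin_add [of t "t + real k * t"] sin_add [of t "real k * t"] cos_add [of t "real k * t"]
    using sin_cos_squared_add [of t] by algebra
  have "sin t * cheb (2 * cos t) (Suc (Suc k)) = 2 * cos t * (sin t * cheb (2 * cos t) (Suc k)) - sin t * cheb (2 * cos t) k"
    by (simp add: algebra_simps)
  also have "\<dots> = 2 * cos t * sin (t + real k * t) - sin (real k * t)"
    using 3 by (simp add: algebra_simps)
  finally show ?case using * by (simp add: algebra_simps)
qed auto

lemma cheb_2: "cheb 2 k = real k"
  by (induction "2::real" k rule: cheb.induct) auto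

lemma cheb_nonneg:
  assumes "i < n" "j < n" "i \<noteq> j" "m i j = 0 \<or> k \<le> m i j"
  shows "0 \<le> cheb (- 2 * bm i j) k"
proof (cases "m i j = 0")
  case True
  then have "- 2 * bm i j = 2" using assms by (simp add: bm_def)
  then show ?thesis using cheb_2[of k] by simp
next
  case False
  then have m2: "2 \<le> m i j" using m_ge_2 assms by blast
  define t where "t = pi / m i j"
  have t: "0 < t" "t < pi" using m2 by (auto simp: t_def field_simps)
  have d: "- 2 * bm i j = 2 * cos t" using assms False by (simp add: bm_def t_def)
  have "real k * t \<le> real (m i j) * t" using assms False t by (intro mult_right_mono) auto
  then have "real k * t \<le> pi" using m2 by (simp add: t_def)
  then have "0 \<le> sin (real k * t)" using t by (intro sin_ge_zero) auto
  then have "0 \<le> sin t * cheb (2 * cos t) k" by (simp only: cheb_sin)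
  moreover have "0 < sin t" using t by (rule sin_gt_zero)
  ultimately show ?thesis unfolding d by (simp add: zero_le_mult_iff)
qed

lemma cheb_period:
  assumes "i < n" "j < n" "i \<noteq> j" "m i j \<noteq> 0"
  shows "cheb (- 2 * bm i j) (2 * m i j) = 0" "cheb (- 2 * bm i j) (Suc (2 * m i j)) = 1"
    "cheb (- 2 * bm i j) (2 * m i j - 1) = - 1"
proof -
  have m2: "2 \<le> m i j" using m_ge_2 assms by blast
  define t where "t = pi / m i j"
  have t: "0 < t" "t < pi" using m2 by (auto simp: t_def field_simps)
  have d: "- 2 * bm i j = 2 * cos t" using assms by (simp add: bm_def t_def)
  have st: "0 < sin t" using t by (rule sin_gt_zero)
  have mt: "real (m i j) * t = pi" using m2 by (simp add: t_def)
  have e: "real (2 * m i j) * t = 2 * pi" using mt by simp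
  have "sin t * cheb (2 * cos t) (2 * m i j) = 0" unfolding cheb_sin e by simp
  then show "cheb (- 2 * bm i j) (2 * m i j) = 0" unfolding d using st by simp
  have "real (Suc (2 * m i j)) * t = t + 2 * pi" using mt by (simp add: algebra_simps)
  then have "sin t * cheb (2 * cos t) (Suc (2 * m i j)) = sin t" unfolding cheb_sin by simp
  then show "cheb (- 2 * bm i j) (Suc (2 * m i j)) = 1" unfolding d using st by simp
  have "real (2 * m i j - 1) * t = 2 * pi - t" using mt m2 by (simp add: of_nat_diff algebra_simps)
  then have "sin t * cheb (2 * cos t) (2 * m i j - 1) = - sin t" unfolding cheb_sin
    by (simp add: sin_diff)
  then have "sin t * (cheb (2 * cos t) (2 * m i j - 1) + 1) = 0" by (simp add: algebra_simps)
  then show "cheb (- 2 * bm i j) (2 * m i j - 1) = - 1" unfolding d using st by simp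
qed

section \<open>The braid relations hold in the geometric representation\<close>

lemma alt_Suc_right: "alt i j (Suc k) = (if even k then alt i j k @ [i] else alt i j k @ [j])"
  by (induction k arbitrary: i j) auto

lemma alt_words [simp]: "i < n \<Longrightarrow> j < n \<Longrightarrow> alt i j k \<in> words n"
  by (induction k arbitrary: i j) auto

lemma length_alt [simp]: "length (alt i j k) = k"
  by (induction k arbitrary: i j) auto

lemma refl_plane:
  assumes "i < n" "j < n"
  shows "refl i (lc a (simple i) b (simple j)) = lc (- a - 2 * bm i j * b) (simple i) b (simple j)"
  unfolding refl_def
  using assms by (simp add: bil_lc_left bil_simple_simple bm_sym[of j i]) (auto simp: lc_def algebra_simps)

lemma lc_swap: "lc a u b v = lc b v a u"
  by (simp add: lc_def add.commute)

text \<open>The word is applied to the simple root of the letter that is not its last one. Stripping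
  the first letter swaps \<open>i\<close> and \<open>j\<close> and the parity, so the two parts
  prove each other.\<close>

lemma act_alt_aux:
  assumes "i < n" "j < n"
  shows "even k \<Longrightarrow> act (alt i j k) (simple i) = lc (cheb (- 2 * bm i j) (Suc k)) (simple i) (cheb (- 2 * bm i j) k) (simple j)"
    and "odd k \<Longrightarrow> act (alt i j k) (simple j) = lc (cheb (- 2 * bm i j) (Suc k)) (simple i) (cheb (- 2 * bm i j) k) (simple j)"
  using assms
proof (induction k arbitrary: i j)
  case 0
  { case 1 then show ?case by (simp add: lc_def) }
  { case 2 then show ?case by simp }
next
  case (Suc k)
  { case 1
    then have "act (alt j i k) (simple i) = lc (cheb (- 2 * bm j i) (Suc k)) (simple j) (cheb (- 2 * bm j i) k) (simple i)"
      using Suc.IH(2)[of j i] by auto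
    then show ?case using 1 by (simp add: lc_swap[of _ "simple j"] refl_plane bm_sym[of j i]) (simp add: algebra_simps lc_def)? }
  { case 2
    then have "act (alt j i k) (simple j) = lc (cheb (- 2 * bm j i) (Suc k)) (simple j) (cheb (- 2 * bm j i) k) (simple i)"
      using Suc.IH(1)[of j i] by auto
    then show ?case using 2 by (simp add: lc_swap[of _ "simple j"] refl_plane bm_sym[of j i]) (simp add: algebra_simps lc_def)? }
qed

lemma act_braid_simple:
  assumes "i < n" "j < n" "i \<noteq> j" "m i j \<noteq> 0"
  shows "act (alt i j (2 * m i j)) (simple i) = simple i" "act (alt i j (2 * m i j)) (simple j) = simple j"
proof -
  show "act (alt i j (2 * m i j)) (simple i) = simple i"
    using act_alt_aux(1)[OF assms(1,2), of "2 * m i j"] cheb_period[OF assms]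
    by (simp add: lc_def)
  have m2: "2 \<le> m i j" using m_ge_2 assms by blast
  then obtain k where k: "2 * m i j = Suc k" by (metis Suc_diff_1 mult_pos_pos pos2 zero_less_iff_neq_zero assms(4))
  have odd: "odd k" using k by (metis even_Suc even_mult_iff even_numeral)
  have "act (alt i j (2 * m i j)) (simple j) = act (alt i j k @ [j]) (simple j)"
    unfolding k using alt_Suc_right[of i j k] odd by simp
  also have "\<dots> = neg (act (alt i j k) (simple j))"
    using assms by (simp add: act_append refl_simple act_neg)
  also have "\<dots> = simple j"
    unfolding act_alt_aux(2)[OF assms(1,2) odd]
    using cheb_period[OF assms] k by (simp add: lc_def neg_def)
  finally show "act (alt i j (2 * m i j)) (simple j) = simple j" .
qed

lemma act_fix:
  assumes "w \<in> words n" "\<And>k. k \<in> set w \<Longrightarrow> bil v (simple k) = 0"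
  shows "act w v = v"
  using assms by (induction w) (auto simp: refl_def lc_def)

lemma set_alt: "set (alt i j k) \<subseteq> {i, j}"
  by (induction k arbitrary: i j) auto

text \<open>For a finite label the form is nondegenerate on the plane of the two simple roots. Hence
  \<open>v\<close> differs by a vector of that plane from one orthogonal to both roots, which every
  letter of the word fixes.\<close>

lemma act_braid:
  assumes "i < n" "j < n" "i \<noteq> j" "m i j \<noteq> 0"
  shows "act (alt i j (2 * m i j)) = id"
proof
  fix v
  define w where "w = alt i j (2 * m i j)"
  define c where "c = bm i j"
  have m2: "2 \<le> m i j" using m_ge_2 assms by blast
  have c: "c\<^sup>2 < 1"
  proof -
    define t where "t = pi / m i j"
    have t: "0 < t" "t < pi" using m2 by (auto simp: t_def field_simps)
    have "0 < (sin t)\<^sup>2" using sin_gt_zero[OF t] by simp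
    then have "(cos t)\<^sup>2 < 1" using sin_cos_squared_add[of t] by linarith
    then show ?thesis using assms by (simp add: c_def bm_def t_def)
  qed
  define p where "p = bil v (simple i)"
  define q where "q = bil v (simple j)"
  \<comment> \<open>\<open>x\<close> and \<open>y\<close> solve the Gram system that makes
    \<open>v'\<close> below orthogonal to both simple roots.\<close>
  define x where "x = (c * q - p) / (1 - c\<^sup>2)"
  define y where "y = (c * p - q) / (1 - c\<^sup>2)"
  have nz: "1 - c\<^sup>2 \<noteq> 0" using c by simp
  have e1: "p + x + y * c = 0" and e2: "q + x * c + y = 0"
    using nz unfolding x_def y_def by (simp_all add: divide_simps power2_eq_square) (simp_all add: algebra_simps)
  define v' where "v' = lc 1 v 1 (lc x (simple i) y (simple j))"
  have "bil v' (simple i) = 0"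
    using e1 assms unfolding v'_def by (simp add: bil_lc_left bil_simple_simple p_def c_def bm_sym[of j i])
  moreover have "bil v' (simple j) = 0"
    using e2 assms unfolding v'_def by (simp add: bil_lc_left bil_simple_simple q_def c_def)
  ultimately have f: "act w v' = v'"
    using assms set_alt[of i j "2 * m i j"] by (intro act_fix) (auto simp: w_def)
  have "v = lc 1 v' (- 1) (lc x (simple i) y (simple j))"
    by (simp add: v'_def lc_def)
  then have "act w v = lc 1 (act w v') (- 1) (lc x (act w (simple i)) y (act w (simple j)))"
    by (metis act_lc)
  also have "\<dots> = v"
    unfolding f using act_braid_simple[OF assms] by (simp add: w_def v'_def lc_def)
  finally show "act (alt i j (2 * m i j)) v = id v" by (simp add: w_def)
qed

section \<open>Length modulo the relations\<close>

abbreviation rel :: "nat list \<Rightarrow> nat list \<Rightarrow> bool" (infix "\<sim>" 50) where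
  "u \<sim> v \<equiv> cox_rel n m u v"

lemma rel_words: "u \<sim> v \<Longrightarrow> u \<in> words n \<and> v \<in> words n"
  by (induction rule: cox_rel.induct) auto

lemma rel_act: "u \<sim> v \<Longrightarrow> act u = act v"
proof (induction rule: cox_rel.induct)
  case (invol i) then show ?case by (auto simp: refl_refl fun_eq_iff)
next
  case (braid i j) then show ?case by (simp add: act_braid)
qed (auto simp: act_append)

lemma rel_parity: "u \<sim> v \<Longrightarrow> even (length u) \<longleftrightarrow> even (length v)"
  by (induction rule: cox_rel.induct) auto

lemma rel_append: "u \<sim> u' \<Longrightarrow> v \<sim> v' \<Longrightarrow> u @ v \<sim> u' @ v'"
  using cox_rel.cong[of n m u u' "[]" v] cox_rel.cong[of n m v v' u' "[]"] rel_words cox_rel.trans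
  by (metis append_Nil append_Nil2 words_Nil)

lemma rel_cancel: "i < n \<Longrightarrow> w \<in> words n \<Longrightarrow> w @ [i, i] \<sim> w" "i < n \<Longrightarrow> w \<in> words n \<Longrightarrow> [i, i] @ w \<sim> w"
  using rel_append[OF cox_rel.refl[of w n m] cox_rel.invol[of i n m]]
    rel_append[OF cox_rel.invol[of i n m] cox_rel.refl[of w n m]] by auto

lemma rel_mid: "i < n \<Longrightarrow> u \<in> words n \<Longrightarrow> v \<in> words n \<Longrightarrow> u @ i # i # v \<sim> u @ v"
  using cox_rel.cong[OF cox_rel.invol[of i n m], of u v] by simp

abbreviation len :: "nat list \<Rightarrow> nat" where "len w \<equiv> clen n m w"

lemma len_le: "w \<sim> v \<Longrightarrow> len w \<le> length v"
  unfolding clen_def ell_def cox_class_def by (intro Least_le) auto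

lemma len_attained: "w \<in> words n \<Longrightarrow> \<exists>v. w \<sim> v \<and> length v = len w"
  using LeastI_ex[of "\<lambda>k. \<exists>v\<in>cox_class n m w. length v = k"] cox_rel.refl
  unfolding clen_def ell_def cox_class_def by blast

lemma len_le_length: "w \<in> words n \<Longrightarrow> len w \<le> length w"
  using len_le cox_rel.refl by blast

lemma len_rel: "u \<sim> v \<Longrightarrow> len u = len v"
  by (metis antisym cox_rel.sym cox_rel.trans len_attained len_le rel_words)

lemma len_parity: "w \<in> words n \<Longrightarrow> even (len w) \<longleftrightarrow> even (length w)"
  using len_attained rel_parity by metis

lemma len_append: "u \<in> words n \<Longrightarrow> v \<in> words n \<Longrightarrow> len (u @ v) \<le> len u + len v"
  by (metis len_attained len_le length_append rel_append)

text \<open>Subadditivity bounds the difference by one, and equality is excluded because all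
  relators have even length.\<close>

lemma len_snoc: "w \<in> words n \<Longrightarrow> i < n \<Longrightarrow> len (w @ [i]) = Suc (len w) \<or> Suc (len (w @ [i])) = len w"
proof -
  assume a: "w \<in> words n" "i < n"
  have 1: "len [i] \<le> 1" using len_le_length[of "[i]"] a by simp
  have "len (w @ [i]) \<le> len w + 1" using len_append[of w "[i]"] a 1 by simp
  moreover have "len w \<le> len (w @ [i]) + 1"
    using len_append[of "w @ [i]" "[i]"] len_rel[OF rel_cancel(1)[of i w]] a 1 by simp
  moreover have "len (w @ [i]) \<noteq> len w"
    using len_parity[of w] len_parity[of "w @ [i]"] a by auto
  ultimately show ?thesis by linarith
qed

lemma alternating:
  assumes "set d \<subseteq> {i, j}" "\<nexists>u k v. d = u @ k # k # v" "d = [] \<or> last d = j"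
  shows "\<exists>k. d = (if even k then alt i j k else alt j i k)"
  using assms
proof (induction d arbitrary: i j rule: rev_induct)
  case Nil then show ?case by (intro exI[of _ 0]) simp
next
  case (snoc x d)
  have x: "x = j" using snoc.prems(3) by simp
  have "d = [] \<or> last d = i"
  proof (rule ccontr)
    assume a: "\<not> ?thesis"
    then have "last d = j" using snoc.prems(1) by (metis Un_iff insertE last_in_set set_append singletonD subsetD)
    then have "d @ [x] = butlast d @ j # j # []" using a x by (metis append.assoc append_Cons append_Nil append_butlast_last_id)
    then show False using snoc.prems(2) by blast
  qed
  moreover have "\<nexists>u k v. d = u @ k # k # v" using snoc.prems(2) by (metis append.assoc append_Cons)
  ultimately have "\<exists>k. d = (if even k then alt j i k else alt i j k)"
    by (intro snoc.IH) (use snoc.prems(1) in auto)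
  then obtain k where k: "d = (if even k then alt j i k else alt i j k)" by blast
  show ?case
    by (intro exI[of _ "Suc k"]) (use k x alt_Suc_right in auto)
qed

lemma rev_alt: "rev (alt i j k) = (if even k then alt j i k else alt i j k)"
proof (induction k arbitrary: i j)
  case (Suc k)
  then show ?case using alt_Suc_right[of i j k] alt_Suc_right[of j i k] by auto
qed simp

lemma alt_add: "alt i j (k + l) = alt i j k @ (if even k then alt i j l else alt j i l)"
  by (induction k arbitrary: i j) auto

lemma rel_rev: "w \<in> words n \<Longrightarrow> w @ rev w \<sim> []"
proof (induction w)
  case Nil then show ?case by (simp add: cox_rel.refl)
next
  case (Cons i w)
  then have "[i] @ (w @ rev w) @ [i] \<sim> [i] @ [] @ [i]" by (intro cox_rel.cong) auto
  then show ?case using Cons.prems cox_rel.trans cox_rel.invol[of i n m] by simp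
qed

lemma rel_alt_m:
  assumes "i < n" "j < n" "i \<noteq> j" "m i j \<noteq> 0"
  shows "alt i j (m i j) \<sim> alt j i (m i j)"
proof -
  define k where "k = m i j"
  define B where "B = (if even k then alt i j k else alt j i k)"
  have w: "alt i j k \<in> words n" "B \<in> words n" "rev B \<in> words n" using assms by (auto simp: B_def)
  have "alt i j (2 * k) \<sim> []" unfolding k_def using assms by (intro cox_rel.braid)
  then have *: "alt i j k @ B \<sim> []" using alt_add[of i j k k] by (simp add: B_def mult_2)
  have rB: "rev B = alt j i k" using rev_alt by (auto simp: B_def)
  have 1: "alt i j k @ B @ rev B \<sim> alt i j k" using rel_append[OF cox_rel.refl[OF w(1)] rel_rev[OF w(2)]] by simp
  have 2: "alt i j k @ B @ rev B \<sim> rev B" using rel_append[OF * cox_rel.refl[OF w(3)]] by simp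
  have "alt i j k \<sim> rev B" using cox_rel.trans[OF cox_rel.sym[OF 1] 2] .
  then show ?thesis by (simp add: rB k_def)
qed

lemma pos_lc: "pos u \<Longrightarrow> pos v \<Longrightarrow> 0 \<le> a \<Longrightarrow> 0 \<le> b \<Longrightarrow> pos (lc a u b v)"
  by (auto simp: pos_def lc_def)

lemma pos_simple: "pos (simple i)"
  by (auto simp: pos_def simple_def)

text \<open>The factorisation \<open>w = v d\<close> with \<open>d\<close> in the dihedral subgroup of \<open>i, j\<close> and \<open>v\<close> shortest
  reduces the claim to the rank two computation above.\<close>

theorem length_increase_pos:
  assumes "w \<in> words n" "i < n" "len w < len (w @ [i])"
  shows "pos (act w (simple i))"
  using assms
proof (induction "len w" arbitrary: w i rule: less_induct)
  case less
  note w = less.prems(1) and i = less.prems(2) and inc = less.prems(3)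
  show ?case
  proof (cases "len w = 0")
    case True
    then obtain v where "w \<sim> v" "length v = 0" using len_attained[OF w] by auto
    then have "act w = id" using rel_act by fastforce
    then show ?thesis by (simp add: pos_simple)
  next
    case False
    obtain r where r: "w \<sim> r" "length r = len w" using len_attained[OF w] by auto
    then have rne: "r \<noteq> []" using False by auto
    define j where "j = last r"
    define r' where "r' = butlast r"
    have rr: "r = r' @ [j]" using rne by (simp add: j_def r'_def)
    have rw: "r' \<in> words n" "j < n" using r(1) rel_words[of w r] unfolding rr by auto
    have lr': "len r' = length r'"
    proof -
      have "len w \<le> len r' + 1" using len_rel[OF r(1)] len_snoc[OF rw] unfolding rr by linarith
      moreover have "length r' + 1 = len w" using r(2) rr by simp
      ultimately show ?thesis using len_le_length[OF rw(1)] by linarith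
    qed
    have ij: "i \<noteq> j"
    proof
      assume "i = j"
      then have "w @ [i] \<sim> r' @ [i, i]" using rel_append[OF r(1) cox_rel.refl[of "[i]" n m]] i rr by simp
      then have "len (w @ [i]) = len r'" using len_rel rel_cancel(1)[OF i rw(1)] by (metis)
      then show False using inc lr' r(2) rr by simp
    qed
    \<comment> \<open>With the least such \<open>k\<close>, the factor \<open>v\<close> is a
      shortest representative of its coset of the dihedral subgroup.\<close>
    define P where "P k \<longleftrightarrow> (\<exists>v d. v \<in> words n \<and> set d \<subseteq> {i, j} \<and> w \<sim> v @ d \<and> len v = k \<and> len v + length d = len w)" for k
    have P1: "P (len r')" unfolding P_def
      by (rule exI[of _ r'], rule exI[of _ "[j]"]) (use rw r rr lr' in auto)
    define k where "k = (LEAST k. P k)"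
    have "P k" unfolding k_def using P1 by (rule LeastI)
    then obtain v d where vd: "v \<in> words n" "set d \<subseteq> {i, j}" "w \<sim> v @ d" "len v = k" "len v + length d = len w"
      unfolding P_def by blast
    have kmin: "k \<le> k'" if "P k'" for k' unfolding k_def using that by (rule Least_le)
    have dw: "d \<in> words n" using vd(2) i rw(2) by (auto simp: words_def)
    have "k \<le> len r'" using P1 by (rule kmin)
    then have vlt: "len v < len w" using vd(4) lr' r(2) rr by simp
    \<comment> \<open>A descent \<open>e\<close> of \<open>v\<close> could be moved over to
      \<open>d\<close>, against the choice of \<open>k\<close>; so the induction hypothesis applies
      to \<open>v\<close> at both letters.\<close>
    have vup: "pos (act v (simple e))" if e: "e \<in> {i, j}" for e
    proof -
      have en: "e < n" using e i rw(2) by auto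
      have "len v < len (v @ [e])"
      proof (rule ccontr)
        assume "\<not> ?thesis"
        then have s: "Suc (len (v @ [e])) = len v" using len_snoc[OF vd(1) en] by linarith
        have "v @ d \<sim> (v @ [e]) @ (e # d)"
          using rel_mid[OF en vd(1) dw] by (simp add: cox_rel.sym)
        then have "w \<sim> (v @ [e]) @ (e # d)" using vd(3) cox_rel.trans by blast
        then have "P (len (v @ [e]))" unfolding P_def
          by (intro exI[of _ "v @ [e]"] exI[of _ "e # d"]) (use vd e en s in auto)
        then show False using kmin s vd(4) by fastforce
      qed
      then show ?thesis using less.hyps[OF vlt vd(1) en] by simp
    qed
    have minimal: "length d \<le> length d'" if "d \<sim> d'" for d'
    proof -
      have d'w: "d' \<in> words n" using that rel_words by blast
      have "w \<sim> v @ d'" using vd(3) rel_append[OF cox_rel.refl[OF vd(1)] that] cox_rel.trans by blast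
      then have "len w \<le> len v + len d'" using len_rel len_append[OF vd(1) d'w] by metis
      then show ?thesis using vd(5) len_le_length[OF d'w] by linarith
    qed
    \<comment> \<open>A final \<open>i\<close> would cancel in \<open>w @ [i]\<close>, which would
      then be shorter than \<open>w\<close>.\<close>
    have noend: "\<not> d \<sim> d' @ [i]" if "length d' < length d" for d'
    proof
      assume a: "d \<sim> d' @ [i]"
      then have d'w: "d' \<in> words n" using rel_words by fastforce
      have "w \<sim> v @ d' @ [i]" using vd(3) rel_append[OF cox_rel.refl[OF vd(1)] a] cox_rel.trans by blast
      then have "w @ [i] \<sim> (v @ d' @ [i]) @ [i]" by (rule rel_append) (simp add: cox_rel.refl i)
      moreover have "(v @ d') @ [i, i] \<sim> v @ d'" using vd d'w i by (intro rel_cancel) auto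
      ultimately have "len (w @ [i]) = len (v @ d')" by (simp add: len_rel)
      also have "\<dots> \<le> len v + length d'" using len_append[OF vd(1) d'w] len_le_length[OF d'w] by linarith
      finally show False using that inc vd(5) by linarith
    qed
    have nodup: "\<nexists>u k v. d = u @ k # k # v"
    proof (intro notI, elim exE)
      fix u k v assume a: "d = u @ k # k # v"
      then have "d \<sim> u @ v" using dw rel_mid by (auto simp: words_def)
      then show False using minimal a by fastforce
    qed
    have lastd: "d = [] \<or> last d = j"
    proof (rule ccontr)
      assume a: "\<not> ?thesis"
      then have "last d = i" using vd(2) last_in_set by blast
      then have "d = butlast d @ [i]" using a by (metis append_butlast_last_id)
      moreover have "d \<sim> d" using dw by (rule cox_rel.refl)
      ultimately have "d \<sim> butlast d @ [i]" by metis
      moreover have "length (butlast d) < length d" using a by simp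
      ultimately show False using noend by blast
    qed
    obtain l where l: "d = (if even l then alt i j l else alt j i l)"
      using alternating[OF vd(2) nodup lastd] by blast
    have ld: "length d = l" by (simp add: l)
    have jn: "j < n" by (rule rw(2))
    \<comment> \<open>With \<open>m i j\<close> or more letters, the braid relation applied to the
      last \<open>m i j\<close> of them would make \<open>d\<close> end in \<open>i\<close>. Below
      that bound the coefficients \<open>cheb\<close> are nonnegative.\<close>
    have short: "m i j = 0 \<or> l < m i j"
    proof (rule ccontr)
      assume a: "\<not> ?thesis"
      then have mz: "m i j \<noteq> 0" and ml: "m i j \<le> l" by auto
      define M where "M = m i j"
      have ab: "alt a b l = alt a b (l - M) @ (if even (l - M) then alt a b M else alt b a M)" for a b
        using alt_add[of a b "l - M" M] ml by (simp add: M_def)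
      define t1 where "t1 = (if even M then alt i j M else alt j i M)"
      define t2 where "t2 = (if even M then alt j i M else alt i j M)"
      define d0 where "d0 = (if even l then alt i j (l - M) else alt j i (l - M))"
      have dd: "d = d0 @ t1" using ml ab by (auto simp: l t1_def d0_def M_def)
      have t12: "t1 \<sim> t2" using rel_alt_m[OF i jn ij mz] cox_rel.sym by (auto simp: t1_def t2_def M_def)
      have "M \<noteq> 0" using mz by (simp add: M_def)
      then obtain M' where M': "M = Suc M'" by (cases M) auto
      have "\<exists>t3. t2 = t3 @ [i]"
        using alt_Suc_right[of i j M'] alt_Suc_right[of j i M'] unfolding t2_def M' by auto
      then obtain t3 where t3: "t2 = t3 @ [i]" by blast
      have d0w: "d0 \<in> words n" using i jn by (auto simp: d0_def)
      have "d \<sim> d0 @ t3 @ [i]" unfolding dd using rel_append[OF cox_rel.refl[OF d0w] t12] by (simp add: t3)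
      moreover have "length t2 = length t1" by (simp add: t1_def t2_def)
      then have "length (d0 @ t3) < length d" unfolding dd using t3 by simp
      ultimately show False using noend[of "d0 @ t3"] by simp
    qed
    have "\<exists>a b. 0 \<le> a \<and> 0 \<le> b \<and> act d (simple i) = lc a (simple i) b (simple j)"
    proof (cases "even l")
      case True
      then show ?thesis
        using act_alt_aux(1)[OF i jn True] cheb_nonneg[OF i jn ij, of l] cheb_nonneg[OF i jn ij, of "Suc l"] short
        by (intro exI[of _ "cheb (- 2 * bm i j) (Suc l)"] exI[of _ "cheb (- 2 * bm i j) l"]) (auto simp: l)
    next
      case False
      then show ?thesis
        using act_alt_aux(2)[OF jn i, of l] cheb_nonneg[OF i jn ij, of l] cheb_nonneg[OF i jn ij, of "Suc l"] short
        by (intro exI[of _ "cheb (- 2 * bm i j) l"] exI[of _ "cheb (- 2 * bm i j) (Suc l)"])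
          (auto simp: l bm_sym[OF jn i] lc_swap[of _ "simple j"])
    qed
    then obtain a b where ab: "0 \<le> a" "0 \<le> b" "act d (simple i) = lc a (simple i) b (simple j)" by blast
    have "act w (simple i) = act v (act d (simple i))" using rel_act[OF vd(3)] by (simp add: act_append)
    also have "\<dots> = lc a (act v (simple i)) b (act v (simple j))" by (simp add: ab act_lc)
    finally show ?thesis using vup ab by (simp add: pos_lc)
  qed
qed

lemma act_simple_pos_or_neg:
  assumes "w \<in> words n" "i < n"
  shows "pos (act w (simple i)) \<or> pos (neg (act w (simple i)))"
proof (cases "len w < len (w @ [i])")
  case True then show ?thesis using length_increase_pos assms by blast
next
  case False
  then have "Suc (len (w @ [i])) = len w" using len_snoc[OF assms] by linarith
  moreover have "len ((w @ [i]) @ [i]) = len w" using len_rel[OF rel_cancel(1)[of i w]] assms by simp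
  ultimately have "pos (act (w @ [i]) (simple i))" using length_increase_pos[of "w @ [i]" i] assms by simp
  then show ?thesis using assms by (simp add: act_append refl_simple act_neg)
qed

lemma ex_descent_word:
  assumes "w \<in> words n" "0 < len w"
  shows "\<exists>i<n. pos (neg (act w (simple i)))"
proof -
  obtain r where r: "w \<sim> r" "length r = len w" using len_attained[OF assms(1)] by auto
  then have rne: "r \<noteq> []" using assms by auto
  define i where "i = last r"
  define r' where "r' = butlast r"
  have rr: "r = r' @ [i]" using rne by (simp add: i_def r'_def)
  have rw: "r' \<in> words n" "i < n" using r(1) rel_words[of w r] unfolding rr by auto
  have "len r' < len (r' @ [i])"
    using len_rel[OF r(1)] r(2) len_le_length[OF rw(1)] unfolding rr by simp
  then have "pos (act r' (simple i))" using length_increase_pos rw by blast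
  then have "pos (neg (act w (simple i)))"
    using rel_act[OF r(1)] rw unfolding rr by (simp add: act_append refl_simple act_neg)
  then show ?thesis using rw by blast
qed

lemma not_pos_neg_simple: "\<not> pos (neg (simple i))"
  by (auto simp: pos_def neg_def simple_def)

text \<open>Faithfulness of the representation: an element of positive length makes some simple root
  negative, which the identity does not.\<close>

lemma act_id_rel_Nil:
  assumes "w \<in> words n" "act w = id"
  shows "w \<sim> []"
proof -
  have "len w = 0" using ex_descent_word[OF assms(1)] assms(2) not_pos_neg_simple by auto
  then show ?thesis using len_attained[OF assms(1)] by auto
qed

lemma rel_iff_act:
  assumes "u \<in> words n" "v \<in> words n"
  shows "u \<sim> v \<longleftrightarrow> act u = act v"
proof
  assume "act u = act v"
  then have "act (u @ rev v) = id"
    using act_rev[of "rev v"] assms by (simp add: act_append)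
  then have 1: "u @ rev v \<sim> []" using act_id_rel_Nil assms by simp
  have 2: "u @ rev v @ v \<sim> v" using rel_append[OF 1 cox_rel.refl[OF assms(2)]] by simp
  have 3: "u @ rev v @ v \<sim> u"
    using rel_append[OF cox_rel.refl[OF assms(1)] rel_rev[of "rev v"]] assms by simp
  show "u \<sim> v" using cox_rel.trans[OF cox_rel.sym[OF 3] 2] .
qed (rule rel_act)

section \<open>Roots and inversion sets\<close>

text \<open>By \<open>rel_iff_act\<close> the group of the presentation is isomorphic to the group \<open>W\<close> of linear maps;
  \<open>N f\<close> is the set of left inversions of \<open>f\<close>, and weak order is inclusion of these sets.\<close>

definition W :: "(vec \<Rightarrow> vec) set" where
  "W = act ` words n"

definition roots :: "vec set" where
  "roots = {f (simple i) | f i. f \<in> W \<and> i < n}"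

definition proots :: "vec set" where
  "proots = {\<beta> \<in> roots. pos \<beta>}"

definition N :: "(vec \<Rightarrow> vec) \<Rightarrow> vec set" where
  "N f = {\<beta> \<in> proots. \<not> pos (inv f \<beta>)}"

lemma id_W [simp, intro]: "id \<in> W"
  unfolding W_def using words_Nil by (metis act.simps(1) imageI)

lemma comp_W [intro]: "f \<in> W \<Longrightarrow> g \<in> W \<Longrightarrow> f \<circ> g \<in> W"
  unfolding W_def by (auto simp: act_append[symmetric])

lemma refl_W [simp, intro]: "i < n \<Longrightarrow> refl i \<in> W"
  unfolding W_def using words_Cons[of i "[]"] words_Nil by (metis act.simps comp_id imageI)

lemma act_W [simp, intro]: "w \<in> words n \<Longrightarrow> act w \<in> W"
  by (simp add: W_def)

lemma W_inverse:
  assumes "f \<in> W"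
  obtains g where "g \<in> W" "g \<circ> f = id" "f \<circ> g = id" "inv f = g"
proof -
  obtain w where w: "w \<in> words n" "f = act w" using assms by (auto simp: W_def)
  have 1: "act (rev w) \<circ> f = id" using act_rev w by blast
  have 2: "f \<circ> act (rev w) = id" using act_rev[of "rev w"] w by simp
  show thesis using that[of "act (rev w)"] 1 2 w inv_unique_comp[OF 2 1] by simp
qed

lemma inv_W [simp, intro]: "f \<in> W \<Longrightarrow> inv f \<in> W"
  by (metis W_inverse)

lemma inv_left [simp]: "f \<in> W \<Longrightarrow> inv f (f v) = v"
  by (metis W_inverse comp_apply id_apply)

lemma inv_right [simp]: "f \<in> W \<Longrightarrow> f (inv f v) = v"
  by (metis W_inverse comp_apply id_apply)

lemma inv_inv [simp]: "f \<in> W \<Longrightarrow> inv (inv f) = f"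
  by (metis W_inverse inv_unique_comp)

lemma bij_W: "f \<in> W \<Longrightarrow> bij f"
  by (metis W_inverse o_bij)

lemma inv_refl [simp]: "i < n \<Longrightarrow> inv (refl i) = refl i"
  by (intro inv_unique_comp) (auto simp: refl_refl fun_eq_iff)

lemma inv_comp: "f \<in> W \<Longrightarrow> g \<in> W \<Longrightarrow> inv (f \<circ> g) = inv g \<circ> inv f"
  by (simp add: o_inv_distrib bij_W)

lemma W_lc: "f \<in> W \<Longrightarrow> f (lc a u b v) = lc a (f u) b (f v)"
  by (auto simp: W_def act_lc)

lemma W_neg [simp]: "f \<in> W \<Longrightarrow> f (neg v) = neg (f v)"
  by (auto simp: W_def act_neg)

lemma W_bil [simp]: "f \<in> W \<Longrightarrow> bil (f u) (f v) = bil u v"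
  by (auto simp: W_def bil_act)

lemma act_ge: "w \<in> words n \<Longrightarrow> n \<le> k \<Longrightarrow> act w v k = v k"
  by (induction w) (auto simp: refl_other)

lemma W_ge: "f \<in> W \<Longrightarrow> n \<le> k \<Longrightarrow> f v k = v k"
  by (auto simp: W_def act_ge)

lemma W_sum:
  assumes "f \<in> W" "finite A"
  shows "f (\<lambda>k. \<Sum>i\<in>A. c i * g i k) = (\<lambda>k. \<Sum>i\<in>A. c i * f (g i) k)"
  using assms(2)
proof (induction A)
  case empty
  have "f (lc 0 (\<lambda>k. 0) 0 (\<lambda>k. 0)) = lc 0 (f (\<lambda>k. 0)) 0 (f (\<lambda>k. 0))" by (rule W_lc[OF assms(1)])
  then show ?case by (simp add: lc_def)
next
  case (insert x A)
  have "f (\<lambda>k. \<Sum>i\<in>insert x A. c i * g i k) = f (lc (c x) (g x) 1 (\<lambda>k. \<Sum>i\<in>A. c i * g i k))"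
    using insert.hyps by (simp add: lc_def)
  also have "\<dots> = lc (c x) (f (g x)) 1 (f (\<lambda>k. \<Sum>i\<in>A. c i * g i k))" by (rule W_lc[OF assms(1)])
  also have "\<dots> = (\<lambda>k. \<Sum>i\<in>insert x A. c i * f (g i) k)"
    unfolding insert.IH using insert.hyps by (simp add: lc_def)
  finally show ?case .
qed

lemma supp_expand: "supp_in {..<n} v \<Longrightarrow> v = (\<lambda>k. \<Sum>i<n. v i * simple i k)"
proof
  fix k assume "supp_in {..<n} v"
  moreover have "(\<Sum>i<n. v i * simple i k) = (\<Sum>i<n. if i = k then v i else 0)"
    by (intro sum.cong) (auto simp: simple_other)
  ultimately show "v k = (\<Sum>i<n. v i * simple i k)" by (auto simp: supp_in_def)
qed

lemma W_expand: "f \<in> W \<Longrightarrow> supp_in {..<n} v \<Longrightarrow> f v k = (\<Sum>i<n. v i * f (simple i) k)"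
  using W_sum[of f "{..<n}" v simple] supp_expand[of v] by (metis finite_lessThan)

lemma rootE:
  assumes "\<beta> \<in> roots" obtains f i where "f \<in> W" "i < n" "\<beta> = f (simple i)"
proof -
  obtain f i where "\<beta> = f (simple i) \<and> f \<in> W \<and> i < n"
    using assms unfolding roots_def by (elim CollectE exE)
  then show thesis using that by metis
qed

lemma rootI: "f \<in> W \<Longrightarrow> i < n \<Longrightarrow> f (simple i) \<in> roots"
  unfolding roots_def by blast

lemma roots_W: "f \<in> W \<Longrightarrow> \<beta> \<in> roots \<Longrightarrow> f \<beta> \<in> roots"
proof -
  assume a: "f \<in> W" "\<beta> \<in> roots"
  obtain g i where g: "g \<in> W" "i < n" "\<beta> = g (simple i)" using a(2) by (rule rootE)
  have "(f \<circ> g) (simple i) \<in> roots" using g a by (intro rootI comp_W)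
  then show ?thesis using g by simp
qed

lemma simple_root [simp]: "i < n \<Longrightarrow> simple i \<in> roots"
  using rootI[OF id_W] by simp

lemma neg_root [simp]: "neg \<beta> \<in> roots \<longleftrightarrow> \<beta> \<in> roots"
proof -
  have *: "neg \<beta> \<in> roots" if b: "\<beta> \<in> roots" for \<beta>
  proof -
    obtain f i where f: "f \<in> W" "i < n" "\<beta> = f (simple i)" using b by (rule rootE)
    then have "neg \<beta> = (f \<circ> refl i) (simple i)" by (simp add: refl_simple)
    moreover have "(f \<circ> refl i) (simple i) \<in> roots" using f by (intro rootI comp_W) auto
    ultimately show ?thesis by simp
  qed
  then show ?thesis by (metis neg_neg)
qed

lemma root_bil: "\<beta> \<in> roots \<Longrightarrow> bil \<beta> \<beta> = 1"
  by (erule rootE) (simp add: bil_simple_simple)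

lemma root_pos_or_neg: "\<beta> \<in> roots \<Longrightarrow> pos \<beta> \<or> pos (neg \<beta>)"
  by (erule rootE) (use act_simple_pos_or_neg in \<open>auto simp: W_def\<close>)

lemma root_supp: "\<beta> \<in> roots \<Longrightarrow> supp_in {..<n} \<beta>"
  by (erule rootE) (auto simp: supp_in_def W_ge simple_def)

lemma root_nonzero: "\<beta> \<in> roots \<Longrightarrow> \<exists>k. \<beta> k \<noteq> 0"
proof (rule ccontr)
  assume b: "\<beta> \<in> roots" and "\<not> ?thesis"
  then have "bil \<beta> \<beta> = 0" by (simp add: bil_def)
  then show False using root_bil[OF b] by simp
qed

lemma root_not_pos: "\<beta> \<in> roots \<Longrightarrow> \<not> pos \<beta> \<longleftrightarrow> pos (neg \<beta>)"
proof -
  assume b: "\<beta> \<in> roots"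
  have "\<not> (pos \<beta> \<and> pos (neg \<beta>))"
  proof
    assume "pos \<beta> \<and> pos (neg \<beta>)"
    then have "\<beta> k = 0" for k by (simp add: pos_def neg_apply antisym)
    then show False using root_nonzero[OF b] by blast
  qed
  then show ?thesis using root_pos_or_neg[OF b] by blast
qed

lemma proot_root: "\<beta> \<in> proots \<Longrightarrow> \<beta> \<in> roots" and proot_pos: "\<beta> \<in> proots \<Longrightarrow> pos \<beta>"
  by (simp_all add: proots_def)

lemma proot_neg: "\<beta> \<in> roots \<Longrightarrow> \<not> pos \<beta> \<Longrightarrow> neg \<beta> \<in> proots"
  by (simp add: proots_def root_not_pos)

lemma proot_not_neg: "\<beta> \<in> proots \<Longrightarrow> neg \<beta> \<notin> proots"
  using root_not_pos by (auto simp: proots_def)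

lemma simple_proot [simp]: "i < n \<Longrightarrow> simple i \<in> proots"
  by (simp add: proots_def pos_simple)

text \<open>All roots have norm one, so the factor is \<open>1\<close> or \<open>- 1\<close>, and
  positivity leaves \<open>1\<close>.\<close>

lemma proot_multiple:
  assumes "\<beta> \<in> proots" "\<gamma> \<in> proots" "\<And>k. \<beta> k = a * \<gamma> k"
  shows "\<beta> = \<gamma>"
proof -
  have b: "\<beta> = lc a \<gamma> 0 \<gamma>" using assms(3) by (auto simp: lc_def)
  have "bil \<beta> \<beta> = a * a * bil \<gamma> \<gamma>" unfolding b by (simp add: bil_lc_left bil_lc_right)
  then have aa: "a * a = 1" using root_bil assms(1,2) by (simp add: proot_root)
  obtain k where k: "\<gamma> k \<noteq> 0" using root_nonzero assms(2) by (meson proot_root)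
  have "0 < \<gamma> k" using k assms(2) by (simp add: proots_def pos_def order_less_le)
  moreover have "0 \<le> a * \<gamma> k" using assms(3)[of k] posD proot_pos assms(1) by metis
  ultimately have "0 \<le> a" by (simp add: zero_le_mult_iff)
  then have "a = 1" using aa by (auto simp: square_eq_1_iff)
  then show ?thesis using assms(3) by auto
qed

lemma proot_other_coord:
  assumes "\<beta> \<in> proots" "i < n" "\<beta> \<noteq> simple i"
  shows "\<exists>k. k \<noteq> i \<and> 0 < \<beta> k"
proof (rule ccontr)
  assume "\<not> ?thesis"
  then have "\<beta> k = 0" if "k \<noteq> i" for k
    using that posD[OF proot_pos[OF assms(1)], of k] by (metis order_less_le)
  then have "\<beta> k = \<beta> i * simple i k" for k by (cases "k = i") (auto simp: simple_other)
  then show False using proot_multiple assms simple_proot by blast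
qed

text \<open>The reflection changes only coordinate \<open>i\<close>, and \<open>\<beta>\<close> has
  another positive coordinate; one positive coordinate makes a root positive.\<close>

lemma refl_proot:
  assumes "\<beta> \<in> proots" "i < n" "\<beta> \<noteq> simple i"
  shows "refl i \<beta> \<in> proots"
proof -
  have r: "refl i \<beta> \<in> roots" using roots_W[OF refl_W proot_root] assms by blast
  obtain k where "k \<noteq> i" "0 < \<beta> k" using proot_other_coord assms by blast
  then have "\<not> pos (neg (refl i \<beta>))" by (auto simp: pos_def refl_other not_le neg_apply intro!: exI[of _ k])
  then show ?thesis using r root_pos_or_neg by (auto simp: proots_def)
qed

lemma refl_eq_simple: "i < n \<Longrightarrow> refl i \<beta> = simple i \<longleftrightarrow> \<beta> = neg (simple i)"
  by (metis refl_refl refl_simple)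

lemma refl_proot_ne: "\<beta> \<in> proots \<Longrightarrow> i < n \<Longrightarrow> refl i \<beta> \<noteq> simple i"
  using refl_eq_simple proot_not_neg simple_proot by metis

section \<open>Inversion sets under multiplication by a simple reflection\<close>

lemma N_proot: "\<beta> \<in> N f \<Longrightarrow> \<beta> \<in> proots"
  by (simp add: N_def)

lemma N_id [simp]: "N id = {}"
  by (auto simp: N_def proots_def)

lemma N_left_simple: "f \<in> W \<Longrightarrow> s < n \<Longrightarrow> simple s \<in> N (refl s \<circ> f) \<longleftrightarrow> simple s \<notin> N f"
proof -
  assume f: "f \<in> W" "s < n"
  have "inv (refl s \<circ> f) (simple s) = neg (inv f (simple s))"
    using f by (simp add: inv_comp refl_simple)
  moreover have "inv f (simple s) \<in> roots" using f roots_W by simp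
  ultimately show ?thesis using f root_not_pos[of "inv f (simple s)"] by (auto simp: N_def)
qed

lemma N_left: "f \<in> W \<Longrightarrow> s < n \<Longrightarrow> \<beta> \<in> proots \<Longrightarrow> \<beta> \<noteq> simple s \<Longrightarrow> \<beta> \<in> N (refl s \<circ> f) \<longleftrightarrow> refl s \<beta> \<in> N f"
  by (simp add: N_def inv_comp refl_proot)

lemma N_left_up:
  assumes "f \<in> W" "s < n" "simple s \<notin> N f"
  shows "N (refl s \<circ> f) = insert (simple s) (refl s ` N f)"
proof (intro set_eqI iffI)
  fix \<beta> assume b: "\<beta> \<in> N (refl s \<circ> f)"
  show "\<beta> \<in> insert (simple s) (refl s ` N f)"
  proof (cases "\<beta> = simple s")
    case False
    then have "refl s \<beta> \<in> N f" using N_left assms b N_proot by blast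
    then show ?thesis by (metis assms(2) image_eqI insertCI refl_refl)
  qed simp
next
  fix \<beta> assume "\<beta> \<in> insert (simple s) (refl s ` N f)"
  then consider "\<beta> = simple s" | \<gamma> where "\<gamma> \<in> N f" "\<beta> = refl s \<gamma>" by blast
  then show "\<beta> \<in> N (refl s \<circ> f)"
  proof cases
    case 1 then show ?thesis using N_left_simple assms by simp
  next
    case 2
    then have g: "\<gamma> \<in> proots" "\<gamma> \<noteq> simple s" using assms N_proot by auto
    then have "\<beta> \<in> proots" "\<beta> \<noteq> simple s" using 2 refl_proot refl_proot_ne assms by auto
    then show ?thesis using N_left[of f s \<beta>] assms 2 by (simp add: refl_refl)
  qed
qed

lemma N_left_down:
  assumes "f \<in> W" "s < n" "simple s \<in> N f"
  shows "N f = insert (simple s) (refl s ` N (refl s \<circ> f))"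
proof -
  have "simple s \<notin> N (refl s \<circ> f)" using N_left_simple assms by blast
  from N_left_up[OF _ assms(2) this] assms have "N (refl s \<circ> (refl s \<circ> f)) = insert (simple s) (refl s ` N (refl s \<circ> f))" by blast
  moreover have "refl s \<circ> (refl s \<circ> f) = f" using assms(2) by (auto simp: refl_refl)
  ultimately show ?thesis by simp
qed

text \<open>\<open>refl i\<close> keeps the sign of every root except \<open>simple i\<close> and
  its negative, so the two inversion sets differ in one root.\<close>

lemma N_right_up:
  assumes "f \<in> W" "i < n" "pos (f (simple i))"
  shows "N (f \<circ> refl i) = insert (f (simple i)) (N f)" "f (simple i) \<notin> N f" "f (simple i) \<in> proots"
proof -
  show p: "f (simple i) \<in> proots" using assms roots_W by (simp add: proots_def)
  show "f (simple i) \<notin> N f" using assms by (simp add: N_def pos_simple)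
  have *: "pos (refl i \<rho>) \<longleftrightarrow> pos \<rho>" if "\<rho> \<in> roots" "\<rho> \<noteq> simple i" "\<rho> \<noteq> neg (simple i)" for \<rho>
  proof -
    have "pos (refl i \<rho>)" if "\<rho> \<in> roots" "\<rho> \<noteq> simple i" "pos \<rho>" for \<rho>
      using that refl_proot[of \<rho> i] assms(2) by (simp add: proots_def)
    then show ?thesis using that roots_W[of "refl i" \<rho>] assms(2)
      by (metis refl_W refl_eq_simple refl_refl)
  qed
  show "N (f \<circ> refl i) = insert (f (simple i)) (N f)"
  proof (intro set_eqI iffI)
    fix \<beta> assume b: "\<beta> \<in> N (f \<circ> refl i)"
    then have bp: "\<beta> \<in> proots" and br: "inv f \<beta> \<in> roots" using assms roots_W N_proot proot_root by auto
    have nb: "\<not> pos (refl i (inv f \<beta>))" using b assms by (simp add: N_def inv_comp)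
    show "\<beta> \<in> insert (f (simple i)) (N f)"
    proof (cases "inv f \<beta> = simple i \<or> inv f \<beta> = neg (simple i)")
      case True
      then show ?thesis using assms nb by (metis W_neg inv_right insertCI pos_simple refl_eq_simple)
    next
      case False
      then show ?thesis using *[OF br] nb bp by (simp add: N_def)
    qed
  next
    fix \<beta> assume b: "\<beta> \<in> insert (f (simple i)) (N f)"
    show "\<beta> \<in> N (f \<circ> refl i)"
    proof (cases "\<beta> = f (simple i)")
      case True
      then show ?thesis using p assms by (simp add: N_def inv_comp refl_simple not_pos_neg_simple[of i] root_not_pos)
    next
      case False
      then have bN: "\<beta> \<in> N f" using b by simp
      then have br: "inv f \<beta> \<in> roots" using assms roots_W N_proot proot_root by auto
      have "inv f \<beta> \<noteq> simple i" using False assms by (metis inv_right)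
      moreover have "inv f \<beta> \<noteq> neg (simple i)"
        using p bN N_proot proot_not_neg assms by (metis W_neg inv_right)
      ultimately show ?thesis using *[OF br] bN assms by (simp add: N_def inv_comp)
    qed
  qed
qed

lemma N_right_down:
  assumes "f \<in> W" "i < n" "\<not> pos (f (simple i))"
  shows "N f = insert (neg (f (simple i))) (N (f \<circ> refl i))" "neg (f (simple i)) \<notin> N (f \<circ> refl i)"
proof -
  define h where "h = f \<circ> refl i"
  have g: "h \<in> W" using assms by (auto simp: h_def)
  have r: "f (simple i) \<in> roots" using assms roots_W by simp
  have e: "h (simple i) = neg (f (simple i))" using assms by (simp add: refl_simple h_def)
  have p: "pos (h (simple i))" using e assms r root_not_pos by simp
  have hf: "h \<circ> refl i = f" using assms(2) by (auto simp: refl_refl h_def)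
  show "N f = insert (neg (f (simple i))) (N (f \<circ> refl i))" "neg (f (simple i)) \<notin> N (f \<circ> refl i)"
    unfolding h_def[symmetric] using N_right_up(1,2)[OF g assms(2) p] unfolding hf e by blast+
qed

lemma W_not_id:
  assumes "f \<in> W" "f \<noteq> id"
  shows "\<exists>i<n. \<not> pos (f (simple i))"
proof -
  obtain w where w: "w \<in> words n" "f = act w" using assms by (auto simp: W_def)
  have "0 < len w"
  proof (rule ccontr)
    assume "\<not> ?thesis"
    then obtain v where "w \<sim> v" "v = []" using len_attained[OF w(1)] by auto
    then show False using rel_act w assms by force
  qed
  then show ?thesis using ex_descent_word[OF w(1)] w root_not_pos roots_W assms simple_root by metis
qed

lemma N_right_subset:
  "f \<in> W \<Longrightarrow> i < n \<Longrightarrow> N (f \<circ> refl i) \<subseteq> insert (f (simple i)) (N f)"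
  using N_right_up(1)[of f i] N_right_down(1)[of f i] by (cases "pos (f (simple i))") auto

lemma finite_N_act: "w \<in> words n \<Longrightarrow> finite (N (act w))"
proof (induction w rule: rev_induct)
  case (snoc i w)
  then have "finite (N (act w \<circ> refl i))"
    using N_right_subset[of "act w" i] by (auto intro: finite_subset)
  moreover have "act (w @ [i]) = act w \<circ> refl i" by (simp add: act_append)
  ultimately show ?case by metis
qed simp

lemma finite_N: "f \<in> W \<Longrightarrow> finite (N f)"
  by (auto simp: W_def finite_N_act)

lemma card_N_le_length: "w \<in> words n \<Longrightarrow> card (N (act w)) \<le> length w"
proof (induction w rule: rev_induct)
  case (snoc i w)
  then have w: "w \<in> words n" "i < n" by auto
  have "N (act (w @ [i])) \<subseteq> insert (act w (simple i)) (N (act w))"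
    using N_right_subset[of "act w" i] w by (simp add: act_append)
  then have "card (N (act (w @ [i]))) \<le> card (insert (act w (simple i)) (N (act w)))"
    using finite_N w by (intro card_mono) auto
  also have "\<dots> \<le> Suc (card (N (act w)))" using finite_N w by (simp add: card_insert_if)
  finally show ?case using snoc w by simp
qed simp

lemma card_N_right_up:
  "f \<in> W \<Longrightarrow> i < n \<Longrightarrow> pos (f (simple i)) \<Longrightarrow> card (N (f \<circ> refl i)) = Suc (card (N f))"
  by (simp add: N_right_up finite_N)

lemma card_N_right_down:
  "f \<in> W \<Longrightarrow> i < n \<Longrightarrow> \<not> pos (f (simple i)) \<Longrightarrow> card (N f) = Suc (card (N (f \<circ> refl i)))"
  using N_right_down[of f i] finite_N[of "f \<circ> refl i"] by (metis card_insert_disjoint comp_W refl_W)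

lemma inj_refl: "s < n \<Longrightarrow> inj (refl s)"
  by (metis injI refl_refl)

lemma card_N_left_down:
  assumes "f \<in> W" "s < n" "simple s \<in> N f"
  shows "card (N f) = Suc (card (N (refl s \<circ> f)))"
proof -
  have g: "refl s \<circ> f \<in> W" using assms by auto
  have ns: "simple s \<notin> refl s ` N (refl s \<circ> f)"
    using refl_proot_ne N_proot assms(2) by (metis imageE)
  have "card (N f) = Suc (card (refl s ` N (refl s \<circ> f)))"
    using N_left_down[OF assms] ns finite_N[OF g] by (metis card_insert_disjoint finite_imageI)
  then show ?thesis using inj_refl[OF assms(2)] by (metis card_image inj_on_subset subset_UNIV)
qed

lemma N_empty: "f \<in> W \<Longrightarrow> N f = {} \<Longrightarrow> f = id"
  using W_not_id N_right_down(1) by (metis insert_not_empty)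

text \<open>A simple root made negative by \<open>inv w \<circ> u\<close> is an ascent of
  \<open>u\<close> that stays below \<open>w\<close>. This is the step by which one climbs inside an
  interval.\<close>

lemma ascent_below:
  assumes "u \<in> W" "w \<in> W" "N u \<subseteq> N w" "u \<noteq> w"
  shows "\<exists>i<n. pos (u (simple i)) \<and> u (simple i) \<in> N w"
proof -
  define g where "g = inv w \<circ> u"
  have g: "g \<in> W" using assms by (auto simp: g_def)
  have "g \<noteq> id"
  proof
    assume "g = id"
    then have "\<And>v. inv w (u v) = v" by (metis comp_apply g_def id_apply)
    then have "u = w" using assms by (metis ext inv_right)
    then show False using assms by simp
  qed
  then obtain i where i: "i < n" "\<not> pos (g (simple i))" using W_not_id g by blast
  have r: "u (simple i) \<in> roots" using assms i roots_W by simp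
  have "pos (u (simple i))"
  proof (rule ccontr)
    assume a: "\<not> ?thesis"
    then have "neg (u (simple i)) \<in> N w" using N_right_down(1)[of u i] assms i by blast
    then have "\<not> pos (neg (g (simple i)))" using assms(2) by (simp add: N_def g_def)
    then show False using i root_pos_or_neg g roots_W simple_root by blast
  qed
  moreover from this have "u (simple i) \<in> N w" using i r by (simp add: N_def proots_def g_def)
  ultimately show ?thesis using i by blast
qed

lemma descent_above:
  assumes "u \<in> W" "w \<in> W" "N u \<subseteq> N w" "u \<noteq> w"
  shows "\<exists>i<n. \<not> pos (w (simple i)) \<and> neg (w (simple i)) \<notin> N u"
proof -
  define g where "g = inv u \<circ> w"
  have g: "g \<in> W" using assms by (auto simp: g_def)
  have "g \<noteq> id"
  proof
    assume "g = id"
    then have "\<And>v. inv u (w v) = v" by (metis comp_apply g_def id_apply)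
    then have "u = w" using assms by (metis ext inv_right)
    then show False using assms by simp
  qed
  then obtain i where i: "i < n" "\<not> pos (g (simple i))" using W_not_id g by blast
  have r: "w (simple i) \<in> roots" using assms i roots_W by simp
  have "\<not> pos (w (simple i))"
  proof
    assume a: "pos (w (simple i))"
    then have "w (simple i) \<in> N u" using i r by (simp add: N_def proots_def g_def)
    then show False using a assms N_right_up(2)[of w i] i by blast
  qed
  moreover have "neg (w (simple i)) \<notin> N u"
    using i assms root_pos_or_neg[of "g (simple i)"] g roots_W by (auto simp: N_def g_def)
  ultimately show ?thesis using i by blast
qed

lemma N_closed:
  assumes "f \<in> W" "\<beta> \<in> N f" "\<gamma> \<in> N f" "0 \<le> a" "0 \<le> b" "lc a \<beta> b \<gamma> \<in> roots"
  shows "lc a \<beta> b \<gamma> \<in> N f"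
proof -
  have r: "inv f \<beta> \<in> roots" "inv f \<gamma> \<in> roots" "inv f (lc a \<beta> b \<gamma>) \<in> roots"
    using assms N_proot roots_W proot_root inv_W by blast+
  have "pos (neg (inv f \<beta>))" "pos (neg (inv f \<gamma>))" using assms r root_not_pos by (auto simp: N_def)
  then have "pos (neg (inv f (lc a \<beta> b \<gamma>)))" using assms by (simp add: W_lc neg_lc pos_lc)
  then have "\<not> pos (inv f (lc a \<beta> b \<gamma>))" using r root_not_pos by blast
  moreover have "pos (lc a \<beta> b \<gamma>)" using assms N_proot proot_pos pos_lc by blast
  ultimately show ?thesis using assms by (simp add: N_def proots_def)
qed

lemma N_coclosed:
  assumes "f \<in> W" "\<beta> \<in> proots" "\<gamma> \<in> proots" "0 \<le> a" "0 \<le> b" "lc a \<beta> b \<gamma> \<in> N f"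
  shows "\<beta> \<in> N f \<or> \<gamma> \<in> N f"
  using assms pos_lc by (auto simp: N_def W_lc)

text \<open>As \<open>z\<close> maps a simple root to \<open>- \<gamma>\<close>, the sign of the preimage of \<open>a \<gamma> + b \<zeta>\<close> is decided by
  another coordinate, to which only \<open>\<zeta>\<close> contributes.\<close>

lemma wall_not_N:
  assumes "z \<in> W" "k < n" "z (simple k) = neg \<gamma>" "\<zeta> \<in> roots" "pos (inv z \<zeta>)" "\<zeta> \<noteq> neg \<gamma>" "0 < b"
  shows "lc a \<gamma> b \<zeta> \<notin> N z"
proof
  assume n: "lc a \<gamma> b \<zeta> \<in> N z"
  have p: "inv z \<zeta> \<in> proots" using assms roots_W by (simp add: proots_def)
  have "inv z \<zeta> \<noteq> simple k" using assms by (metis inv_right)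
  then obtain l where l: "l \<noteq> k" "0 < inv z \<zeta> l" using proot_other_coord p assms by blast
  have "inv z \<gamma> = neg (simple k)" using assms by (metis W_neg inv_left neg_neg)
  then have "inv z (lc a \<gamma> b \<zeta>) l = b * inv z \<zeta> l" using assms l by (simp add: W_lc lc_apply simple_other neg_apply)
  then have "0 < inv z (lc a \<gamma> b \<zeta>) l" using l assms by simp
  moreover have "pos (neg (inv z (lc a \<gamma> b \<zeta>)))"
    using n assms(1) roots_W[of "inv z" "lc a \<gamma> b \<zeta>"] root_not_pos proot_root by (auto simp: N_def)
  ultimately show False by (metis neg_apply neg_0_le_iff_le not_le posD)
qed

lemma refl_supp: "s \<in> J \<Longrightarrow> supp_in J (refl s v) \<longleftrightarrow> supp_in J v"
  by (metis refl_other supp_in_def)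

text \<open>Left descents in \<open>J\<close> are stripped one by one. Once none is left,
  \<open>inv x\<close> keeps every simple root of \<open>J\<close> positive, hence also every
  positive root supported in \<open>J\<close>, and the projection is trivial.\<close>

lemma parabolic_projection:
  assumes "x \<in> W"
  shows "\<exists>u\<in>W. N u = {\<beta> \<in> N x. supp_in J \<beta>}"
  using assms
proof (induction "card (N x)" arbitrary: x rule: less_induct)
  case less
  show ?case
  proof (cases "\<exists>s\<in>J. s < n \<and> simple s \<in> N x")
    case False
    have "\<beta> \<notin> N x" if b: "supp_in J \<beta>" for \<beta>
    proof
      assume bN: "\<beta> \<in> N x"
      have br: "\<beta> \<in> roots" "pos \<beta>" using bN N_proot proot_pos proot_root by auto
      have "0 \<le> \<beta> i * inv x (simple i) k" if "i < n" for i k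
      proof (cases "i \<in> J")
        case True
        then have "pos (inv x (simple i))" using False that by (auto simp: N_def)
        then show ?thesis using br by (simp add: pos_def)
      qed (use b in \<open>simp add: supp_in_def\<close>)
      then have "0 \<le> inv x \<beta> k" for k
        using W_expand[of "inv x" \<beta> k] less.prems br root_supp by (auto intro: sum_nonneg)
      then show False using bN by (simp add: N_def pos_def)
    qed
    then have "N id = {\<beta> \<in> N x. supp_in J \<beta>}" by auto
    then show ?thesis by blast
  next
    case True
    then obtain s where s: "s \<in> J" "s < n" "simple s \<in> N x" by blast
    define x' where "x' = refl s \<circ> x"
    have x': "x' \<in> W" using less.prems s by (auto simp: x'_def)
    have Nx: "N x = insert (simple s) (refl s ` N x')"
      unfolding x'_def using N_left_down less.prems s by blast
    have sx': "simple s \<notin> N x'" using N_left_simple less.prems s by (simp add: x'_def)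
    have "card (N x') < card (N x)" using card_N_left_down[of x s] less.prems s by (simp add: x'_def)
    from less.hyps[OF this x'] obtain u where u: "u \<in> W" "N u = {\<beta> \<in> N x'. supp_in J \<beta>}" by blast
    have "N (refl s \<circ> u) = insert (simple s) (refl s ` N u)"
      using N_left_up u sx' s by simp
    also have "\<dots> = {\<beta> \<in> N x. supp_in J \<beta>}"
      unfolding u Nx using s by (auto simp: refl_supp)
    finally show ?thesis using u s by blast
  qed
qed

section \<open>The Euler form and sortable elements\<close>

text \<open>The Euler form of the Coxeter element with word \<open>q\<close>: on simple roots \<open>E (\<alpha>\<^sub>i, \<alpha>\<^sub>j)\<close> is \<open>0\<close> if \<open>i\<close>
  precedes \<open>j\<close> in \<open>q\<close>, and \<open>2 bm i j\<close> if \<open>i\<close> follows \<open>j\<close>. Its antisymmetrisation is the form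
  \<open>\<omega>\<^sub>c\<close> of Reading and Speyer. Moving the first letter to the end of \<open>q\<close> conjugates the Coxeter element.\<close>

fun E :: "nat list \<Rightarrow> vec \<Rightarrow> vec \<Rightarrow> real" where
  "E [] u v = 0"
| "E (s # q) u v = u s * v s + 2 * v s * (\<Sum>j\<in>set q. bm j s * u j) + E q u v"

definition letters :: "nat list \<Rightarrow> bool" where
  "letters q \<longleftrightarrow> distinct q \<and> set q \<subseteq> {..<n}"

lemma letters_Cons: "letters (s # q) \<longleftrightarrow> s < n \<and> s \<notin> set q \<and> letters q"
  by (auto simp: letters_def)

lemma letters_snoc: "letters (q @ [s]) \<longleftrightarrow> letters (s # q)"
  by (auto simp: letters_def)

lemma letters_less: "letters q \<Longrightarrow> s \<in> set q \<Longrightarrow> s < n"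
  by (auto simp: letters_def)

lemma E_lc_left: "E q (lc a u b u') v = a * E q u v + b * E q u' v"
proof (induction q)
  case (Cons s q)
  have "(\<Sum>j\<in>set q. bm j s * lc a u b u' j) = a * (\<Sum>j\<in>set q. bm j s * u j) + b * (\<Sum>j\<in>set q. bm j s * u' j)"
    by (simp add: lc_apply sum_distrib_left sum.distrib [symmetric] algebra_simps)
  then show ?case using Cons by (simp add: lc_apply algebra_simps)
qed simp

lemma E_lc_right: "E q v (lc a u b u') = a * E q v u + b * E q v u'"
  by (induction q) (auto simp: lc_apply algebra_simps)

lemma E_cong: "(\<And>k. k \<in> set q \<Longrightarrow> u k = u' k) \<Longrightarrow> (\<And>k. k \<in> set q \<Longrightarrow> v k = v' k) \<Longrightarrow> E q u v = E q u' v'"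
proof (induction q)
  case (Cons s q)
  have "(\<Sum>j\<in>set q. bm j s * u j) = (\<Sum>j\<in>set q. bm j s * u' j)"
    by (intro sum.cong) (use Cons.prems in auto)
  then show ?case using Cons by simp
qed simp

lemma E_zero_left: "(\<And>k. k \<in> set q \<Longrightarrow> u k = 0) \<Longrightarrow> E q u v = 0"
  by (induction q) auto

lemma E_zero_right: "(\<And>k. k \<in> set q \<Longrightarrow> v k = 0) \<Longrightarrow> E q u v = 0"
  by (induction q) auto

lemma E_snoc:
  "letters (q @ [s]) \<Longrightarrow> E (q @ [s]) u v = E q u v + u s * v s + 2 * u s * (\<Sum>j\<in>set q. bm j s * v j)"
proof (induction q)
  case (Cons t q)
  have l: "letters (q @ [s])" "t \<noteq> s" "s \<notin> set q" "t \<notin> set q" "s < n" "t < n"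
    using Cons.prems by (auto simp: letters_def)
  have "(\<Sum>j\<in>set (q @ [s]). bm j t * u j) = bm s t * u s + (\<Sum>j\<in>set q. bm j t * u j)"
    using l by simp
  then show ?case using Cons.IH[OF l(1)] l by (simp add: algebra_simps bm_sym[of s t])
qed simp

lemma E_sum: "letters q \<Longrightarrow> E q u v + E q v u = 2 * (\<Sum>i\<in>set q. \<Sum>j\<in>set q. u i * v j * bm i j)"
proof (induction q)
  case (Cons s q)
  have l: "letters q" "s \<notin> set q" "s < n" "set q \<subseteq> {..<n}"
    using Cons.prems by (auto simp: letters_def)
  have "(\<Sum>i\<in>set (s # q). \<Sum>j\<in>set (s # q). u i * v j * bm i j)
     = u s * v s + (\<Sum>j\<in>set q. u s * v j * bm s j) + (\<Sum>i\<in>set q. u i * v s * bm i s)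
       + (\<Sum>i\<in>set q. \<Sum>j\<in>set q. u i * v j * bm i j)"
    using l by (simp add: sum.distrib)
  also have "(\<Sum>j\<in>set q. u s * v j * bm s j) = u s * (\<Sum>j\<in>set q. bm j s * v j)"
    unfolding sum_distrib_left by (intro sum.cong) (use l bm_sym in \<open>auto simp: subset_iff\<close>)
  also have "(\<Sum>i\<in>set q. u i * v s * bm i s) = v s * (\<Sum>j\<in>set q. bm j s * u j)"
    unfolding sum_distrib_left by (intro sum.cong) auto
  finally show ?case using Cons.IH[OF l(1)] by (simp add: algebra_simps)
qed simp

lemma bil_supp:
  assumes "J \<subseteq> {..<n}" "supp_in J u" "supp_in J v"
  shows "bil u v = (\<Sum>i\<in>J. \<Sum>j\<in>J. u i * v j * bm i j)"
proof -
  have "(\<Sum>j<n. u i * v j * bm i j) = (\<Sum>j\<in>J. u i * v j * bm i j)" for i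
    by (rule sum.mono_neutral_right) (use assms in \<open>auto simp: supp_in_def\<close>)
  then have "bil u v = (\<Sum>i<n. \<Sum>j\<in>J. u i * v j * bm i j)" by (simp add: bil_def)
  also have "\<dots> = (\<Sum>i\<in>J. \<Sum>j\<in>J. u i * v j * bm i j)"
    by (rule sum.mono_neutral_right) (use assms in \<open>auto simp: supp_in_def\<close>)
  finally show ?thesis .
qed

lemma E_bil:
  "letters q \<Longrightarrow> supp_in (set q) u \<Longrightarrow> supp_in (set q) v \<Longrightarrow> E q u v + E q v u = 2 * bil u v"
  using E_sum[of q u v] bil_supp[of "set q" u v] by (simp add: letters_def)

lemma bil_simple_supp:
  assumes "letters (s # q)" "supp_in (set (s # q)) v"
  shows "bil v (simple s) = v s + (\<Sum>j\<in>set q. bm j s * v j)"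
proof -
  have "bil v (simple s) = (\<Sum>j<n. v j * bm j s)" using assms bil_simple by (simp add: letters_Cons)
  also have "\<dots> = (\<Sum>j\<in>set (s # q). v j * bm j s)"
    by (rule sum.mono_neutral_right) (use assms in \<open>auto simp: supp_in_def letters_def\<close>)
  also have "\<dots> = v s + (\<Sum>j\<in>set q. bm j s * v j)"
    using assms by (simp add: letters_Cons mult.commute)
  finally show ?thesis .
qed

lemma refl_at:
  assumes "letters (s # q)" "supp_in (set (s # q)) v"
  shows "refl s v s = - v s - 2 * (\<Sum>j\<in>set q. bm j s * v j)"
  using bil_simple_supp[OF assms] by (simp add: refl_def lc_apply algebra_simps)

text \<open>\<open>refl s\<close> alters only coordinate \<open>s\<close>, by exactly the sum that
  changes sides when \<open>s\<close> moves from first to last. This carries the alignment condition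
  through an accepted letter.\<close>

lemma E_refl:
  assumes l: "letters (s # q)" and u: "supp_in (set (s # q)) u" and v: "supp_in (set (s # q)) v"
  shows "E (q @ [s]) (refl s u) (refl s v) = E (s # q) u v"
proof -
  have sq: "s \<notin> set q" using l by (simp add: letters_Cons)
  have o: "refl s w k = w k" if "k \<in> set q" for k w using that sq refl_other by metis
  have "E q (refl s u) (refl s v) = E q u v" by (rule E_cong) (simp_all add: o)
  moreover have "(\<Sum>j\<in>set q. bm j s * refl s v j) = (\<Sum>j\<in>set q. bm j s * v j)" by (simp add: o)
  ultimately show ?thesis
    using E_snoc[of q s "refl s u" "refl s v"] l refl_at[OF l u] refl_at[OF l v]
    by (simp add: letters_snoc algebra_simps)
qed

lemma E_refl':
  assumes l: "letters (s # q)" and u: "supp_in (set (s # q)) u" and v: "supp_in (set (s # q)) v"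
  shows "E (s # q) (refl s u) (refl s v) = E (q @ [s]) u v"
  using E_refl[OF l, of "refl s u" "refl s v"] u v l by (simp add: refl_supp refl_refl letters_Cons)

lemma E_first_left: "letters (s # q) \<Longrightarrow> E (s # q) (simple s) v = v s"
proof -
  assume l: "letters (s # q)"
  have o: "simple s k = 0" if "k \<in> set q" for k by (rule simple_other) (use that l in \<open>auto simp: letters_Cons\<close>)
  have "E q (simple s) v = 0" by (rule E_zero_left) (rule o)
  moreover have "(\<Sum>j\<in>set q. bm j s * simple s j) = 0" by (intro sum.neutral) (simp add: o)
  ultimately show ?thesis by simp
qed

lemma E_first_right: "letters (s # q) \<Longrightarrow> E (s # q) v (simple s) = v s + 2 * (\<Sum>j\<in>set q. bm j s * v j)"
proof -
  assume l: "letters (s # q)"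
  have "E q v (simple s) = 0" by (rule E_zero_right, rule simple_other) (use l in \<open>auto simp: letters_Cons\<close>)
  then show ?thesis by simp
qed

lemma E_last_right: "letters (s # q) \<Longrightarrow> E (q @ [s]) v (simple s) = v s"
proof -
  assume l: "letters (s # q)"
  have o: "simple s k = 0" if "k \<in> set q" for k by (rule simple_other) (use that l in \<open>auto simp: letters_Cons\<close>)
  have "E q v (simple s) = 0" by (rule E_zero_right) (rule o)
  moreover have "(\<Sum>j\<in>set q. bm j s * simple s j) = 0" by (intro sum.neutral) (simp add: o)
  ultimately show ?thesis using E_snoc[of q s v "simple s"] l by (simp add: letters_snoc)
qed

lemma E_last_left: "letters (s # q) \<Longrightarrow> E (q @ [s]) (simple s) v = v s + 2 * (\<Sum>j\<in>set q. bm j s * v j)"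
proof -
  assume l: "letters (s # q)"
  have "E q (simple s) v = 0" by (rule E_zero_left, rule simple_other) (use l in \<open>auto simp: letters_Cons\<close>)
  then show ?thesis using E_snoc[of q s "simple s" v] l by (simp add: letters_snoc)
qed

lemma bm_sum_nonpos: "letters (s # q) \<Longrightarrow> pos v \<Longrightarrow> (\<Sum>j\<in>set q. bm j s * v j) \<le> 0"
proof (rule sum_nonpos)
  fix j assume l: "letters (s # q)" "pos v" "j \<in> set q"
  then have "bm j s \<le> 0" by (intro bm_le_0) (auto simp: letters_def)
  then show "bm j s * v j \<le> 0" using l by (simp add: pos_def mult_nonpos_nonneg)
qed

text \<open>The two sides differ by twice a sum of nonpositive terms \<open>bm j s * v j\<close>.
  Thus the simple root of the first letter comes first against every positive vector.\<close>

lemma E_first_le: "letters (s # q) \<Longrightarrow> pos v \<Longrightarrow> E (s # q) v (simple s) \<le> E (s # q) (simple s) v"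
  using bm_sum_nonpos[of s q v] E_first_left[of s q v] E_first_right[of s q v] by simp

lemma E_rest:
  "s \<notin> set q \<Longrightarrow> supp_in (set q) u \<Longrightarrow> supp_in (set q) v \<Longrightarrow> E (s # q) u v = E q u v"
  by (simp add: supp_in_def)

text \<open>The alignment condition at \<open>\<gamma>\<close>: of two positive roots decomposing \<open>\<gamma>\<close>, the set \<open>X\<close> must contain the one
  that \<open>\<omega>\<^sub>c\<close> puts first.\<close>

definition good :: "nat list \<Rightarrow> vec \<Rightarrow> vec set \<Rightarrow> bool" where
  "good q \<gamma> X \<longleftrightarrow> (\<forall>\<beta>1\<in>proots. \<forall>\<beta>3\<in>proots. \<forall>a b. 0 < a \<longrightarrow> 0 < b \<longrightarrow> \<gamma> = lc a \<beta>1 b \<beta>3 \<longrightarrow>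
      E q \<beta>3 \<beta>1 \<le> E q \<beta>1 \<beta>3 \<longrightarrow> \<beta>1 \<in> X)"

lemma goodI:
  "(\<And>\<beta>1 \<beta>3 a b. \<beta>1 \<in> proots \<Longrightarrow> \<beta>3 \<in> proots \<Longrightarrow> 0 < a \<Longrightarrow> 0 < b \<Longrightarrow> \<gamma> = lc a \<beta>1 b \<beta>3 \<Longrightarrow>
      E q \<beta>3 \<beta>1 \<le> E q \<beta>1 \<beta>3 \<Longrightarrow> \<beta>1 \<in> X) \<Longrightarrow> good q \<gamma> X"
  unfolding good_def by blast

lemma goodD:
  "good q \<gamma> X \<Longrightarrow> \<beta>1 \<in> proots \<Longrightarrow> \<beta>3 \<in> proots \<Longrightarrow> 0 < a \<Longrightarrow> 0 < b \<Longrightarrow> \<gamma> = lc a \<beta>1 b \<beta>3 \<Longrightarrow>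
      E q \<beta>3 \<beta>1 \<le> E q \<beta>1 \<beta>3 \<Longrightarrow> \<beta>1 \<in> X"
  unfolding good_def by blast

lemma good_mono: "good q \<gamma> X \<Longrightarrow> X \<subseteq> Y \<Longrightarrow> good q \<gamma> Y"
  unfolding good_def by blast

text \<open>Positive summands of \<open>\<gamma>\<close> are supported where \<open>\<gamma>\<close>
  is, and there the two forms agree.\<close>

lemma good_rest:
  assumes "s \<notin> set q" "supp_in (set q) \<gamma>"
  shows "good (s # q) \<gamma> X \<longleftrightarrow> good q \<gamma> X"
proof -
  have *: "E (s # q) \<beta> \<beta>' = E q \<beta> \<beta>' \<and> E (s # q) \<beta>' \<beta> = E q \<beta>' \<beta>"
    if "\<beta> \<in> proots" "\<beta>' \<in> proots" "0 < a" "0 < b" "\<gamma> = lc a \<beta> b \<beta>'" for \<beta> \<beta>' a b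
    using supp_in_pos_lc[of "set q" a \<beta> b \<beta>'] that assms proot_pos E_rest by metis
  show ?thesis
  proof
    assume g: "good (s # q) \<gamma> X"
    show "good q \<gamma> X" by (rule goodI) (metis * goodD[OF g])
  next
    assume g: "good q \<gamma> X"
    show "good (s # q) \<gamma> X" by (rule goodI) (metis * goodD[OF g])
  qed
qed

lemma simple_decomp:
  assumes "i < n" "\<beta>1 \<in> proots" "\<beta>3 \<in> proots" "0 < a" "0 < b" "simple i = lc a \<beta>1 b \<beta>3"
  shows "\<beta>1 = simple i"
proof (rule ccontr)
  assume "\<beta>1 \<noteq> simple i"
  then obtain k where k: "k \<noteq> i" "0 < \<beta>1 k" using proot_other_coord assms by blast
  have "0 < a * \<beta>1 k + b * \<beta>3 k"
    using k assms posD[OF proot_pos[OF assms(3)]] by (simp add: add_pos_nonneg)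
  then have "0 < simple i k" using assms(6) by (simp add: lc_apply)
  then show False using k by (simp add: simple_other)
qed

lemma good_simple: "i < n \<Longrightarrow> simple i \<in> X \<Longrightarrow> good q (simple i) X"
  by (rule goodI) (metis simple_decomp)

text \<open>Excludes \<open>simple s\<close> as a summand on the wrong side of the order: such a
  comparison makes the sum nonnegative, and then the reflected root has a negative coordinate at
  \<open>s\<close>.\<close>

lemma refl_coord_neg:
  assumes "letters (s # q)" "supp_in (set (s # q)) \<beta>" "pos \<beta>" "0 < a" "0 \<le> b"
    "0 \<le> (\<Sum>j\<in>set q. bm j s * \<beta> j)"
  shows "\<not> pos (refl s (lc a (simple s) b \<beta>))"
proof -
  have "refl s (lc a (simple s) b \<beta>) s = lc a (refl s (simple s)) b (refl s \<beta>) s" by (simp add: refl_lc)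
  also have "\<dots> = - a + b * (- \<beta> s - 2 * (\<Sum>j\<in>set q. bm j s * \<beta> j))"
    using refl_at[OF assms(1,2)] assms(1) by (simp add: lc_apply refl_simple letters_Cons neg_apply)
  also have "\<dots> < 0"
  proof -
    have "b * (- \<beta> s - 2 * (\<Sum>j\<in>set q. bm j s * \<beta> j)) \<le> 0"
      using assms posD[OF assms(3), of s] by (intro mult_nonneg_nonpos) auto
    then show ?thesis using assms by simp
  qed
  finally show ?thesis by (auto simp: pos_def not_le)
qed

text \<open>Apply \<open>refl s\<close> to a decomposition. The order rules out
  \<open>\<beta>1 = simple s\<close> by \<open>refl_coord_neg\<close>; if
  \<open>\<beta>3 = simple s\<close>, then \<open>refl s \<beta>1\<close> is a nonnegative
  combination of the inversions \<open>\<gamma>\<close> and \<open>simple s\<close>; otherwise both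
  summands stay positive and \<open>E_refl'\<close> translates the order.\<close>

lemma good_refl:
  assumes l: "letters (s # q)" and x: "x \<in> W" "simple s \<in> N x" and g: "\<gamma> \<in> N x" "\<gamma> \<noteq> simple s"
    and sup: "supp_in (set (s # q)) \<gamma>" and good: "good (s # q) \<gamma> (N x)"
  shows "good (q @ [s]) (refl s \<gamma>) (N (refl s \<circ> x))"
proof (rule goodI)
  fix \<beta>1 \<beta>3 a b
  assume b: "\<beta>1 \<in> proots" "\<beta>3 \<in> proots" "0 < a" "0 < b" "refl s \<gamma> = lc a \<beta>1 b \<beta>3"
    and e: "E (q @ [s]) \<beta>3 \<beta>1 \<le> E (q @ [s]) \<beta>1 \<beta>3"
  have s: "s < n" "s \<notin> set q" using l by (auto simp: letters_Cons)
  have gp: "\<gamma> \<in> proots" using g N_proot by blast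
  have supr: "supp_in (set (s # q)) (lc a \<beta>1 b \<beta>3)" using sup by (simp add: b(5)[symmetric] refl_supp)
  have sb: "supp_in (set (s # q)) \<beta>1" "supp_in (set (s # q)) \<beta>3"
    using supp_in_pos_lc[OF supr] b proot_pos by blast+
  have geq: "\<gamma> = refl s (lc a \<beta>1 b \<beta>3)" using b(5) s by (metis refl_refl)
  have n1: "\<beta>1 \<noteq> simple s"
  proof
    assume a1: "\<beta>1 = simple s"
    have "\<beta>3 s \<le> \<beta>3 s + 2 * (\<Sum>j\<in>set q. bm j s * \<beta>3 j)"
      using e E_last_right[OF l, of \<beta>3] E_last_left[OF l, of \<beta>3] unfolding a1 by simp
    then have "\<not> pos (refl s (lc a \<beta>1 b \<beta>3))"
      unfolding a1 using refl_coord_neg[OF l sb(2) proot_pos[OF b(2)] b(3)] b(4) by simp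
    then show False using geq gp proot_pos by simp
  qed
  have "refl s \<beta>1 \<in> N x"
  proof (cases "\<beta>3 = simple s")
    case True
    have "refl s \<beta>1 = lc (1 / a) \<gamma> (b / a) (simple s)"
      unfolding geq True refl_lc using s b(3) by (auto simp: refl_simple lc_def neg_def field_simps)
    moreover have "refl s \<beta>1 \<in> roots" using roots_W s b proot_root by simp
    ultimately show ?thesis
      using N_closed[OF x(1) g(1) x(2), of "1 / a" "b / a"] b by simp
  next
    case False
    have p: "refl s \<beta>1 \<in> proots" "refl s \<beta>3 \<in> proots" using refl_proot b s n1 False by auto
    have "\<gamma> = lc a (refl s \<beta>1) b (refl s \<beta>3)" using geq by (simp add: refl_lc)
    moreover have "E (s # q) (refl s \<beta>3) (refl s \<beta>1) \<le> E (s # q) (refl s \<beta>1) (refl s \<beta>3)"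
      using e E_refl'[OF l] sb by (simp del: E.simps)
    ultimately show ?thesis using goodD[OF good] p b by blast
  qed
  then show "\<beta>1 \<in> N (refl s \<circ> x)" using N_left x s b n1 by simp
qed

text \<open>Now \<open>\<beta>1 = simple s\<close> is harmless, being an inversion, and it is
  \<open>\<beta>3 = simple s\<close> that the order rules out.\<close>

lemma good_refl_rev:
  assumes l: "letters (s # q)" and x: "x \<in> W" "simple s \<in> N x" and g: "\<gamma> \<in> N x" "\<gamma> \<noteq> simple s"
    and sup: "supp_in (set (s # q)) \<gamma>" and good: "good (q @ [s]) (refl s \<gamma>) (N (refl s \<circ> x))"
  shows "good (s # q) \<gamma> (N x)"
proof (rule goodI)
  fix \<beta>1 \<beta>3 a b
  assume b: "\<beta>1 \<in> proots" "\<beta>3 \<in> proots" "0 < a" "0 < b" "\<gamma> = lc a \<beta>1 b \<beta>3"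
    and e: "E (s # q) \<beta>3 \<beta>1 \<le> E (s # q) \<beta>1 \<beta>3"
  have s: "s < n" "s \<notin> set q" using l by (auto simp: letters_Cons)
  have gp: "\<gamma> \<in> proots" using g N_proot by blast
  have sb: "supp_in (set (s # q)) \<beta>1" "supp_in (set (s # q)) \<beta>3"
    using supp_in_pos_lc[of _ a \<beta>1 b \<beta>3] b proot_pos sup by blast+
  show "\<beta>1 \<in> N x"
  proof (cases "\<beta>1 = simple s")
    case False
    have n3: "\<beta>3 \<noteq> simple s"
    proof
      assume a1: "\<beta>3 = simple s"
      have "\<beta>1 s \<le> \<beta>1 s + 2 * (\<Sum>j\<in>set q. bm j s * \<beta>1 j)"
        using e E_first_right[OF l, of \<beta>1] E_first_left[OF l, of \<beta>1] unfolding a1 by simp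
      then have "\<not> pos (refl s (lc b (simple s) a \<beta>1))"
        using refl_coord_neg[OF l sb(1) proot_pos[OF b(1)] b(4)] b(3) by simp
      moreover have "\<gamma> = lc b (simple s) a \<beta>1" using b(5) a1 by (simp add: lc_def add.commute)
      ultimately show False using refl_proot[OF gp s(1) g(2)] proot_pos by simp
    qed
    have p: "refl s \<beta>1 \<in> proots" "refl s \<beta>3 \<in> proots" using refl_proot b s n3 False by auto
    have "refl s \<gamma> = lc a (refl s \<beta>1) b (refl s \<beta>3)" using b by (simp add: refl_lc)
    moreover have "E (q @ [s]) (refl s \<beta>3) (refl s \<beta>1) \<le> E (q @ [s]) (refl s \<beta>1) (refl s \<beta>3)"
      using e E_refl[OF l] sb by (simp del: E.simps)
    ultimately have "refl s \<beta>1 \<in> N (refl s \<circ> x)" using goodD[OF good] p b by blast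
    then have "refl s (refl s \<beta>1) \<in> N x"
      using N_left[OF x(1) s(1) p(1)] refl_proot_ne b s by blast
    then show ?thesis using s by (simp add: refl_refl)
  qed (use x in simp)
qed

text \<open>The recursive form of sortability: an accepted first letter is moved to the end of the word, a
  rejected one is deleted for good, which is what nestedness of the passes amounts to.\<close>

inductive sortable :: "nat list \<Rightarrow> (vec \<Rightarrow> vec) \<Rightarrow> bool" where
  nil: "sortable [] id"
| acc: "w \<in> W \<Longrightarrow> simple s \<in> N w \<Longrightarrow> sortable (q @ [s]) (refl s \<circ> w) \<Longrightarrow> sortable (s # q) w"
| rej: "simple s \<notin> N w \<Longrightarrow> sortable q w \<Longrightarrow> sortable (s # q) w"

inductive_cases sortable_ConsE: "sortable (s # q) w"

lemma sortable_W: "sortable q w \<Longrightarrow> w \<in> W"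
  by (induction rule: sortable.induct) (rule id_W, assumption, assumption)

text \<open>Membership in the standard parabolic subgroup of \<open>J\<close>, in terms of inversions.\<close>

definition inP :: "nat set \<Rightarrow> (vec \<Rightarrow> vec) \<Rightarrow> bool" where
  "inP J w \<longleftrightarrow> w \<in> W \<and> (\<forall>\<beta>\<in>N w. supp_in J \<beta>)"

lemma inP_id [simp]: "inP J id"
  by (simp add: inP_def)

lemma inP_mono: "inP I w \<Longrightarrow> I \<subseteq> J \<Longrightarrow> inP J w"
  unfolding inP_def using supp_in_mono by blast

lemma inP_left_down:
  assumes "inP J w" "s < n" "simple s \<in> N w"
  shows "inP J (refl s \<circ> w)" "s \<in> J"
proof -
  show sJ: "s \<in> J" using assms by (auto simp: inP_def)
  show "inP J (refl s \<circ> w)"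
    unfolding inP_def
  proof (intro conjI ballI)
    show "refl s \<circ> w \<in> W" using assms by (auto simp: inP_def)
    fix \<beta> assume "\<beta> \<in> N (refl s \<circ> w)"
    then have "refl s \<beta> \<in> N w" using N_left_down assms by (auto simp: inP_def)
    then show "supp_in J \<beta>" using assms sJ refl_supp unfolding inP_def by blast
  qed
qed

lemma inP_left_up:
  assumes "inP J w" "s < n" "s \<in> J" "simple s \<notin> N w"
  shows "inP J (refl s \<circ> w)"
  using assms N_left_up[of w s] by (auto simp: inP_def refl_supp)

lemma sortable_inP: "sortable q w \<Longrightarrow> letters q \<Longrightarrow> inP (set q) w"
proof (induction rule: sortable.induct)
  case (acc w s q)
  then have "inP (set (q @ [s])) (refl s \<circ> w)" unfolding letters_snoc by blast
  moreover have "set (q @ [s]) = set (s # q)" by simp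
  ultimately have i: "inP (set (s # q)) (refl s \<circ> w)" by metis
  have s: "s < n" using acc by (simp add: letters_Cons)
  have "simple s \<notin> N (refl s \<circ> w)" using N_left_simple acc s by blast
  then have "inP (set (s # q)) (refl s \<circ> (refl s \<circ> w))" by (intro inP_left_up i s) auto
  moreover have "refl s \<circ> (refl s \<circ> w) = w" using s by (auto simp: refl_refl)
  ultimately show ?case by simp
next
  case (rej s w q)
  then show ?case by (auto simp: letters_Cons intro: inP_mono)
qed simp

lemma left_descent: "w \<in> W \<Longrightarrow> w \<noteq> id \<Longrightarrow> \<exists>s<n. simple s \<in> N w"
proof -
  assume w: "w \<in> W" "w \<noteq> id"
  have "inv w \<noteq> id"
  proof
    assume "inv w = id"
    then have "inv (inv w) = id" by simp
    then show False using w by simp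
  qed
  then obtain s where "s < n" "\<not> pos (inv w (simple s))" using W_not_id w by blast
  then show ?thesis by (auto simp: N_def)
qed

text \<open>Stripping left descents writes \<open>w\<close> as a product of reflections with letters
  in \<open>J\<close>, each of which fixes the coordinates outside \<open>J\<close>.\<close>

lemma inP_coord: "inP J w \<Longrightarrow> k \<notin> J \<Longrightarrow> w v k = v k"
proof (induction "card (N w)" arbitrary: w rule: less_induct)
  case less
  have w: "w \<in> W" using less.prems by (simp add: inP_def)
  show ?case
  proof (cases "w = id")
    case False
    then obtain s where s: "s < n" "simple s \<in> N w" using left_descent w by blast
    note d = inP_left_down[OF less.prems(1) s]
    have "card (N (refl s \<circ> w)) < card (N w)" using card_N_left_down w s by simp
    then have "(refl s \<circ> w) v k = v k" using less.hyps d less.prems by blast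
    moreover have "k \<noteq> s" using d less.prems by blast
    ultimately show ?thesis by (simp add: refl_other)
  qed simp
qed

lemma inP_supp: "inP J w \<Longrightarrow> i \<in> J \<Longrightarrow> supp_in J (w (simple i))"
  by (metis inP_coord simple_other supp_in_def)

lemma inP_outside: "inP J w \<Longrightarrow> i \<notin> J \<Longrightarrow> i < n \<Longrightarrow> w (simple i) \<in> proots \<and> w (simple i) i = 1"
proof -
  assume a: "inP J w" "i \<notin> J" "i < n"
  have c: "w (simple i) i = 1" using inP_coord[OF a(1,2), of "simple i"] by simp
  have r: "w (simple i) \<in> roots" using a roots_W by (simp add: inP_def)
  have "\<not> pos (neg (w (simple i)))"
  proof
    assume "pos (neg (w (simple i)))"
    then have "0 \<le> neg (w (simple i)) i" by (rule posD)
    then show False using c by (simp add: neg_apply)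
  qed
  then show ?thesis using r c root_pos_or_neg by (auto simp: proots_def)
qed

lemma inP_right_down: "inP J w \<Longrightarrow> i < n \<Longrightarrow> \<not> pos (w (simple i)) \<Longrightarrow> inP J (w \<circ> refl i) \<and> i \<in> J"
proof -
  assume a: "inP J w" "i < n" "\<not> pos (w (simple i))"
  have w: "w \<in> W" using a by (simp add: inP_def)
  have "N (w \<circ> refl i) \<subseteq> N w" using N_right_down(1)[OF w a(2,3)] by blast
  moreover have "w \<circ> refl i \<in> W" using w a(2) by blast
  moreover have "i \<in> J" using inP_outside[of J w i] proot_pos a by blast
  ultimately show ?thesis using a(1) unfolding inP_def by blast
qed

section \<open>Sortable elements are the aligned ones\<close>

lemma sortable_id: "sortable q id"
proof (induction q)
  case (Cons s q)
  have "simple s \<notin> N id" unfolding N_id by blast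
  then show ?case using Cons by (rule sortable.rej)
qed (rule sortable.nil)

text \<open>Dropping the last letter of the sorting word keeps the element sortable, and the
  inversion contributed by that letter comes after all others in the order of \<open>q\<close>.
  Under acceptance, old inversions are compared by \<open>E_refl'\<close>, while the new one,
  \<open>simple s\<close>, comes first by \<open>E_first_le\<close>.\<close>

lemma sortable_last_letter:
  assumes "sortable q u" "letters q" "u \<noteq> id"
  shows "\<exists>u' r. sortable q u' \<and> r \<in> set q \<and> u = u' \<circ> refl r \<and> u' (simple r) \<in> proots \<and>
    (\<forall>\<beta>\<in>N u'. E q (u' (simple r)) \<beta> \<le> E q \<beta> (u' (simple r)))"
  using assms
proof (induction rule: sortable.induct)
  case (acc w s q)
  have l: "letters (s # q)" and l': "letters (q @ [s])" and s: "s < n" "s \<notin> set q"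
    using acc.prems by (auto simp: letters_snoc letters_Cons)
  have ww: "refl s \<circ> (refl s \<circ> w) = w" using s by (auto simp: refl_refl)
  show ?case
  proof (cases "refl s \<circ> w = id")
    case True
    then have "w = refl s" using ww by simp
    then have ws: "w = id \<circ> refl s" by simp
    show ?thesis
    proof (rule exI[of _ id], rule exI[of _ s], intro conjI)
      show "id (simple s) \<in> proots" using s by simp
      show "\<forall>\<beta>\<in>N id. E (s # q) (id (simple s)) \<beta> \<le> E (s # q) \<beta> (id (simple s))" unfolding N_id by blast
      show "s \<in> set (s # q)" by simp
    qed (rule sortable_id ws)+
  next
    case False
    then obtain u' r where u': "sortable (q @ [s]) u'" "r \<in> set (q @ [s])" "refl s \<circ> w = u' \<circ> refl r"
      "u' (simple r) \<in> proots" and e: "\<And>\<beta>. \<beta> \<in> N u' \<Longrightarrow> E (q @ [s]) (u' (simple r)) \<beta> \<le> E (q @ [s]) \<beta> (u' (simple r))"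
      using acc.IH l' by blast
    have r: "r < n" using u' l' letters_less by blast
    have uW: "u' \<in> W" using u' sortable_W by blast
    have N1: "N (refl s \<circ> w) = insert (u' (simple r)) (N u')"
      using N_right_up(1)[OF uW r] u' proot_pos by simp
    have ns: "simple s \<notin> N (refl s \<circ> w)" using N_left_simple acc s by blast
    have g: "u' (simple r) \<noteq> simple s" "simple s \<notin> N u'" using ns unfolding N1 by (metis insertI1, blast)
    have pW: "inP (set (s # q)) (refl s \<circ> w)" using sortable_inP[OF acc.hyps(3) l'] by simp
    have sup: "supp_in (set (s # q)) (u' (simple r))" "\<And>\<beta>. \<beta> \<in> N u' \<Longrightarrow> supp_in (set (s # q)) \<beta>"
      using pW unfolding inP_def N1 by blast+
    have cc: "refl s \<circ> (refl s \<circ> u') = u'" using s by (auto simp: refl_refl)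
    show ?thesis
    proof (intro exI[of _ "refl s \<circ> u'"] exI[of _ r] conjI ballI)
      have "simple s \<in> N (refl s \<circ> u')" using N_left_simple[OF uW s(1)] g by blast
      then show "sortable (s # q) (refl s \<circ> u')"
        using u'(1) uW s by (intro sortable.acc) (simp_all only: cc comp_W refl_W)
      show "r \<in> set (s # q)" using u' by auto
      show "w = refl s \<circ> u' \<circ> refl r" by (subst ww[symmetric]) (simp only: u'(3) comp_assoc)
      show "(refl s \<circ> u') (simple r) \<in> proots" using refl_proot u' s g by simp
      fix \<beta> assume "\<beta> \<in> N (refl s \<circ> u')"
      then consider "\<beta> = simple s" | \<beta>' where "\<beta>' \<in> N u'" "\<beta> = refl s \<beta>'"
        using N_left_up[OF uW s(1) g(2)] by auto
      then show "E (s # q) ((refl s \<circ> u') (simple r)) \<beta> \<le> E (s # q) \<beta> ((refl s \<circ> u') (simple r))"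
      proof cases
        case 1
        then show ?thesis
          using E_first_le[OF l] proot_pos[OF \<open>(refl s \<circ> u') (simple r) \<in> proots\<close>] by blast
      next
        case 2
        then show ?thesis using e[OF 2(1)] E_refl'[OF l] sup by (simp del: E.simps)
      qed
    qed
  qed
next
  case (rej s w q)
  have l: "letters q" and s: "s < n" "s \<notin> set q" using rej.prems by (auto simp: letters_Cons)
  obtain u' r where u': "sortable q u'" "r \<in> set q" "w = u' \<circ> refl r"
      "u' (simple r) \<in> proots" and e: "\<And>\<beta>. \<beta> \<in> N u' \<Longrightarrow> E q (u' (simple r)) \<beta> \<le> E q \<beta> (u' (simple r))"
    using rej.IH l rej.prems by blast
  have p: "inP (set q) u'" using sortable_inP u' l by blast
  have "simple s \<notin> N u'" using p s by (auto simp: inP_def)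
  then have "sortable (s # q) u'" using u' by (intro sortable.rej)
  moreover have "E (s # q) (u' (simple r)) \<beta> \<le> E (s # q) \<beta> (u' (simple r))" if "\<beta> \<in> N u'" for \<beta>
    using e[OF that] E_rest[OF s(2)] inP_supp[OF p u'(2)] p that by (simp add: inP_def del: E.simps)
  ultimately show ?case using u' by (intro exI[of _ u'] exI[of _ r]) auto
qed simp

text \<open>Along a reduced word of \<open>u\<close>, each letter \<open>i\<close> adds to the image
  of \<open>simple s\<close> the multiple \<open>- 2 * bm s i\<close> of an inversion, and these
  multiples are nonnegative since \<open>i \<noteq> s\<close>.\<close>

lemma functional_ray:
  assumes "inP J u" "s \<notin> J" "s < n"
    and lin: "\<And>a u b v. \<phi> (lc a u b v) = a * \<phi> u + b * \<phi> v"
    and nonneg: "\<And>\<beta>. \<beta> \<in> N u \<Longrightarrow> (0::real) \<le> \<phi> \<beta>"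
  shows "\<phi> (simple s) \<le> \<phi> (u (simple s))"
  using assms(1) nonneg
proof (induction "card (N u)" arbitrary: u rule: less_induct)
  case less
  have u: "u \<in> W" using less.prems by (simp add: inP_def)
  show ?case
  proof (cases "u = id")
    case False
    then obtain i where i: "i < n" "\<not> pos (u (simple i))" using W_not_id u by blast
    define u' where "u' = u \<circ> refl i"
    define \<gamma> where "\<gamma> = neg (u (simple i))"
    have d: "inP J u'" "i \<in> J" using inP_right_down[OF less.prems(1) i] by (auto simp: u'_def)
    have Nu: "N u = insert \<gamma> (N u')" using N_right_down(1)[OF u i] by (simp add: u'_def \<gamma>_def)
    have "card (N u') < card (N u)" using card_N_right_down[OF u i] by (simp add: u'_def)
    then have IH: "\<phi> (simple s) \<le> \<phi> (u' (simple s))" using less.hyps d less.prems Nu by blast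
    have ns: "i \<noteq> s" using d assms(2) by blast
    have uu: "u = u' \<circ> refl i" using i by (auto simp: u'_def refl_refl)
    have u'W: "u' \<in> W" using d by (simp add: inP_def)
    have g: "u' (simple i) = \<gamma>" using i u by (simp add: u'_def \<gamma>_def refl_simple)
    have "u (simple s) = u' (lc 1 (simple s) (- 2 * bm s i) (simple i))"
      unfolding uu using i assms(3) by (simp add: refl_def bil_simple_simple)
    also have "\<dots> = lc 1 (u' (simple s)) (- 2 * bm s i) \<gamma>" using W_lc[OF u'W] g by simp
    finally have "\<phi> (u (simple s)) = \<phi> (u' (simple s)) - 2 * bm s i * \<phi> \<gamma>" by (simp add: lin)
    moreover have "bm s i * \<phi> \<gamma> \<le> 0"
      using bm_le_0[of s i] i ns assms(3) less.prems(2)[of \<gamma>] Nu by (simp add: mult_nonpos_nonneg)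
    ultimately show ?thesis using IH by linarith
  qed simp
qed

text \<open>The sorting word of \<open>u\<close> is undone from its end: this leads from
  \<open>u (simple s)\<close> back to \<open>simple s\<close> by subtracting multiples of inversions
  \<open>\<gamma>\<close>, and at each stage the remaining root precedes \<open>\<gamma>\<close>.
  The premise \<open>step\<close> is the shape of the alignment condition, so membership in
  \<open>Y\<close> survives down to \<open>simple s\<close>.\<close>

lemma sortable_ray:
  assumes "letters (s # q)" "sortable q u"
    and step: "\<And>\<delta> \<beta> \<gamma> k. \<beta> \<in> proots \<Longrightarrow> \<gamma> \<in> N u \<Longrightarrow> 0 < k \<Longrightarrow> \<delta> = lc 1 \<beta> k \<gamma> \<Longrightarrow> \<delta> \<in> Y \<Longrightarrow>
      \<beta> s = 1 \<Longrightarrow> E (s # q) \<gamma> \<beta> \<le> E (s # q) \<beta> \<gamma> \<Longrightarrow> \<beta> \<in> Y"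
    and "u (simple s) \<in> Y"
  shows "simple s \<in> Y"
  using assms(2-)
proof (induction "card (N u)" arbitrary: u rule: less_induct)
  case less
  have l: "letters q" and s: "s < n" "s \<notin> set q" using assms(1) by (auto simp: letters_Cons)
  show ?case
  proof (cases "u = id")
    case True then show ?thesis using less.prems by simp
  next
    case False
    obtain u' r where u': "sortable q u'" "r \<in> set q" "u = u' \<circ> refl r"
      "u' (simple r) \<in> proots" and e: "\<And>\<beta>. \<beta> \<in> N u' \<Longrightarrow> E q (u' (simple r)) \<beta> \<le> E q \<beta> (u' (simple r))"
      using sortable_last_letter[OF less.prems(1) l False] by blast
    define \<gamma> where "\<gamma> = u' (simple r)"
    have r: "r < n" "r \<noteq> s" using u' l letters_less s by auto
    have uW: "u' \<in> W" using u' sortable_W by blast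
    have p: "inP (set q) u'" using sortable_inP u' l by blast
    have Nu: "N u = insert \<gamma> (N u')" and pc: "card (N u') < card (N u)"
      using N_right_up(1)[OF uW r(1)] card_N_right_up[OF uW r(1)] u' proot_pos by (simp_all add: \<gamma>_def)
    have supg: "supp_in (set q) \<gamma>" using inP_supp[OF p u'(2)] by (simp add: \<gamma>_def)
    have up: "u' (simple s) \<in> proots" "u' (simple s) s = 1" using inP_outside[OF p s(2,1)] by auto
    have us: "u (simple s) = lc 1 (u' (simple s)) (- 2 * bm s r) \<gamma>"
      unfolding u'(3) \<gamma>_def using r s W_lc[OF uW] by (simp add: refl_def bil_simple_simple)
    have "u' (simple s) \<in> Y"
    proof (cases "bm s r = 0")
      case True
      then have "u (simple s) = u' (simple s)" using us by (simp add: lc_def)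
      then show ?thesis using less.prems(3) by simp
    next
      case False
      then have k: "0 < - 2 * bm s r" using bm_le_0[of s r] r s by simp
      \<comment> \<open>\<open>\<phi>\<close> measures by how much a vector precedes
        \<open>\<gamma>\<close>. It is nonnegative at \<open>simple s\<close>, the first letter, and
        at the inversions of \<open>u'\<close>, hence at \<open>u' (simple s)\<close>.\<close>
      define \<phi> where "\<phi> v = E (s # q) v \<gamma> - E (s # q) \<gamma> v" for v
      have gp: "pos \<gamma>" using u' proot_pos by (simp add: \<gamma>_def)
      have "\<phi> (simple s) \<le> \<phi> (u' (simple s))"
      proof (rule functional_ray[OF p s(2,1)])
        show "\<phi> (lc a u b v) = a * \<phi> u + b * \<phi> v" for a u b v
          by (simp add: \<phi>_def E_lc_left E_lc_right algebra_simps del: E.simps)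
        fix \<beta> assume "\<beta> \<in> N u'"
        then show "0 \<le> \<phi> \<beta>" using e[of \<beta>] E_rest[OF s(2)] supg p
          by (simp add: \<phi>_def \<gamma>_def inP_def del: E.simps)
      qed
      moreover have "0 \<le> \<phi> (simple s)" using E_first_le[OF assms(1) gp] by (simp add: \<phi>_def del: E.simps)
      ultimately have "E (s # q) \<gamma> (u' (simple s)) \<le> E (s # q) (u' (simple s)) \<gamma>"
        by (simp add: \<phi>_def del: E.simps)
      then show ?thesis
        using less.prems(2)[OF up(1) _ k us less.prems(3) up(2)] Nu by blast
    qed
    then show ?thesis using less.hyps[OF pc u'(1)] less.prems(2) Nu by blast
  qed
qed

definition aligned :: "nat list \<Rightarrow> (vec \<Rightarrow> vec) \<Rightarrow> bool" where
  "aligned q w \<longleftrightarrow> (\<forall>\<gamma>\<in>N w. good q \<gamma> (N w))"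

lemma aligned_projection:
  assumes "letters (s # q)" "aligned (s # q) w" "N u = {\<beta> \<in> N w. supp_in (set q) \<beta>}"
  shows "aligned q u"
  unfolding aligned_def
proof
  fix \<gamma> assume "\<gamma> \<in> N u"
  then have g: "\<gamma> \<in> N w" "supp_in (set q) \<gamma>" using assms by auto
  have gd: "good q \<gamma> (N w)" using good_rest[of s q \<gamma> "N w"] assms g by (simp add: aligned_def letters_Cons)
  show "good q \<gamma> (N u)"
  proof (rule goodI)
    fix \<beta>1 \<beta>3 a b
    assume b: "\<beta>1 \<in> proots" "\<beta>3 \<in> proots" "0 < a" "0 < b" "\<gamma> = lc a \<beta>1 b \<beta>3" "E q \<beta>3 \<beta>1 \<le> E q \<beta>1 \<beta>3"
    then have "\<beta>1 \<in> N w" using goodD[OF gd] by blast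
    moreover have "supp_in (set q) \<beta>1" using supp_in_pos_lc(1)[of _ a \<beta>1 b \<beta>3] b g proot_pos by blast
    ultimately show "\<beta>1 \<in> N u" using assms by simp
  qed
qed

text \<open>Only rejection is subtle. The projection \<open>u\<close> to the remaining letters is
  sortable by induction; if \<open>u \<noteq> w\<close>, then \<open>w\<close> lies above an ascent
  of \<open>u\<close>, which can only come from the letter \<open>s\<close>. So
  \<open>u (simple s)\<close> is an inversion of \<open>w\<close>, and \<open>sortable_ray\<close>
  makes \<open>simple s\<close> one as well.\<close>

lemma aligned_sortable:
  "letters q \<Longrightarrow> inP (set q) w \<Longrightarrow> aligned q w \<Longrightarrow> sortable q w"
proof (induction "length q + card (N w)" arbitrary: q w rule: less_induct)
  case less
  have w: "w \<in> W" using less.prems by (simp add: inP_def)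
  show ?case
  proof (cases q)
    case Nil
    have "N w = {}"
    proof (rule ccontr)
      assume "N w \<noteq> {}"
      then obtain \<beta> where "\<beta> \<in> N w" by blast
      then show False using root_nonzero[of \<beta>] less.prems Nil N_proot proot_root
        by (auto simp: inP_def supp_in_def)
    qed
    then have "w = id" using N_empty w by blast
    then show ?thesis using Nil sortable.nil by metis
  next
    case (Cons s q')
    have l: "letters (s # q')" and al: "aligned (s # q') w" and p: "inP (set (s # q')) w"
      using less.prems Cons by auto
    have s: "s < n" "s \<notin> set q'" "letters q'" using l by (auto simp: letters_Cons)
    show ?thesis
    proof (cases "simple s \<in> N w")
      case True
      define w' where "w' = refl s \<circ> w"
      have w': "inP (set (s # q')) w'" using inP_left_down[OF p s(1) True] by (simp add: w'_def)
      have "aligned (q' @ [s]) w'"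
        unfolding aligned_def
      proof
        fix \<gamma> assume g: "\<gamma> \<in> N w'"
        have gp: "\<gamma> \<in> proots" using g N_proot by blast
        have "simple s \<notin> N w'" using N_left_simple[OF w s(1)] True by (simp add: w'_def)
        then have "\<gamma> \<noteq> simple s" using g by blast
        then have g2: "refl s \<gamma> \<in> N w" using N_left[OF w s(1) gp] g by (simp add: w'_def)
        have "good (q' @ [s]) (refl s (refl s \<gamma>)) (N (refl s \<circ> w))"
          using l w True g2 refl_proot_ne[OF gp s(1)] p al
          by (intro good_refl) (auto simp: inP_def aligned_def)
        then show "good (q' @ [s]) \<gamma> (N w')" using s by (simp add: refl_refl w'_def)
      qed
      moreover have "length (q' @ [s]) + card (N w') < length q + card (N w)"
        using card_N_left_down[OF w s(1) True] Cons by (simp add: w'_def)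
      moreover have "letters (q' @ [s])" "inP (set (q' @ [s])) w'" using l w' by (auto simp: letters_snoc)
      ultimately have "sortable (q' @ [s]) w'" using less.hyps by blast
      then show ?thesis using Cons w True by (auto simp: w'_def intro: sortable.acc)
    next
      case False
      obtain u where u: "u \<in> W" "N u = {\<beta> \<in> N w. supp_in (set q') \<beta>}"
        using parabolic_projection w by blast
      have pu: "inP (set q') u" using u by (simp add: inP_def)
      have "N u \<subseteq> N w" using u by auto
      then have "card (N u) \<le> card (N w)" using finite_N[OF w] by (simp add: card_mono)
      then have "length q' + card (N u) < length q + card (N w)" using Cons by simp
      from less.hyps[OF this s(3) pu aligned_projection[OF l al u(2)]] have su: "sortable q' u" .
      have "u = w"
      proof (rule ccontr)
        assume "u \<noteq> w"
        then obtain i where i: "i < n" "pos (u (simple i))" "u (simple i) \<in> N w"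
          using ascent_below[OF u(1) w] u(2) by blast
        have "i \<notin> set q'"
          using N_right_up(2)[OF u(1) i(1,2)] i u inP_supp[OF pu] by blast
        moreover have "i \<in> set (s # q')"
        proof (rule ccontr)
          assume "i \<notin> set (s # q')"
          then have "u (simple i) i = 1" using inP_coord[OF pu, of i] by simp
          then show False using i p \<open>i \<notin> set (s # q')\<close> by (auto simp: inP_def supp_in_def)
        qed
        ultimately have "i = s" by simp
        have "simple s \<in> N w"
        proof (rule sortable_ray[OF l su, where Y = "N w"])
          show "u (simple s) \<in> N w" using i \<open>i = s\<close> by simp
          fix \<delta> \<beta> \<gamma> k
          assume "\<beta> \<in> proots" "\<gamma> \<in> N u" "0 < k" "\<delta> = lc 1 \<beta> k \<gamma>" "\<delta> \<in> N w"
            "E (s # q') \<gamma> \<beta> \<le> E (s # q') \<beta> \<gamma>"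
          then show "\<beta> \<in> N w" using al goodD[of "s # q'" \<delta> "N w" \<beta> \<gamma> 1 k] N_proot by (simp add: aligned_def del: E.simps)
        qed
        then show False using False by simp
      qed
      then show ?thesis using su False Cons by (simp add: sortable.rej)
    qed
  qed
qed

lemma sortable_aligned: "sortable q w \<Longrightarrow> letters q \<Longrightarrow> aligned q w"
proof (induction rule: sortable.induct)
  case nil then show ?case unfolding aligned_def N_id by blast
next
  case (acc w s q)
  have l: "letters (s # q)" and l': "letters (q @ [s])" and s: "s < n" using acc.prems by (auto simp: letters_snoc letters_Cons)
  have p: "inP (set (s # q)) w" using sortable_inP[OF sortable.acc[OF acc.hyps] l] .
  show ?case
    unfolding aligned_def
  proof
    fix \<gamma> assume g: "\<gamma> \<in> N w"
    show "good (s # q) \<gamma> (N w)"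
    proof (cases "\<gamma> = simple s")
      case True then show ?thesis using good_simple s acc by blast
    next
      case False
      have "refl s \<gamma> \<in> N (refl s \<circ> w)"
        using N_left[OF acc.hyps(1) s refl_proot[OF N_proot[OF g] s False]] refl_proot_ne[OF N_proot[OF g] s] g s
        by (simp add: refl_refl)
      then have "good (q @ [s]) (refl s \<gamma>) (N (refl s \<circ> w))" using acc.IH[OF l'] unfolding aligned_def by blast
      then show ?thesis using good_refl_rev[OF l acc.hyps(1,2) g False] p g by (simp add: inP_def)
    qed
  qed
next
  case (rej s w q)
  have l: "letters q" and s: "s \<notin> set q" using rej.prems by (auto simp: letters_Cons)
  show ?case using rej.IH[OF l] good_rest[OF s] sortable_inP[OF rej.hyps(2) l]
    by (simp add: aligned_def inP_def)
qed

lemma sortable_projection: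
  assumes "letters (s # q)" "sortable (s # q) w" "u \<in> W" "N u = {\<beta> \<in> N w. supp_in (set q) \<beta>}"
  shows "sortable q u"
  using assms aligned_projection[OF assms(1) sortable_aligned[OF assms(2,1)] assms(4)]
  by (intro aligned_sortable) (auto simp: inP_def letters_Cons)

section \<open>Walls and join-irreducible sortable elements\<close>

text \<open>The letter \<open>i\<close> determines a covering pair \<open>y\<close>, \<open>y s\<^sub>i\<close> of the weak order: \<open>wall_top\<close> is its upper
  element and \<open>wall_root\<close> the root by which the inversion sets differ.\<close>

definition wall_top :: "(vec \<Rightarrow> vec) \<Rightarrow> nat \<Rightarrow> vec \<Rightarrow> vec" where
  "wall_top y i = (if pos (y (simple i)) then y \<circ> refl i else y)"

definition wall_root :: "(vec \<Rightarrow> vec) \<Rightarrow> nat \<Rightarrow> vec" where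
  "wall_root y i = (if pos (y (simple i)) then y (simple i) else neg (y (simple i)))"

text \<open>Upper walls are included because removing an accepted letter \<open>s\<close> turns a
  lower wall \<open>simple s\<close> into an upper one, and the induction in
  \<open>walls_triangular\<close> needs a class of walls closed under this step.\<close>

definition good_wall :: "nat list \<Rightarrow> (vec \<Rightarrow> vec) \<Rightarrow> nat \<Rightarrow> bool" where
  "good_wall q y i \<longleftrightarrow> good q (wall_root y i) (N (wall_top y i))"

lemma wall_top:
  assumes "y \<in> W" "i < n"
  shows "wall_top y i \<in> W" "N y \<subseteq> N (wall_top y i)" "wall_root y i \<in> N (wall_top y i)"
proof -
  show "wall_top y i \<in> W" unfolding wall_top_def using assms by (cases "pos (y (simple i))") auto
  show "N y \<subseteq> N (wall_top y i)" unfolding wall_top_def using N_right_up(1)[OF assms] by (cases "pos (y (simple i))") auto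
  show "wall_root y i \<in> N (wall_top y i)"
    unfolding wall_top_def wall_root_def using N_right_up(1)[OF assms] N_right_down(1)[OF assms]
    by (cases "pos (y (simple i))") auto
qed

lemma wall_root_supp: "inP J y \<Longrightarrow> i \<in> J \<Longrightarrow> supp_in J (wall_root y i)"
  unfolding wall_root_def using inP_supp by (cases "pos (y (simple i))") auto

lemma good_wall_refl:
  assumes l: "letters (s # q)" and p: "inP (set (s # q)) y" and sN: "simple s \<in> N y"
    and i: "i \<in> set (s # q)" and g: "good_wall (s # q) y i"
  shows "good_wall (q @ [s]) (refl s \<circ> y) i"
proof -
  have s: "s < n" and inn: "i < n" using l i by (auto simp: letters_def)
  have y: "y \<in> W" using p by (simp add: inP_def)
  define y1 where "y1 = refl s \<circ> y"
  have y1: "y1 \<in> W" using y s by (auto simp: y1_def)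
  have y1i: "y1 (simple i) = refl s (y (simple i))" by (simp add: y1_def)
  have r: "y (simple i) \<in> roots" using roots_W y inn by simp
  show ?thesis
  proof (cases "y (simple i) = neg (simple s)")
    case True
    then have e: "y1 (simple i) = simple s" using s y1i by (simp add: refl_simple)
    have "simple s \<in> N (y1 \<circ> refl i)" using N_right_up(1)[OF y1 inn] e pos_simple by simp
    then have "good (q @ [s]) (simple s) (N (y1 \<circ> refl i))" using good_simple s by blast
    then have "good_wall (q @ [s]) y1 i"
      unfolding good_wall_def wall_root_def wall_top_def e using pos_simple by simp
    then show ?thesis by (simp only: y1_def)
  next
    case False
    have n2: "y (simple i) \<noteq> simple s"
    proof
      assume "y (simple i) = simple s"
      then have "inv y (simple s) = simple i" using y by (metis inv_left)
      then show False using sN pos_simple by (simp add: N_def)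
    qed
    have nw: "wall_root y i \<noteq> simple s" using False n2 unfolding wall_root_def by (metis neg_neg)
    have pp: "pos (y1 (simple i)) \<longleftrightarrow> pos (y (simple i))"
    proof
      assume "pos (y (simple i))"
      then have "refl s (y (simple i)) \<in> proots" using r n2 s by (intro refl_proot) (auto simp: proots_def)
      then show "pos (y1 (simple i))" using y1i proot_pos by simp
    next
      assume a: "pos (y1 (simple i))"
      show "pos (y (simple i))"
      proof (rule ccontr)
        assume "\<not> pos (y (simple i))"
        then have "neg (y (simple i)) \<in> proots" using proot_neg r by blast
        moreover have "neg (y (simple i)) \<noteq> simple s" using False by (metis neg_neg)
        ultimately have "refl s (neg (y (simple i))) \<in> proots" using s by (intro refl_proot)
        then have "neg (y1 (simple i)) \<in> proots" using y1i s by simp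
        then show False using a root_not_pos[of "y1 (simple i)"] roots_W[OF y1 simple_root[OF inn]] proot_pos by blast
      qed
    qed
    have t: "wall_top y1 i = refl s \<circ> wall_top y i"
      unfolding wall_top_def pp by (cases "pos (y (simple i))") (simp_all only: y1_def comp_assoc if_True if_False)
    have w: "wall_root y1 i = refl s (wall_root y i)"
      using pp y1i s by (cases "pos (y (simple i))") (simp_all add: wall_root_def)
    have "good (q @ [s]) (refl s (wall_root y i)) (N (refl s \<circ> wall_top y i))"
    proof (rule good_refl[OF l wall_top(1)[OF y inn]])
      show "simple s \<in> N (wall_top y i)" using wall_top(2)[OF y inn] sN by blast
    qed (use wall_top(3)[OF y inn] nw wall_root_supp[OF p i] g in \<open>simp_all only: good_wall_def not_False_eq_True\<close>)
    then have "good_wall (q @ [s]) y1 i" unfolding good_wall_def t w .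
    then show ?thesis by (simp only: y1_def)
  qed
qed

text \<open>\<open>sortable_ray\<close> with the singleton of \<open>w (simple s)\<close>: goodness
  puts each intermediate root among the inversions of \<open>w\<close> or equal to the wall, and its
  coordinate \<open>1\<close> at \<open>s\<close> excludes the inversions. So the ray never
  moves.\<close>

lemma sortable_new_wall:
  assumes l: "letters (s # q)" and so: "sortable q w" and g: "good_wall (s # q) w s"
  shows "w (simple s) = simple s"
proof -
  have s: "s < n" "s \<notin> set q" "letters q" using l by (auto simp: letters_Cons)
  have p: "inP (set q) w" using sortable_inP so s by blast
  have w: "w \<in> W" using p by (simp add: inP_def)
  have up: "w (simple s) \<in> proots" using inP_outside[OF p s(2,1)] by simp
  then have ps: "pos (w (simple s))" by (rule proot_pos)
  have gd: "good (s # q) (w (simple s)) (insert (w (simple s)) (N w))"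
    using g ps N_right_up(1)[OF w s(1) ps] by (simp only: good_wall_def wall_root_def wall_top_def if_True)
  have "simple s \<in> {w (simple s)}"
  proof (rule sortable_ray[OF l so])
    fix \<delta> \<beta> \<gamma> k
    assume a: "\<beta> \<in> proots" "\<gamma> \<in> N w" "0 < k" "\<delta> = lc 1 \<beta> k \<gamma>" "\<delta> \<in> {w (simple s)}" "\<beta> s = 1"
      "E (s # q) \<gamma> \<beta> \<le> E (s # q) \<beta> \<gamma>"
    have "\<beta> \<in> insert (w (simple s)) (N w)"
      using goodD[OF gd a(1) N_proot[OF a(2)] _ a(3) _ a(7), of 1] a(4,5) by simp
    moreover have "\<beta> \<notin> N w" using a(6) p s by (auto simp: inP_def supp_in_def)
    ultimately show "\<beta> \<in> {w (simple s)}" by blast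
  qed simp
  then show ?thesis by simp
qed

text \<open>Accepted letters preserve \<open>E\<close>. A rejected letter \<open>s\<close> whose
  wall is good has that wall equal to \<open>simple s\<close>, and
  \<open>E (s # q) (simple s)\<close> reads off the coordinate at \<open>s\<close>, which vanishes
  at the other walls. With \<open>E_bil\<close> this controls the angle between two walls.\<close>

lemma walls_triangular:
  "sortable q y \<Longrightarrow> letters q \<Longrightarrow> i \<in> set q \<Longrightarrow> k \<in> set q \<Longrightarrow> i \<noteq> k \<Longrightarrow> good_wall q y i \<Longrightarrow> good_wall q y k
    \<Longrightarrow> E q (y (simple i)) (y (simple k)) = 0 \<or> E q (y (simple k)) (y (simple i)) = 0"
proof (induction rule: sortable.induct)
  case (acc w s q)
  have l: "letters (s # q)" and l': "letters (q @ [s])" using acc.prems by (auto simp: letters_snoc)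
  have p: "inP (set (s # q)) w" using sortable_inP[OF sortable.acc[OF acc.hyps] l] .
  have gw: "good_wall (q @ [s]) (refl s \<circ> w) i" "good_wall (q @ [s]) (refl s \<circ> w) k"
    using good_wall_refl[OF l p acc.hyps(2)] acc.prems by blast+
  have "i \<in> set (q @ [s])" "k \<in> set (q @ [s])" using acc.prems by auto
  from acc.IH[OF l' this acc.prems(4) gw] show ?case
    unfolding comp_apply using E_refl[OF l inP_supp[OF p acc.prems(2)] inP_supp[OF p acc.prems(3)]]
      E_refl[OF l inP_supp[OF p acc.prems(3)] inP_supp[OF p acc.prems(2)]] by simp
next
  case (rej s w q)
  have l: "letters q" and s: "s < n" "s \<notin> set q" using rej.prems by (auto simp: letters_Cons)
  have p: "inP (set q) w" using sortable_inP rej l by blast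
  have new: "E (s # q) (w (simple s)) (w (simple e)) = 0" if "good_wall (s # q) w s" "e \<noteq> s" for e
  proof -
    have "w (simple s) = simple s" using sortable_new_wall[OF rej.prems(1) rej.hyps(2) that(1)] .
    then have "E (s # q) (w (simple s)) (w (simple e)) = w (simple e) s"
      using E_first_left[OF rej.prems(1)] by (simp del: E.simps)
    also have "\<dots> = 0" using inP_coord[OF p s(2), of "simple e"] that by (simp add: simple_other)
    finally show ?thesis .
  qed
  show ?case
  proof (cases "i = s \<or> k = s")
    case True then show ?thesis using new rej.prems by metis
  next
    case False
    then have ik: "i \<in> set q" "k \<in> set q" using rej.prems by auto
    have "good_wall q w i" "good_wall q w k"
      using rej.prems good_rest[OF s(2) wall_root_supp[OF p ik(1)]] good_rest[OF s(2) wall_root_supp[OF p ik(2)]]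
      by (simp_all only: good_wall_def)
    then show ?thesis
      using rej.IH[OF l ik rej.prems(4)] E_rest[OF s(2) inP_supp[OF p ik(1)] inP_supp[OF p ik(2)]]
        E_rest[OF s(2) inP_supp[OF p ik(2)] inP_supp[OF p ik(1)]] by (simp del: E.simps)
  qed
qed simp

text \<open>An inversion \<open>\<gamma>\<close> added after \<open>simple s\<close> comes late in
  the order, but nothing positive comes later than the last letter. The resulting tie, together with
  positivity of \<open>refl s \<gamma>\<close>, forces \<open>\<gamma>\<close> to be orthogonal to
  \<open>simple s\<close>; so adding it leaves the wall \<open>simple s\<close> in place.\<close>

lemma final_letter_wall:
  assumes l: "letters (s # q)"
  shows "sortable (q @ [s]) z \<Longrightarrow> simple s \<in> N z \<Longrightarrow> \<exists>i<n. z (simple i) = neg (simple s)"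
proof (induction "card (N z)" arbitrary: z rule: less_induct)
  case less
  have l': "letters (q @ [s])" and s: "s < n" using l by (auto simp: letters_snoc letters_Cons)
  have ne: "z \<noteq> id" using less.prems(2) N_id by blast
  obtain z' r where z': "sortable (q @ [s]) z'" "r \<in> set (q @ [s])" "z = z' \<circ> refl r" "z' (simple r) \<in> proots"
    and e: "\<And>\<beta>. \<beta> \<in> N z' \<Longrightarrow> E (q @ [s]) (z' (simple r)) \<beta> \<le> E (q @ [s]) \<beta> (z' (simple r))"
    using sortable_last_letter[OF less.prems(1) l' ne] by blast
  define \<gamma> where "\<gamma> = z' (simple r)"
  have r: "r < n" using z' l' letters_less by blast
  have z'W: "z' \<in> W" using z' sortable_W by blast
  have Nz: "N z = insert \<gamma> (N z')" and cz: "card (N z') < card (N z)"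
    using N_right_up(1)[OF z'W r] card_N_right_up[OF z'W r] z' proot_pos by (simp_all add: \<gamma>_def)
  have p: "inP (set (q @ [s])) z'" using sortable_inP z' l' by blast
  show ?case
  proof (cases "\<gamma> = simple s")
    case True
    have "z (simple r) = neg (simple s)" unfolding z'(3) using r z'W True by (simp add: refl_simple \<gamma>_def)
    then show ?thesis using r by blast
  next
    case False
    then have sz': "simple s \<in> N z'" using less.prems(2) Nz by (metis insertE)
    then obtain i where i: "i < n" "z' (simple i) = neg (simple s)" using less.hyps[OF cz z'(1)] by blast
    have gp: "\<gamma> \<in> proots" using z' by (simp add: \<gamma>_def)
    have sup: "supp_in (set (s # q)) \<gamma>" using inP_supp[OF p z'(2)] by (simp add: \<gamma>_def)
    have "\<gamma> s \<le> \<gamma> s + 2 * (\<Sum>j\<in>set q. bm j s * \<gamma> j)"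
      using e[OF sz'] E_last_left[OF l, of \<gamma>] E_last_right[OF l, of \<gamma>] by (simp add: \<gamma>_def)
    then have S: "(\<Sum>j\<in>set q. bm j s * \<gamma> j) = 0" using bm_sum_nonpos[OF l proot_pos[OF gp]] by linarith
    have "0 \<le> refl s \<gamma> s" using refl_proot[OF gp s False] proot_pos posD by blast
    then have "\<gamma> s = 0" using refl_at[OF l sup] S posD[OF proot_pos[OF gp], of s] by simp
    then have "bil \<gamma> (simple s) = 0" using bil_simple_supp[OF l sup] S by simp
    then have "bil (z' (simple i)) (z' (simple r)) = 0" using i by (simp add: bil_sym[of "simple s"] \<gamma>_def)
    then have "bil (simple i) (simple r) = 0" using z'W by simp
    then have "refl r (simple i) = simple i" by (simp add: refl_def lc_def)
    then have "z (simple i) = neg (simple s)" unfolding z'(3) using i by simp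
    then show ?thesis using i by blast
  qed
qed

text \<open>Join-irreducible elements, with their only right descent.\<close>

definition jirr :: "(vec \<Rightarrow> vec) \<Rightarrow> nat \<Rightarrow> bool" where
  "jirr j i \<longleftrightarrow> j \<in> W \<and> i < n \<and> \<not> pos (j (simple i)) \<and> (\<forall>k<n. k \<noteq> i \<longrightarrow> pos (j (simple k)))"

lemma E_neg: "E q (neg u) (neg v) = E q u v"
  by (simp add: neg_eq_lc E_lc_left E_lc_right)

lemma refl_refl_comp: "s < n \<Longrightarrow> refl s \<circ> (refl s \<circ> w) = w"
  by (auto simp: refl_refl)

text \<open>Roots not involving the first letter \<open>s\<close> are handled in the shorter word.
  For the others, except \<open>simple s\<close> itself, the element is
  \<open>refl s \<circ> z\<close>, with \<open>z\<close> found for the rotated word and the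
  reflected root. It remains to see that \<open>s\<close> is not already below \<open>z\<close> and
  that no second descent \<open>simple s\<close> arises.\<close>

lemma ex_sortable_jirr_below:
  "letters q \<Longrightarrow> sortable q w \<Longrightarrow> \<gamma> \<in> N w \<Longrightarrow> \<exists>j i. sortable q j \<and> jirr j i \<and> j (simple i) = neg \<gamma>"
proof (induction "length q + card (N w)" arbitrary: q w \<gamma> rule: less_induct)
  case less
  have gp: "\<gamma> \<in> proots" using less.prems N_proot by blast
  show ?case
  proof (cases q)
    case Nil
    have "w = id" using less.prems(2) unfolding Nil by (cases rule: sortable.cases) auto
    then show ?thesis using less.prems(3) N_id by blast
  next
    case (Cons s q')
    have l: "letters (s # q')" and so: "sortable (s # q') w" using less.prems Cons by auto
    have l': "letters (q' @ [s])" and lq: "letters q'" and s: "s < n" "s \<notin> set q'"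
      using l by (auto simp: letters_snoc letters_Cons)
    have w: "w \<in> W" using sortable_W so .
    have lift: "\<exists>j i. sortable q j \<and> jirr j i \<and> j (simple i) = neg \<gamma>"
      if "sortable q' u" "\<gamma> \<in> N u" "card (N u) \<le> card (N w)" for u
    proof -
      have "length q' + card (N u) < length q + card (N w)" using that Cons by simp
      from less.hyps[OF this lq that(1,2)] obtain j i
        where j: "sortable q' j" "jirr j i" "j (simple i) = neg \<gamma>" by blast
      have "simple s \<notin> N j" using sortable_inP[OF j(1) lq] s by (auto simp: inP_def)
      then have "sortable q j" unfolding Cons using j(1) by (rule sortable.rej)
      then show ?thesis using j by blast
    qed
    show ?thesis
    proof (cases "simple s \<in> N w")
      case False
      then have "sortable q' w" using so by (auto elim: sortable_ConsE)
      then show ?thesis using lift less.prems by blast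
    next
      case sN: True
      have so1: "sortable (q' @ [s]) (refl s \<circ> w)" using so sN by (auto elim: sortable_ConsE)
      have p: "inP (set (s # q')) w" using sortable_inP so l by blast
      consider (simple) "\<gamma> = simple s" | (rest) "supp_in (set q') \<gamma>"
        | (main) "\<gamma> \<noteq> simple s" "\<not> supp_in (set q') \<gamma>" by blast
      then show ?thesis
      proof cases
        case simple
        have "refl s \<circ> (refl s \<circ> id) = id" by (rule refl_refl_comp[OF s(1)])
        then have 1: "refl s \<circ> refl s = id" by simp
        have "simple s \<in> N (refl s \<circ> id)" using N_left_simple[OF id_W s(1)] N_id by blast
        then have 2: "simple s \<in> N (refl s)" by simp
        have "sortable (s # q') (refl s)"
          by (rule sortable.acc[OF refl_W[OF s(1)] 2]) (simp only: 1 sortable_id)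
        moreover have "jirr (refl s) s"
          unfolding jirr_def
        proof (intro conjI allI impI)
          show "\<not> pos (refl s (simple s))" using s not_pos_neg_simple by (simp add: refl_simple)
          fix k assume k: "k < n" "k \<noteq> s"
          then have "simple k \<noteq> simple s" by (metis simple_same simple_other zero_neq_one)
          then show "pos (refl s (simple k))" using refl_proot[of "simple k" s] k s proot_pos by simp
        qed (use s in simp_all)
        ultimately show ?thesis unfolding Cons simple using refl_simple[OF s(1)] by blast
      next
        case rest
        obtain u where u: "u \<in> W" "N u = {\<beta> \<in> N w. supp_in (set q') \<beta>}"
          using parabolic_projection w by blast
        have "N u \<subseteq> N w" using u by auto
        then have "card (N u) \<le> card (N w)" using finite_N[OF w] by (simp add: card_mono)
        moreover have "\<gamma> \<in> N u" using u rest less.prems by simp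
        ultimately show ?thesis using lift sortable_projection[OF l so u] by blast
      next
        case main
        define w1 where "w1 = refl s \<circ> w"
        have cw1: "length (q' @ [s]) + card (N w1) < length q + card (N w)"
          using card_N_left_down[OF w s(1) sN] Cons by (simp add: w1_def)
        have sup: "supp_in (set (s # q')) \<gamma>" using p less.prems by (simp add: inP_def)
        have gs0: "\<gamma> s \<noteq> 0" using main(2) sup by (auto simp: supp_in_def)
        then have gs: "0 < \<gamma> s" using posD[OF proot_pos[OF gp], of s] by simp
        have rp: "refl s \<gamma> \<in> proots" using refl_proot[OF gp s(1) main(1)] .
        have rN: "refl s \<gamma> \<in> N w1"
          using N_left[OF w s(1) rp] refl_proot_ne[OF gp s(1)] less.prems s by (simp add: w1_def refl_refl)
        obtain z i where z: "sortable (q' @ [s]) z" "jirr z i" "z (simple i) = neg (refl s \<gamma>)"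
          using less.hyps[OF cw1 l' _ rN] so1 unfolding w1_def by blast
        have zW: "z \<in> W" and i: "i < n" using z by (auto simp: jirr_def)
        \<comment> \<open>The only lower wall of \<open>z\<close> is the reflected
          \<open>\<gamma>\<close>, while an inversion \<open>simple s\<close> would be a lower wall
          by \<open>final_letter_wall\<close>.\<close>
        have sz: "simple s \<notin> N z"
        proof
          assume "simple s \<in> N z"
          then obtain k where k: "k < n" "z (simple k) = neg (simple s)" using final_letter_wall[OF l z(1)] by blast
          then have "k = i" using z(2) not_pos_neg_simple unfolding jirr_def by metis
          then show False using k z(3) refl_proot_ne[OF gp s(1)] by (metis neg_neg)
        qed
        define j where "j = refl s \<circ> z"
        have jz: "refl s \<circ> j = z" unfolding j_def by (rule refl_refl_comp[OF s(1)])
        have jW: "j \<in> W" using zW s by (auto simp: j_def)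
        have sj: "simple s \<in> N j" using N_left_simple[OF zW s(1)] sz by (simp add: j_def)
        have jso: "sortable (s # q') j" using jz z(1) by (intro sortable.acc[OF jW sj]) simp
        have pj: "inP (set (s # q')) j" using sortable_inP[OF jso l] .
        have ji: "j (simple i) = neg \<gamma>" using z(3) s by (simp add: j_def refl_refl)
        have nji: "\<not> pos (j (simple i))" using ji proot_neg proot_not_neg[OF gp] gp proot_root root_not_pos proot_pos neg_neg by metis
        have jj: "pos (j (simple k))" if k: "k < n" "k \<noteq> i" for k
        proof (cases "z (simple k) = simple s")
          case False
          have "z (simple k) \<in> proots" using z(2) k roots_W[OF zW simple_root] by (simp add: jirr_def proots_def)
          then show ?thesis using refl_proot[OF _ s(1) False] proot_pos by (simp add: j_def)
        next
          case True
          then have jk: "j (simple k) = neg (simple s)" using s by (simp add: j_def refl_simple)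
          then have njk: "\<not> pos (j (simple k))" using not_pos_neg_simple by simp
          have ik: "i \<in> set (s # q')" "k \<in> set (s # q')"
            using inP_right_down[OF pj i nji] inP_right_down[OF pj k(1) njk] by auto
          have al: "aligned (s # q') j" using sortable_aligned[OF jso l] .
          have gw: "good_wall (s # q') j e" if "e < n" "\<not> pos (j (simple e))" for e
            using N_right_down(1)[OF jW that] al that(2) unfolding good_wall_def wall_root_def wall_top_def aligned_def
            by auto
          \<comment> \<open>The second alternative would give \<open>\<gamma> s = 0\<close>. The
            first makes \<open>2 * bil \<gamma> (simple s)\<close> equal to
            \<open>\<gamma> s > 0\<close>, whereas images under \<open>j\<close> of distinct simple
            roots have nonpositive product.\<close>
          have "E (s # q') (neg \<gamma>) (neg (simple s)) = 0 \<or> E (s # q') (neg (simple s)) (neg \<gamma>) = 0"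
            using walls_triangular[OF jso l ik k(2)[symmetric] gw[OF i nji] gw[OF k(1) njk]] ji jk by (simp del: E.simps)
          then have "E (s # q') \<gamma> (simple s) = 0" using E_first_left[OF l, of \<gamma>] gs by (simp add: E_neg del: E.simps)
          then have "2 * bil \<gamma> (simple s) = \<gamma> s"
            using E_bil[OF l sup, of "simple s"] E_first_left[OF l, of \<gamma>] by (simp del: E.simps)
          moreover have "bil (j (simple i)) (j (simple k)) = bm i k" using jW i k by (simp add: bil_simple_simple)
          then have "bil \<gamma> (simple s) = bm i k" unfolding ji jk by simp
          ultimately show ?thesis using bm_le_0[OF i k(1)] k gs by simp
        qed
        have "jirr j i" unfolding jirr_def using jW i nji jj by blast
        then show ?thesis unfolding Cons using jso ji by blast
      qed
    qed
  qed
qed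

text \<open>An element with the most inversions has no ascent, so it sends every positive root to a
  negative one.\<close>

lemma longest_element: "finite W \<Longrightarrow> \<exists>w\<in>W. N w = proots"
proof -
  assume fin: "finite W"
  define M where "M = Max ((\<lambda>w. card (N w)) ` W)"
  have ne: "W \<noteq> {}" using id_W by blast
  have "M \<in> (\<lambda>w. card (N w)) ` W" unfolding M_def using fin ne by (intro Max_in) auto
  then obtain w where w: "w \<in> W" "card (N w) = M" by auto
  have up: "\<not> pos (w (simple i))" if i: "i < n" for i
  proof
    assume a: "pos (w (simple i))"
    have "card (N (w \<circ> refl i)) \<le> M" unfolding M_def using fin w i by (intro Max_ge finite_imageI imageI comp_W) auto
    then show False using card_N_right_up[OF w(1) i a] w by simp
  qed
  have "\<beta> \<in> N w" if b: "\<beta> \<in> proots" for \<beta>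
  proof (rule ccontr)
    assume "\<beta> \<notin> N w"
    then have p: "pos (inv w \<beta>)" using b by (simp add: N_def)
    have r: "inv w \<beta> \<in> roots" using roots_W w b proot_root inv_W by blast
    have "pos (neg (w (simple i)))" if "i < n" for i
      using up[OF that] root_not_pos roots_W w simple_root that by blast
    then have t: "inv w \<beta> i * w (simple i) k \<le> 0" if "i < n" for i k
      using that p posD[OF p, of i] by (intro mult_nonneg_nonpos) (auto simp: pos_def neg_apply)
    have "w (inv w \<beta>) k \<le> 0" for k
      unfolding W_expand[OF w(1) root_supp[OF r], of k] using t by (intro sum_nonpos) auto
    then have "pos (neg \<beta>)" using w by (simp add: pos_def neg_apply)
    then show False using b root_not_pos proot_pos proot_root by blast
  qed
  then show ?thesis using w N_proot by blast
qed

text \<open>The longest element of the parabolic subgroup of \<open>q\<close> inverts every positive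
  root supported there, so it is trivially aligned and lies above all candidates.\<close>

lemma ex_sortable_jirr:
  assumes "finite W" "letters q" "\<gamma> \<in> proots" "supp_in (set q) \<gamma>"
  shows "\<exists>j i. sortable q j \<and> jirr j i \<and> j (simple i) = neg \<gamma>"
proof -
  obtain w0 where w0: "w0 \<in> W" "N w0 = proots" using longest_element assms by blast
  obtain w where w: "w \<in> W" "N w = {\<beta> \<in> proots. supp_in (set q) \<beta>}"
    using parabolic_projection[OF w0(1)] w0(2) by metis
  have "aligned q w"
    unfolding aligned_def
  proof
    fix \<gamma> assume g: "\<gamma> \<in> N w"
    show "good q \<gamma> (N w)"
    proof (rule goodI)
      fix \<beta>1 \<beta>3 a b
      assume "\<beta>1 \<in> proots" "\<beta>3 \<in> proots" "0 < a" "0 < b" "\<gamma> = lc a \<beta>1 b \<beta>3"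
      then show "\<beta>1 \<in> N w" using g w supp_in_pos_lc(1)[of _ a \<beta>1 b \<beta>3] proot_pos by blast
    qed
  qed
  moreover have "inP (set q) w" using w by (simp add: inP_def)
  ultimately have "sortable q w" using aligned_sortable assms by blast
  then show ?thesis using ex_sortable_jirr_below[OF assms(2)] w assms by simp
qed

section \<open>Shards, meets and joins\<close>

lemma root_sign: "\<beta> \<in> roots \<Longrightarrow> \<beta> k \<noteq> 0 \<Longrightarrow> pos \<beta> \<longleftrightarrow> 0 < \<beta> k"
  using root_not_pos[of \<beta>] posD[of \<beta> k] posD[of "neg \<beta>" k] by (cases "pos \<beta>") (auto simp: neg_apply)

lemma inP_supp_iff: "inP I w \<Longrightarrow> supp_in I (w v) \<longleftrightarrow> supp_in I v"
  by (auto simp: supp_in_def inP_coord)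

lemma inP_inv_supp_iff: "inP I w \<Longrightarrow> supp_in I (inv w v) \<longleftrightarrow> supp_in I v"
  using inP_supp_iff[of I w "inv w v"] by (simp add: inP_def)

lemma inP_inv_coord: "inP I w \<Longrightarrow> k \<notin> I \<Longrightarrow> inv w v k = v k"
  using inP_coord[of I w k "inv w v"] by (simp add: inP_def)

lemma inP_right:
  assumes "inP I w" "e \<in> I" "e < n"
  shows "inP I (w \<circ> refl e)"
proof (cases "pos (w (simple e))")
  case True
  have w: "w \<in> W" using assms by (simp add: inP_def)
  have 1: "N (w \<circ> refl e) = insert (w (simple e)) (N w)" using N_right_up(1)[OF w assms(3) True] .
  have 2: "w \<circ> refl e \<in> W" using w assms(3) by blast
  show ?thesis unfolding inP_def 1 using 2 inP_supp[OF assms(1,2)] assms(1) by (auto simp: inP_def)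
next
  case False
  then show ?thesis using inP_right_down assms by blast
qed

lemma pos_image_supp:
  assumes "y \<in> W" "I \<subseteq> {..<n}" "\<And>e. e \<in> I \<Longrightarrow> pos (y (simple e))" "supp_in I v" "pos v"
  shows "pos (y v)"
  unfolding pos_def
proof
  fix k
  have t: "0 \<le> v i * y (simple i) k" for i
  proof (cases "i \<in> I")
    case True then show ?thesis using assms by (simp add: pos_def)
  qed (use assms in \<open>simp add: supp_in_def\<close>)
  show "0 \<le> y v k"
    unfolding W_expand[OF assms(1) supp_in_mono[OF assms(4,2)], of k] using t by (intro sum_nonneg) auto
qed

lemma neg_image_supp:
  assumes "y \<in> W" "I \<subseteq> {..<n}" "\<And>e. e \<in> I \<Longrightarrow> \<not> pos (y (simple e))" "supp_in I v" "pos v"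
  shows "pos (neg (y v))"
  unfolding pos_def
proof
  fix k
  have t: "v i * y (simple i) k \<le> 0" for i
  proof (cases "i \<in> I")
    case True
    then have "pos (neg (y (simple i)))" using assms root_not_pos roots_W simple_root by blast
    then have "y (simple i) k \<le> 0" using posD[of "neg (y (simple i))" k] by (simp add: neg_apply)
    then show ?thesis using assms by (simp add: pos_def mult_nonneg_nonpos)
  qed (use assms in \<open>simp add: supp_in_def\<close>)
  have "y v k \<le> 0"
    unfolding W_expand[OF assms(1) supp_in_mono[OF assms(4,2)], of k] using t by (intro sum_nonpos) auto
  then show "0 \<le> neg (y v) k" by (simp add: neg_apply)
qed

text \<open>\<open>w\<close> fixes the coordinates outside \<open>I\<close>, and a nonzero one of
  them decides the sign of the root.\<close>

lemma coset_N_outside: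
  assumes "x \<in> W" "inP I w" "\<beta> \<in> proots" "\<not> supp_in I (inv x \<beta>)"
  shows "\<beta> \<in> N (x \<circ> w) \<longleftrightarrow> \<beta> \<in> N x"
proof -
  have w: "w \<in> W" using assms by (simp add: inP_def)
  have r: "inv x \<beta> \<in> roots" "inv w (inv x \<beta>) \<in> roots" using roots_W assms w proot_root inv_W by blast+
  obtain k where k: "k \<notin> I" "inv x \<beta> k \<noteq> 0" using assms by (auto simp: supp_in_def)
  have "pos (inv w (inv x \<beta>)) \<longleftrightarrow> pos (inv x \<beta>)"
    using root_sign[OF r(1) k(2)] root_sign[OF r(2), of k] k inP_inv_coord[OF assms(2)] by simp
  then show ?thesis using assms w by (simp add: N_def inv_comp)
qed

lemma coset_minimal:
  assumes "x \<in> W" "I \<subseteq> {..<n}"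
  shows "\<exists>w. inP I w \<and> (\<forall>e\<in>I. pos (x (w (simple e))))"
proof -
  define P where "P c \<longleftrightarrow> (\<exists>w. inP I w \<and> card (N (x \<circ> w)) = c)" for c
  have "P (card (N (x \<circ> id)))" unfolding P_def using inP_id by blast
  then have "P (LEAST c. P c)" by (rule LeastI)
  then obtain w where w: "inP I w" "card (N (x \<circ> w)) = (LEAST c. P c)" unfolding P_def by blast
  have wW: "w \<in> W" using w by (simp add: inP_def)
  have xw: "x \<circ> w \<in> W" using wW assms by blast
  have "pos ((x \<circ> w) (simple e))" if e: "e \<in> I" for e
  proof (rule ccontr)
    have en: "e < n" using e assms by auto
    assume a: "\<not> pos ((x \<circ> w) (simple e))"
    have "inP I (w \<circ> refl e)" using inP_right w e en by blast
    then have "P (card (N (x \<circ> (w \<circ> refl e))))" unfolding P_def by blast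
    then have "(LEAST c. P c) \<le> card (N (x \<circ> (w \<circ> refl e)))" by (rule Least_le)
    then show False using card_N_right_down[OF xw en a] w(2) unfolding comp_assoc by linarith
  qed
  then show ?thesis using w(1) by auto
qed

lemma coset_maximal:
  assumes "finite W" "x \<in> W" "I \<subseteq> {..<n}"
  shows "\<exists>w. inP I w \<and> (\<forall>e\<in>I. \<not> pos (x (w (simple e))))"
proof -
  define C where "C = {w. inP I w}"
  define M where "M = Max ((\<lambda>w. card (N (x \<circ> w))) ` C)"
  have "C \<subseteq> W" by (auto simp: C_def inP_def)
  then have fin: "finite C" using assms(1) finite_subset by blast
  have ne: "C \<noteq> {}" unfolding C_def using inP_id by blast
  have "M \<in> (\<lambda>w. card (N (x \<circ> w))) ` C" unfolding M_def using fin ne by (intro Max_in) auto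
  then obtain w where w: "inP I w" "card (N (x \<circ> w)) = M" by (auto simp: C_def)
  have xw: "x \<circ> w \<in> W" using w assms by (auto simp: inP_def)
  have "\<not> pos ((x \<circ> w) (simple e))" if e: "e \<in> I" for e
  proof
    have en: "e < n" using e assms by auto
    assume a: "pos ((x \<circ> w) (simple e))"
    have "w \<circ> refl e \<in> C" using inP_right w e en unfolding C_def by blast
    then have "card (N (x \<circ> (w \<circ> refl e))) \<le> M" unfolding M_def using fin by (intro Max_ge finite_imageI imageI)
    then show False using card_N_right_up[OF xw en a] w(2) unfolding comp_assoc by linarith
  qed
  then show ?thesis using w(1) by auto
qed

lemma wall_root_proot: "x \<in> W \<Longrightarrow> i < n \<Longrightarrow> \<not> pos (x (simple i)) \<Longrightarrow> neg (x (simple i)) \<in> N x"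
  using N_right_down(1) by blast

text \<open>All letters of \<open>I\<close> are descents, so \<open>x\<close> is the maximal
  representative of its coset. The minimal one, \<open>y\<close>, inverts just the inversions of
  \<open>x\<close> outside the root subsystem attached to \<open>I\<close> at \<open>x\<close>. Both
  representatives are bounded by the same hyperplanes of this subsystem, so \<open>y\<close> can be
  left through the wall of \<open>i\<close>, which restores that single inversion.\<close>

lemma delete_walls:
  assumes x: "x \<in> W" and I: "I \<subseteq> {..<n}" "\<And>e. e \<in> I \<Longrightarrow> \<not> pos (x (simple e))" and i: "i \<in> I"
  shows "\<exists>b\<in>W. \<exists>e<n. N b = insert (neg (x (simple i))) {\<beta> \<in> N x. \<not> supp_in I (inv x \<beta>)}
    \<and> b (simple e) = x (simple i)"
proof -
  have inn: "i < n" using i I by auto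
  define \<gamma> where "\<gamma> = neg (x (simple i))"
  have gN: "\<gamma> \<in> N x" using wall_root_proot x inn I(2)[OF i] by (simp add: \<gamma>_def)
  then have gp: "\<gamma> \<in> proots" by (rule N_proot)
  obtain w where w: "inP I w" "\<And>e. e \<in> I \<Longrightarrow> pos (x (w (simple e)))" using coset_minimal[OF x I(1)] by blast
  have wW: "w \<in> W" using w by (simp add: inP_def)
  define y where "y = x \<circ> w"
  have y: "y \<in> W" using x wW by (auto simp: y_def)
  have yv: "y v = x (w v)" for v by (simp add: y_def)
  have invy: "inv y v = inv w (inv x v)" for v using x wW by (simp add: y_def inv_comp)
  have ypos: "pos (y v)" if "supp_in I v" "pos v" for v
    using pos_image_supp[OF y I(1)] w(2) that by (simp add: yv)
  have xneg: "pos (neg (x v))" if "supp_in I v" "pos v" for v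
    using neg_image_supp[OF x I] that by blast
  have inside: "pos (inv y \<beta>)" if b: "\<beta> \<in> proots" "supp_in I (inv x \<beta>)" for \<beta>
  proof (rule ccontr)
    assume a: "\<not> pos (inv y \<beta>)"
    have r: "inv y \<beta> \<in> roots" using roots_W y b proot_root inv_W by blast
    have s: "supp_in I (neg (inv y \<beta>))" using b inP_inv_supp_iff[OF w(1)] by (simp add: invy)
    have "pos (y (neg (inv y \<beta>)))" using ypos s a root_not_pos r by blast
    then have "pos (neg \<beta>)" using y by simp
    then show False using b root_not_pos proot_pos proot_root by blast
  qed
  have Ny: "N y = {\<beta> \<in> N x. \<not> supp_in I (inv x \<beta>)}"
  proof (intro set_eqI iffI)
    fix \<beta> assume b: "\<beta> \<in> N y"
    then have bp: "\<beta> \<in> proots" by (rule N_proot)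
    have "\<not> supp_in I (inv x \<beta>)" using inside[OF bp] b by (auto simp: N_def)
    then show "\<beta> \<in> {\<beta> \<in> N x. \<not> supp_in I (inv x \<beta>)}" using coset_N_outside[OF x w(1) bp] b by (simp add: y_def)
  next
    fix \<beta> assume b: "\<beta> \<in> {\<beta> \<in> N x. \<not> supp_in I (inv x \<beta>)}"
    then show "\<beta> \<in> N y" using coset_N_outside[OF x w(1), of \<beta>] N_proot[of \<beta> x] by (simp add: y_def)
  qed
  have ig: "inv x \<gamma> = neg (simple i)" using x by (simp add: \<gamma>_def)
  define \<rho> where "\<rho> = inv y \<gamma>"
  have rr: "\<rho> \<in> roots" using roots_W y gp proot_root inv_W unfolding \<rho>_def by blast
  have rp: "pos \<rho>" unfolding \<rho>_def using inside[OF gp] ig i by simp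
  have rs: "supp_in I \<rho>" using inP_inv_supp_iff[OF w(1)] ig i by (simp add: \<rho>_def invy)
  have wr: "w \<rho> = neg (simple i)" using wW ig by (simp add: \<rho>_def invy)
  have wneg: "pos (neg (w (simple e)))" if e: "e \<in> I" for e
  proof (rule ccontr)
    have en: "e < n" using e I by auto
    have r: "w (simple e) \<in> roots" "y (simple e) \<in> roots" using roots_W[OF wW simple_root[OF en]] roots_W[OF y simple_root[OF en]] .
    assume "\<not> ?thesis"
    then have "pos (w (simple e))" using root_pos_or_neg r by blast
    then have "pos (neg (y (simple e)))" using xneg inP_supp[OF w(1) e] by (simp add: yv)
    then show False using w(2)[OF e] r root_not_pos yv by metis
  qed
  obtain e where e: "\<rho> e \<noteq> 0" using root_nonzero rr by blast
  then have eI: "e \<in> I" using rs by (auto simp: supp_in_def)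
  then have en: "e < n" using I by auto
  have re: "0 < \<rho> e" using e posD[OF rp, of e] by simp
  have wep: "neg (w (simple e)) \<in> proots" using wneg[OF eI] roots_W[OF wW simple_root[OF en]] by (simp add: proots_def)
  \<comment> \<open>In the expansion of \<open>w \<rho> = neg (simple i)\<close> all terms are
    nonpositive, so none can have a coordinate other than \<open>i\<close>.\<close>
  have "neg (w (simple e)) = simple i"
  proof (rule ccontr)
    assume "\<not> ?thesis"
    then obtain l where l: "l \<noteq> i" "0 < neg (w (simple e)) l" using proot_other_coord[OF wep inn] by blast
    have t: "\<rho> k * w (simple k) l \<le> 0" for k
    proof (cases "k \<in> I")
      case True
      then show ?thesis using posD[OF wneg[OF True], of l] posD[OF rp, of k] by (simp add: neg_apply mult_nonneg_nonpos)
    qed (use rs in \<open>simp add: supp_in_def\<close>)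
    have "w \<rho> l = (\<Sum>k<n. \<rho> k * w (simple k) l)" using W_expand[OF wW root_supp[OF rr]] .
    also have "\<dots> \<le> \<rho> e * w (simple e) l"
    proof -
      have "(\<Sum>k\<in>{..<n} - {e}. \<rho> k * w (simple k) l) \<le> 0" using t by (intro sum_nonpos) auto
      then show ?thesis using en by (simp add: sum.remove[of "{..<n}" e])
    qed
    also have "\<dots> < 0" using re l by (simp add: neg_apply mult_pos_neg)
    finally show False using wr l by (simp add: neg_apply simple_other)
  qed
  then have "w (simple e) = neg (simple i)" by (metis neg_neg)
  then have ye: "y (simple e) = \<gamma>" using x by (simp add: yv \<gamma>_def)
  define b where "b = y \<circ> refl e"
  have "b \<in> W" using y en by (auto simp: b_def)
  moreover have "N b = insert \<gamma> (N y)" using N_right_up(1)[OF y en] ye gp proot_pos by (simp only: b_def)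
  moreover have "b (simple e) = x (simple i)" using y en ye by (simp add: b_def refl_simple \<gamma>_def)
  ultimately show ?thesis using Ny en unfolding \<gamma>_def by blast
qed

lemma delete_walls_obtain:
  assumes "x \<in> W" "I \<subseteq> {..<n}" "\<forall>e\<in>I. \<not> pos (x (simple e))" "i \<in> I" "x (simple i) = neg \<gamma>"
  obtains b e where "b \<in> W" "e < n" "N b = insert \<gamma> {\<beta> \<in> N x. \<not> supp_in I (inv x \<beta>)}" "b (simple e) = neg \<gamma>"
proof -
  have "\<exists>b\<in>W. \<exists>e<n. N b = insert (neg (x (simple i))) {\<beta> \<in> N x. \<not> supp_in I (inv x \<beta>)}
    \<and> b (simple e) = x (simple i)"
    by (rule delete_walls) (use assms in blast)+
  then have "\<exists>b\<in>W. \<exists>e<n. N b = insert \<gamma> {\<beta> \<in> N x. \<not> supp_in I (inv x \<beta>)} \<and> b (simple e) = neg \<gamma>"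
    unfolding assms(5) neg_neg .
  then show thesis by (elim bexE exE conjE) (rule that)
qed

lemma supp_pair: "i \<noteq> k \<Longrightarrow> supp_in {i, k} v \<Longrightarrow> v = lc (v i) (simple i) (v k) (simple k)"
  by (auto simp: supp_in_def lc_def simple_def fun_eq_iff)

lemma plane_coords:
  assumes "t \<in> W" "i \<noteq> k" "supp_in {i, k} (inv t \<beta>)"
  shows "\<beta> = lc (inv t \<beta> i) (t (simple i)) (inv t \<beta> k) (t (simple k))"
  using supp_pair[OF assms(2,3)] assms(1) by (metis W_lc inv_right)

lemma neg_inv_N: "x \<in> W \<Longrightarrow> \<beta> \<in> N x \<Longrightarrow> pos (neg (inv x \<beta>))"
proof -
  assume a: "x \<in> W" "\<beta> \<in> N x"
  have "inv x \<beta> \<in> roots" using roots_W[OF inv_W[OF a(1)] proot_root[OF N_proot[OF a(2)]]] .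
  moreover have "\<not> pos (inv x \<beta>)" using a by (simp add: N_def)
  ultimately show ?thesis using root_not_pos by blast
qed

lemma not_N_pos: "\<beta> \<in> proots \<Longrightarrow> \<beta> \<notin> N x \<Longrightarrow> pos (inv x \<beta>)"
  by (simp add: N_def)

lemma plane_N:
  assumes t: "t \<in> W" "i \<noteq> k" "t (simple i) = neg \<gamma>" "t (simple k) = neg \<delta>"
    and b: "\<beta> \<in> N t" "supp_in {i, k} (inv t \<beta>)"
  shows "\<exists>a c. 0 \<le> a \<and> 0 \<le> c \<and> \<beta> = lc a \<gamma> c \<delta>"
proof (intro exI conjI)
  have p: "pos (neg (inv t \<beta>))" using neg_inv_N t b by blast
  show "0 \<le> - inv t \<beta> i" "0 \<le> - inv t \<beta> k" using posD[OF p, of i] posD[OF p, of k] by (simp_all add: neg_apply)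
  show "\<beta> = lc (- inv t \<beta> i) \<gamma> (- inv t \<beta> k) \<delta>"
    using plane_coords[OF t(1,2) b(2)] unfolding t(3,4) by (simp add: lc_def neg_def)
qed

lemma lc_zero_right: "lc a u 0 v k = a * u k"
  by (simp add: lc_apply)

text \<open>Being an inversion of \<open>t\<close> in its plane, \<open>\<beta>\<close> is a
  nonnegative combination of the walls \<open>\<gamma>\<close> and \<open>\<delta>\<close>; as
  \<open>\<delta>\<close> is not an inversion of \<open>z\<close>, a positive coefficient at
  \<open>\<delta>\<close> is impossible by \<open>wall_not_N\<close>.\<close>

lemma wall_plane:
  assumes z: "z \<in> W" "l < n" "z (simple l) = neg \<gamma>" and g: "\<gamma> \<in> proots"
    and t: "t \<in> W" "i \<noteq> k" "t (simple i) = neg \<gamma>" "t (simple k) = neg \<delta>" and d: "\<delta> \<in> proots" "\<delta> \<notin> N z"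
    and b: "\<beta> \<in> N z" "\<beta> \<in> N t" "supp_in {i, k} (inv t \<beta>)"
  shows "\<beta> = \<gamma>"
proof -
  obtain a c where ac: "0 \<le> a" "0 \<le> c" "\<beta> = lc a \<gamma> c \<delta>" using plane_N t b by blast
  have "\<delta> \<noteq> neg \<gamma>" using proot_not_neg g d by blast
  then have "\<not> 0 < c" using wall_not_N[OF z proot_root[OF d(1)] not_N_pos[OF d]] b ac by blast
  then have "c = 0" using ac by simp
  then show ?thesis using proot_multiple[OF N_proot[OF b(1)] g] ac lc_zero_right by metis
qed

lemma jirr_below:
  assumes j: "jirr j i" "j (simple i) = neg \<gamma>" and y: "y \<in> W" "\<gamma> \<in> N y" "N y \<subseteq> N j"
  shows "y = j"
proof (rule ccontr)
  assume "y \<noteq> j"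
  then obtain k where k: "k < n" "\<not> pos (j (simple k))" "neg (j (simple k)) \<notin> N y"
    using descent_above[OF y(1) _ y(3)] j by (auto simp: jirr_def)
  then have "k = i" using j by (auto simp: jirr_def)
  then show False using k j y by simp
qed

text \<open>A form of semidistributivity of the weak order.\<close>

lemma jirr_least:
  assumes j: "jirr j i" "j (simple i) = neg \<gamma>"
  shows "t \<in> W \<Longrightarrow> e < n \<Longrightarrow> t (simple e) = neg \<gamma> \<Longrightarrow> N j \<subseteq> N t \<Longrightarrow> y \<in> W \<Longrightarrow> N y \<subseteq> N t \<Longrightarrow> \<gamma> \<in> N y \<Longrightarrow> N j \<subseteq> N y"
proof (induction "card (N t)" arbitrary: t e y rule: less_induct)
  case less
  note t = less.prems(1,2,3)
  have jW: "j \<in> W" and i: "i < n" and nj: "\<not> pos (j (simple i))" using j by (auto simp: jirr_def)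
  have gj: "\<gamma> \<in> N j" using wall_root_proot[OF jW i nj] j by simp
  then have gp: "\<gamma> \<in> proots" by (rule N_proot)
  define P where "P c \<longleftrightarrow> (\<exists>y'\<in>W. N y' \<subseteq> N y \<and> \<gamma> \<in> N y' \<and> card (N y') = c)" for c
  have "P (card (N y))" unfolding P_def using less.prems by blast
  then have "P (LEAST c. P c)" by (rule LeastI)
  \<comment> \<open>Minimality of \<open>z\<close> forces every lower wall of \<open>z\<close> to be
    \<open>\<gamma>\<close>.\<close>
  then obtain z where z: "z \<in> W" "N z \<subseteq> N y" "\<gamma> \<in> N z" "card (N z) = (LEAST c. P c)" unfolding P_def by blast
  have "z \<noteq> id" using z(3) N_id by blast
  then obtain l where l: "l < n" "\<not> pos (z (simple l))" using W_not_id[OF z(1)] by blast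
  have zl: "z (simple l) = neg \<gamma>"
  proof (rule ccontr)
    assume a: "z (simple l) \<noteq> neg \<gamma>"
    have Nz: "N z = insert (neg (z (simple l))) (N (z \<circ> refl l))" using N_right_down(1)[OF z(1) l] .
    have "neg (z (simple l)) \<noteq> \<gamma>" using a by (metis neg_neg)
    then have "\<gamma> \<in> N (z \<circ> refl l)" using z(3) Nz by (metis insertE)
    moreover have "N (z \<circ> refl l) \<subseteq> N y" using Nz z(2) by blast
    moreover have "z \<circ> refl l \<in> W" using z(1) l by blast
    ultimately have "P (card (N (z \<circ> refl l)))" unfolding P_def by blast
    then have "(LEAST c. P c) \<le> card (N (z \<circ> refl l))" by (rule Least_le)
    then show False using card_N_right_down[OF z(1) l] z(4) by simp
  qed
  have zt: "N z \<subseteq> N t" using z less.prems by blast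
  have "N j \<subseteq> N z"
  proof (cases "j = t \<or> z = t")
    case True
    then show ?thesis using jirr_below[OF j z(1,3)] zt less.prems by blast
  next
    case False
    \<comment> \<open>\<open>k1\<close> is a lower wall of \<open>t\<close> missed by
      \<open>j\<close>, and \<open>k2\<close> one missed by \<open>z\<close>. From \<open>t\<close>,
      the elements \<open>b1\<close> and \<open>b2\<close> delete the subsystem of
      \<open>\<gamma>\<close> with the respective wall, and \<open>b\<close> that of all three
      walls, always keeping \<open>\<gamma>\<close>. Induction at \<open>b1\<close> puts
      \<open>j\<close> below \<open>b\<close>, and then induction at \<open>b2\<close> puts it below
      \<open>z\<close>.\<close>
    obtain k1 where k1: "k1 < n" "\<not> pos (t (simple k1))" "neg (t (simple k1)) \<notin> N j"
      using descent_above[OF jW t(1) less.prems(4)] False by blast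
    obtain k2 where k2: "k2 < n" "\<not> pos (t (simple k2))" "neg (t (simple k2)) \<notin> N z"
      using descent_above[OF z(1) t(1) zt] False by blast
    have te: "\<not> pos (t (simple e))" using t(3) gp proot_not_neg root_not_pos proot_pos proot_root neg_neg neg_root by metis
    have ek: "e \<noteq> k1" "e \<noteq> k2" using k1 k2 gj z(3) t(3) by auto
    have I: "{e, k1} \<subseteq> {..<n}" "{e, k2} \<subseteq> {..<n}" "{e, k1, k2} \<subseteq> {..<n}" using t(2) k1(1) k2(1) by auto
    have D: "\<forall>d\<in>{e, k1}. \<not> pos (t (simple d))" "\<forall>d\<in>{e, k2}. \<not> pos (t (simple d))" "\<forall>d\<in>{e, k1, k2}. \<not> pos (t (simple d))"
      using te k1(2) k2(2) by blast+
    obtain b1 e1 where b1: "b1 \<in> W" "e1 < n" "N b1 = insert \<gamma> {\<beta> \<in> N t. \<not> supp_in {e, k1} (inv t \<beta>)}" "b1 (simple e1) = neg \<gamma>"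
      by (rule delete_walls_obtain[OF t(1) I(1) D(1) insertI1 t(3)])
    obtain b2 e2 where b2: "b2 \<in> W" "e2 < n" "N b2 = insert \<gamma> {\<beta> \<in> N t. \<not> supp_in {e, k2} (inv t \<beta>)}" "b2 (simple e2) = neg \<gamma>"
      by (rule delete_walls_obtain[OF t(1) I(2) D(2) insertI1 t(3)])
    obtain b where b: "b \<in> W" "N b = insert \<gamma> {\<beta> \<in> N t. \<not> supp_in {e, k1, k2} (inv t \<beta>)}"
      by (rule delete_walls_obtain[OF t(1) I(3) D(3) insertI1 t(3)])
    have gt: "\<gamma> \<in> N t" using gj less.prems by blast
    have below: "N z' \<subseteq> insert \<gamma> {\<beta> \<in> N t. \<not> supp_in {e, k} (inv t \<beta>)}"
      if "z' \<in> W" "l' < n" "z' (simple l') = neg \<gamma>" "N z' \<subseteq> N t" "k < n" "\<not> pos (t (simple k))"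
        "neg (t (simple k)) \<notin> N z'" "e \<noteq> k" for z' l' k
    proof
      fix \<beta> assume bz: "\<beta> \<in> N z'"
      have dp: "neg (t (simple k)) \<in> proots" using N_proot[OF wall_root_proot[OF t(1) that(5,6)]] .
      show "\<beta> \<in> insert \<gamma> {\<beta> \<in> N t. \<not> supp_in {e, k} (inv t \<beta>)}"
        using wall_plane[OF that(1-3) gp t(1) that(8) t(3) neg_neg[symmetric] dp that(7) bz] bz that(4) by blast
    qed
    have smaller: "card (N b') < card (N t)"
      if "N b' = insert \<gamma> {\<beta> \<in> N t. \<not> supp_in {e, k} (inv t \<beta>)}" "k < n" "\<not> pos (t (simple k))" "e \<noteq> k" for b' k
    proof -
      have kN: "neg (t (simple k)) \<in> N t" using wall_root_proot[OF t(1) that(2,3)] .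
      have "neg (t (simple k)) \<noteq> \<gamma>"
      proof
        assume "neg (t (simple k)) = \<gamma>"
        then have "t (simple k) = t (simple e)" using t(3) by (metis neg_neg)
        then have "simple k = simple e" using t(1) by (metis inv_left)
        then show False using that(4) by (metis simple_other simple_same zero_neq_one)
      qed
      moreover have "supp_in {e, k} (inv t (neg (t (simple k))))" using t(1) by simp
      ultimately have "neg (t (simple k)) \<notin> N b'" using that(1) by auto
      moreover have "N b' \<subseteq> N t" using that(1) gt by auto
      ultimately have "N b' \<subset> N t" using kN by blast
      then show ?thesis using finite_N[OF t(1)] psubset_card_mono by blast
    qed
    have bsub: "N b \<subseteq> N b1" "N b \<subseteq> N b2"
      unfolding b(2) b1(3) b2(3) using supp_in_mono[of "{e, k1}" _ "{e, k1, k2}"] supp_in_mono[of "{e, k2}" _ "{e, k1, k2}"] by blast+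
    have jb1: "N j \<subseteq> N b1" unfolding b1(3) using below[OF jW i j(2) less.prems(4) k1 ek(1)] .
    have zb2: "N z \<subseteq> N b2" unfolding b2(3) using below[OF z(1) l(1) zl zt k2 ek(2)] .
    have gb: "\<gamma> \<in> N b" using b by simp
    have "N j \<subseteq> N b" using less.hyps[OF smaller[OF b1(3) k1(1,2) ek(1)] b1(1,2,4) jb1 b(1) bsub(1) gb] .
    then have "N j \<subseteq> N b2" using bsub by blast
    then show ?thesis using less.hyps[OF smaller[OF b2(3) k2(1,2) ek(2)] b2(1,2,4) _ z(1) zb2 z(3)] by blast
  qed
  then show ?case using z by blast
qed

text \<open>Up to sign, \<open>inv z\<close> carries the decomposition to one of the simple root
  \<open>simple k\<close>, which has no proper decomposition into positive roots.\<close>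

lemma lower_wall_not_both:
  assumes "z \<in> W" "k < n" "z (simple k) = neg \<gamma>" "\<gamma> = lc a \<beta>1 b \<beta>3" "0 < a" "0 < b" "\<beta>1 \<in> N z" "\<beta>3 \<in> N z"
  shows "\<beta>1 = \<gamma>"
proof -
  have "neg (inv z \<beta>) \<in> proots" if "\<beta> \<in> N z" for \<beta>
    using neg_inv_N[OF assms(1) that] roots_W[OF inv_W[OF assms(1)] proot_root[OF N_proot[OF that]]]
    by (simp add: proots_def)
  then have r: "neg (inv z \<beta>1) \<in> proots" "neg (inv z \<beta>3) \<in> proots" using assms(7,8) by blast+
  have "inv z \<gamma> = neg (simple k)" using assms(1,3) by (metis W_neg inv_left neg_neg)
  then have "simple k = neg (inv z (lc a \<beta>1 b \<beta>3))" using assms(4) by simp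
  also have "\<dots> = lc a (neg (inv z \<beta>1)) b (neg (inv z \<beta>3))" using assms(1) by (simp add: W_lc neg_lc)
  finally have "neg (inv z \<beta>1) = simple k" using simple_decomp[OF assms(2) r assms(5,6)] by blast
  then have "z (inv z \<beta>1) = neg (z (simple k))" using assms(1) by (metis W_neg neg_neg)
  then show ?thesis using assms(1,3) by simp
qed

text \<open>The hypothesis puts \<open>x\<close> and \<open>j\<close> into the same shard of the hyperplane of \<open>\<gamma>\<close>. They are joined by
  moves through rank two subsystems in which \<open>\<gamma>\<close> is simple, each of which brings \<open>x\<close> closer to \<open>j\<close>
  and leaves the least element inverting \<open>\<gamma>\<close> unchanged.\<close>

lemma jirr_le_shard:
  assumes fin: "finite W" and j: "jirr j i'" "j (simple i') = neg \<gamma>"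
  shows "x \<in> W \<Longrightarrow> i < n \<Longrightarrow> x (simple i) = neg \<gamma> \<Longrightarrow>
    (\<And>\<beta>1 \<beta>3 a b. \<beta>1 \<in> proots \<Longrightarrow> \<beta>3 \<in> proots \<Longrightarrow> 0 < a \<Longrightarrow> 0 < b \<Longrightarrow> \<gamma> = lc a \<beta>1 b \<beta>3 \<Longrightarrow> \<beta>1 \<in> N x \<longleftrightarrow> \<beta>1 \<in> N j)
    \<Longrightarrow> N j \<subseteq> N x"
proof (induction "card ((N x - N j) \<union> (N j - N x))" arbitrary: x i rule: less_induct)
  case less
  note x = less.prems(1,2,3) and agree = less.prems(4)
  have jW: "j \<in> W" and i': "i' < n" and nj: "\<not> pos (j (simple i'))" using j by (auto simp: jirr_def)
  have gj: "\<gamma> \<in> N j" using wall_root_proot[OF jW i' nj] j by simp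
  then have gp: "\<gamma> \<in> proots" by (rule N_proot)
  have xi: "\<not> pos (x (simple i))" using x(3) gp proot_not_neg root_not_pos proot_pos proot_root neg_neg neg_root by metis
  have gx: "\<gamma> \<in> N x" using wall_root_proot[OF x(1,2) xi] x(3) by simp
  have finD: "finite ((N x - N j) \<union> (N j - N x))" using finite_N x(1) jW by simp
  have step: "card ((N x2 - N j) \<union> (N j - N x2)) < card ((N x - N j) \<union> (N j - N x))"
    if "(N x2 - N j) \<union> (N j - N x2) \<subseteq> (N x - N j) \<union> (N j - N x)"
      "\<theta> \<in> (N x - N j) \<union> (N j - N x)" "\<theta> \<notin> (N x2 - N j) \<union> (N j - N x2)" for x2 \<theta>
    using that finD by (intro psubset_card_mono) auto
  show ?case
  proof (cases "x = j")
    case False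
    \<comment> \<open>A simple root made negative by \<open>g\<close> gives a wall of
      \<open>x\<close> that separates \<open>x\<close> from \<open>j\<close>.\<close>
    define g where "g = inv j \<circ> x"
    have gW: "g \<in> W" using x(1) jW by (auto simp: g_def)
    have "g \<noteq> id"
    proof
      assume "g = id"
      then have "\<And>v. inv j (x v) = v" by (metis comp_apply g_def id_apply)
      then have "x = j" using jW by (metis ext inv_right)
      then show False using False by simp
    qed
    then obtain k where k: "k < n" "\<not> pos (inv j (x (simple k)))" using W_not_id[OF gW] by (auto simp: g_def)
    have "inv j (x (simple i)) = simple i'" using x(3) j(2) jW by (metis W_neg inv_left neg_neg)
    then have ik: "i \<noteq> k" using k pos_simple by metis
    have kr: "x (simple k) \<in> roots" using roots_W x(1) k by simp
    show ?thesis
    proof (cases "pos (x (simple k))")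
      case False
      define \<delta> where "\<delta> = neg (x (simple k))"
      have dx: "\<delta> \<in> N x" using wall_root_proot[OF x(1) k(1) False] by (simp add: \<delta>_def)
      then have dp: "\<delta> \<in> proots" by (rule N_proot)
      have dj: "\<delta> \<notin> N j"
      proof
        assume "\<delta> \<in> N j"
        then have "pos (neg (inv j \<delta>))" using neg_inv_N jW by blast
        then show False using k jW by (simp add: \<delta>_def)
      qed
      have I: "{i, k} \<subseteq> {..<n}" "i \<in> {i, k}" using x k by simp_all
      have nn: "\<forall>e\<in>{i, k}. \<not> pos (x (simple e))" using xi False by blast
      \<comment> \<open>A separating lower wall: move down through the subsystem of
        \<open>\<gamma>\<close> and \<open>\<delta>\<close>. By \<open>wall_plane\<close> none of
        the deleted roots is an inversion of \<open>j\<close>.\<close>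
      obtain x2 e where x2: "x2 \<in> W" "e < n" "N x2 = insert \<gamma> {\<beta> \<in> N x. \<not> supp_in {i, k} (inv x \<beta>)}" "x2 (simple e) = neg \<gamma>"
        by (rule delete_walls_obtain[OF x(1) I(1) nn I(2) x(3)])
      have sub: "N x2 \<subseteq> N x" using x2(3) gx by auto
      have dis: "\<beta> \<notin> N j" if "\<beta> \<in> N x" "\<beta> \<notin> N x2" for \<beta>
      proof
        assume "\<beta> \<in> N j"
        moreover have "supp_in {i, k} (inv x \<beta>)" using that x2(3) by auto
        ultimately have "\<beta> = \<gamma>"
          using wall_plane[OF jW i' j(2) gp x(1) ik x(3) _ dp dj _ that(1)] by (simp add: \<delta>_def)
        then show False using that x2(3) by simp
      qed
      have "supp_in {i, k} (inv x \<delta>)" using x(1) by (simp add: \<delta>_def)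
      moreover have "\<delta> \<noteq> \<gamma>" using dj gj by blast
      ultimately have dx2: "\<delta> \<notin> N x2" using x2(3) by auto
      have "card ((N x2 - N j) \<union> (N j - N x2)) < card ((N x - N j) \<union> (N j - N x))"
        by (rule step[of _ \<delta>]) (use sub dis dx dj dx2 in blast)+
      moreover have "\<beta>1 \<in> N x2 \<longleftrightarrow> \<beta>1 \<in> N j"
        if "\<beta>1 \<in> proots" "\<beta>3 \<in> proots" "0 < a" "0 < b" "\<gamma> = lc a \<beta>1 b \<beta>3" for \<beta>1 \<beta>3 a b
        using agree[OF that] sub dis by blast
      ultimately have "N j \<subseteq> N x2" using less.hyps[OF _ x2(1,2,4)] by blast
      then show ?thesis using sub by blast
    next
      case True
      define \<theta> where "\<theta> = x (simple k)"
      have tp: "\<theta> \<in> proots" using kr True by (simp add: \<theta>_def proots_def)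
      have tj: "\<theta> \<in> N j" using tp k by (simp add: N_def \<theta>_def)
      have tx: "\<theta> \<notin> N x" using N_right_up(2)[OF x(1) k(1) True] by (simp add: \<theta>_def)
      have tg: "\<theta> \<noteq> \<gamma>" using tx gx by blast
      have I: "{i, k} \<subseteq> {..<n}" using x k by simp
      \<comment> \<open>A separating upper wall: climb to the maximal representative
        \<open>t\<close> of the coset of \<open>i\<close> and \<open>k\<close>.\<close>
      obtain w where w: "inP {i, k} w" "\<And>e. e \<in> {i, k} \<Longrightarrow> \<not> pos (x (w (simple e)))"
        using coset_maximal[OF fin x(1) I] by blast
      have wW: "w \<in> W" using w by (simp add: inP_def)
      define t where "t = x \<circ> w"
      have tW: "t \<in> W" using x(1) wW by (auto simp: t_def)
      have tv: "t v = x (w v)" for v by (simp add: t_def)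
      have tinv: "inv t v = inv w (inv x v)" for v using x(1) wW by (simp add: t_def inv_comp)
      have tn: "\<not> pos (t (simple e))" if "e \<in> {i, k}" for e using w(2)[OF that] by (simp only: tv not_False_eq_True)
      have supp_t: "supp_in {i, k} (inv t v) \<longleftrightarrow> supp_in {i, k} (inv x v)" for v
        unfolding tinv using inP_inv_supp_iff[OF w(1)] .
      have inside: "\<beta> \<in> N t" if "\<beta> \<in> proots" "supp_in {i, k} (inv x \<beta>)" for \<beta>
      proof (rule ccontr)
        assume "\<beta> \<notin> N t"
        then have "pos (inv t \<beta>)" using not_N_pos that by blast
        then have "pos (neg (t (inv t \<beta>)))" using neg_image_supp[OF tW I tn] supp_t that by blast
        then have "pos (neg \<beta>)" using tW by simp
        then show False using that proot_pos proot_root root_not_pos by blast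
      qed
      have outside: "\<beta> \<in> N t \<longleftrightarrow> \<beta> \<in> N x" if "\<beta> \<in> proots" "\<not> supp_in {i, k} (inv x \<beta>)" for \<beta>
        using coset_N_outside[OF x(1) w(1) that] by (simp only: t_def)
      have sub: "N x \<subseteq> N t" using inside outside N_proot by blast
      have tt: "\<theta> \<in> N t" using inside[OF tp] x(1) by (simp add: \<theta>_def)
      define \<epsilon> where "\<epsilon> e = neg (t (simple e))" for e
      have eN: "\<epsilon> e \<in> N t" if "e \<in> {i, k}" for e using wall_root_proot[OF tW _ tn[OF that]] that I by (auto simp: \<epsilon>_def)
      \<comment> \<open>An inversion of \<open>x\<close> in this plane is a multiple of
        \<open>\<gamma>\<close> minus \<open>c\<close> times \<open>\<theta>\<close>. As
        \<open>j\<close> inverts \<open>\<theta>\<close>, \<open>wall_not_N\<close> admits it as an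
        inversion of \<open>j\<close> only for \<open>c = 0\<close>.\<close>
      have notboth: "\<epsilon> e = \<gamma>" if e: "e \<in> {i, k}" "\<epsilon> e \<in> N x" "\<epsilon> e \<in> N j" for e
      proof (rule ccontr)
        assume ne: "\<epsilon> e \<noteq> \<gamma>"
        have "supp_in {i, k} (inv t (\<epsilon> e))" using e(1) tW by (auto simp: \<epsilon>_def)
        then have s: "supp_in {i, k} (inv x (\<epsilon> e))" using supp_t by blast
        define c where "c = - inv x (\<epsilon> e) k"
        have "0 \<le> c" using posD[OF neg_inv_N[OF x(1) e(2)], of k] by (simp add: c_def neg_apply)
        have eq: "\<epsilon> e = lc (- inv x (\<epsilon> e) i) \<gamma> c (neg \<theta>)"
          using plane_coords[OF x(1) ik s] unfolding x(3) \<theta>_def[symmetric] by (simp add: lc_def neg_def c_def)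
        have "c \<noteq> 0"
        proof
          assume "c = 0"
          then have "\<epsilon> e = \<gamma>"
            using proot_multiple[OF N_proot[OF e(2)] gp] eq lc_zero_right by metis
          then show False using ne by simp
        qed
        then have "0 < c" using \<open>0 \<le> c\<close> by simp
        moreover have "pos (inv j (neg \<theta>))" using neg_inv_N[OF jW tj] jW by simp
        moreover have "neg \<theta> \<noteq> neg \<gamma>" using tg by (metis neg_neg)
        moreover have "neg \<theta> \<in> roots" using tp proot_root by simp
        ultimately have "lc (- inv x (\<epsilon> e) i) \<gamma> c (neg \<theta>) \<notin> N j"
          using wall_not_N[OF jW i' j(2)] by blast
        then show False using eq e(3) by simp
      qed
      have gt: "\<gamma> \<in> N t" using gx sub by blast
      have "supp_in {i, k} (inv t \<gamma>)" using supp_t x(1,3) by (metis W_neg insertI1 inv_left neg_neg supp_in_neg supp_in_simple)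
      then obtain c1 c2 where c: "0 \<le> c1" "0 \<le> c2" "\<gamma> = lc c1 (\<epsilon> i) c2 (\<epsilon> k)"
        using plane_N[OF tW ik _ _ gt, of "\<epsilon> i" "\<epsilon> k"] by (auto simp: \<epsilon>_def)
      have ep: "\<epsilon> i \<in> proots" "\<epsilon> k \<in> proots" using eN N_proot by auto
      \<comment> \<open>If \<open>\<gamma>\<close> is a positive combination of both walls of
        \<open>t\<close>, one of them is an inversion of \<open>x\<close>, hence of \<open>j\<close>
        by \<open>agree\<close>, and then \<open>notboth\<close> makes it equal to
        \<open>\<gamma>\<close>.\<close>
      have "\<exists>e\<in>{i, k}. \<epsilon> e = \<gamma>"
      proof (cases "c1 = 0 \<or> c2 = 0")
        case True
        then show ?thesis
        proof
          assume "c1 = 0"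
          then have "\<gamma> l = c2 * \<epsilon> k l" for l using c(3) by (simp add: lc_apply)
          then have "\<gamma> = \<epsilon> k" using proot_multiple[OF gp ep(2)] by blast
          then show ?thesis by auto
        next
          assume "c2 = 0"
          then have "\<gamma> l = c1 * \<epsilon> i l" for l using c(3) by (simp add: lc_apply)
          then have "\<gamma> = \<epsilon> i" using proot_multiple[OF gp ep(1)] by blast
          then show ?thesis by auto
        qed
      next
        case False
        then have c0: "0 < c1" "0 < c2" using c by auto
        have c': "\<gamma> = lc c2 (\<epsilon> k) c1 (\<epsilon> i)" using c(3) by (simp add: lc_def add.commute)
        have "\<epsilon> i \<in> N x \<or> \<epsilon> k \<in> N x"
          using N_coclosed[OF x(1) ep, of c1 c2] c gx by simp
        then show ?thesis
        proof
          assume "\<epsilon> i \<in> N x"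
          then show ?thesis using notboth[of i] agree[OF ep c0 c(3)] by blast
        next
          assume "\<epsilon> k \<in> N x"
          then show ?thesis using notboth[of k] agree[OF ep(2,1) c0(2,1) c'] by blast
        qed
      qed
      then obtain e where e: "e \<in> {i, k}" "\<epsilon> e = \<gamma>" by blast
      define e' where "e' = (if e = i then k else i)"
      have ee: "e' \<in> {i, k}" "e \<noteq> e'" "{e, e'} = {i, k}" "e < n" using e ik x k by (auto simp: e'_def)
      have te: "t (simple e) = neg \<gamma>" using e(2) by (metis \<epsilon>_def neg_neg)
      have te': "t (simple e') = neg (\<epsilon> e')" by (simp add: \<epsilon>_def)
      have e'p: "\<epsilon> e' \<in> proots" using eN[OF ee(1)] N_proot by blast
      have dj: "\<epsilon> e' \<in> N j"
      proof (rule ccontr)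
        assume a: "\<epsilon> e' \<notin> N j"
        have "supp_in {e, e'} (inv t \<theta>)" unfolding ee(3) supp_t using x(1) by (simp add: \<theta>_def)
        then have "\<theta> = \<gamma>" using wall_plane[OF jW i' j(2) gp tW ee(2) te te' e'p a tj tt] by blast
        then show False using tg by simp
      qed
      have dis: "\<beta> \<in> N j" if "\<beta> \<in> N t" "\<beta> \<notin> N x" for \<beta>
      proof -
        have bt: "\<beta> \<in> N t" using that by blast
        have "supp_in {i, k} (inv x \<beta>)" using outside[OF N_proot[OF bt]] that by blast
        then have sb: "supp_in {e, e'} (inv t \<beta>)" unfolding ee(3) supp_t .
        then obtain a1 a2 where a: "0 \<le> a1" "0 \<le> a2" "\<beta> = lc a1 \<gamma> a2 (\<epsilon> e')"
          using plane_N[OF tW ee(2) te te' bt sb] by (elim exE conjE)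
        show ?thesis using N_closed[OF jW gj dj a(1,2)] N_proot[OF bt] proot_root a(3) by simp
      qed
      have "card ((N t - N j) \<union> (N j - N t)) < card ((N x - N j) \<union> (N j - N x))"
        by (rule step[of _ \<theta>]) (use sub dis tx tj tt in blast)+
      moreover have "\<beta>1 \<in> N t \<longleftrightarrow> \<beta>1 \<in> N j"
        if "\<beta>1 \<in> proots" "\<beta>3 \<in> proots" "0 < a" "0 < b" "\<gamma> = lc a \<beta>1 b \<beta>3" for \<beta>1 \<beta>3 a b
        using agree[OF that] sub dis by blast
      ultimately have "N j \<subseteq> N t" using less.hyps[OF _ tW ee(4) te] by blast
      \<comment> \<open>The climb gained inversions; \<open>jirr_least\<close> takes the bound from
        \<open>t\<close> back down to \<open>x\<close>.\<close>
      then show ?thesis using jirr_least[OF j tW ee(4) te _ x(1) sub gx] by blast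
    qed
  qed simp
qed

text \<open>Of two summands, the one that comes first lies in both sets by goodness. Then the other
  lies in neither, because a lower wall cannot have both summands among the inversions.\<close>

lemma good_agree:
  assumes x: "x \<in> W" "i < n" "x (simple i) = neg \<gamma>" "good q \<gamma> (N x)" and \<gamma>: "\<gamma> \<in> N x" "\<gamma> \<in> N y"
    and y: "y \<in> W" "k < n" "y (simple k) = neg \<gamma>" "good q \<gamma> (N y)"
    and b: "\<beta>1 \<in> proots" "\<beta>3 \<in> proots" "0 < a" "0 < b" "\<gamma> = lc a \<beta>1 b \<beta>3"
  shows "\<beta>1 \<in> N x \<longleftrightarrow> \<beta>1 \<in> N y"
proof (cases "\<beta>1 = \<gamma>")
  case False
  have b': "\<gamma> = lc b \<beta>3 a \<beta>1" using b by (simp add: lc_def add.commute)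
  show ?thesis
  proof (cases "E q \<beta>3 \<beta>1 \<le> E q \<beta>1 \<beta>3")
    case True
    then show ?thesis using goodD[OF x(4) b] goodD[OF y(4) b] by blast
  next
    case False2: False
    then have "\<beta>3 \<in> N x" "\<beta>3 \<in> N y"
      using goodD[OF x(4) b(2,1,4,3) b'] goodD[OF y(4) b(2,1,4,3) b'] by auto
    then show ?thesis
      using lower_wall_not_both[OF x(1-3) b(5,3,4)] lower_wall_not_both[OF y(1-3) b(5,3,4)] False by blast
  qed
qed (use \<gamma> in simp)

text \<open>After accepting \<open>s\<close>, each lower wall of the smaller element is the
  reflection of a lower wall of \<open>x\<close>, so \<open>good_refl\<close> applies. Rejecting
  \<open>s\<close> requires that no inversion of \<open>x\<close> involves \<open>s\<close>; this is
  where shards are used.\<close>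

theorem lower_walls_good_sortable:
  assumes fin: "finite W"
  shows "letters q \<Longrightarrow> inP (set q) x \<Longrightarrow> (\<And>i. i < n \<Longrightarrow> \<not> pos (x (simple i)) \<Longrightarrow> good q (neg (x (simple i))) (N x))
    \<Longrightarrow> sortable q x"
proof (induction "length q + card (N x)" arbitrary: q x rule: less_induct)
  case less
  have x: "x \<in> W" using less.prems by (simp add: inP_def)
  note good = less.prems(3)
  show ?case
  proof (cases q)
    case Nil
    then have "aligned q x" using less.prems root_nonzero N_proot proot_root
      by (fastforce simp: inP_def supp_in_def aligned_def)
    then show ?thesis using aligned_sortable less.prems by blast
  next
    case (Cons s q')
    have l: "letters (s # q')" and p: "inP (set (s # q')) x" using less.prems Cons by auto
    have l': "letters (q' @ [s])" and lq: "letters q'" and s: "s < n" "s \<notin> set q'"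
      using l by (auto simp: letters_snoc letters_Cons)
    show ?thesis
    proof (cases "simple s \<in> N x")
      case True
      define x1 where "x1 = refl s \<circ> x"
      have p1: "inP (set (q' @ [s])) x1" using inP_left_down(1)[OF p s(1) True] by (simp add: x1_def)
      have x1: "x1 \<in> W" using p1 by (simp add: inP_def)
      have sx1: "simple s \<notin> N x1" using N_left_simple[OF x s(1)] True by (simp add: x1_def)
      have "good (q' @ [s]) (neg (x1 (simple i))) (N x1)" if i: "i < n" "\<not> pos (x1 (simple i))" for i
      proof -
        define \<gamma> where "\<gamma> = neg (x (simple i))"
        have g1: "neg (x1 (simple i)) \<in> N x1" using wall_root_proot x1 i by blast
        have e1: "neg (x1 (simple i)) = refl s \<gamma>" using s by (simp add: x1_def \<gamma>_def)
        have ns: "refl s \<gamma> \<noteq> simple s" using g1 sx1 e1 by metis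
        have "refl s (refl s \<gamma>) \<in> proots" using refl_proot[OF _ s(1) ns] N_proot[OF g1] e1 by simp
        then have gp: "\<gamma> \<in> proots" using s by (simp add: refl_refl)
        have "neg (x (simple i)) \<in> proots" using gp by (simp add: \<gamma>_def)
        then have "\<not> pos (x (simple i))" using proot_pos root_not_pos proot_root neg_root by metis
        then have gN: "\<gamma> \<in> N x" and gd: "good q \<gamma> (N x)" using wall_root_proot[OF x i(1)] good[OF i(1)] by (simp_all add: \<gamma>_def)
        have "\<gamma> \<noteq> simple s" using refl_proot_ne[OF _ s(1)] N_proot[OF g1] e1 s by (metis refl_refl)
        then have "good (q' @ [s]) (refl s \<gamma>) (N (refl s \<circ> x))"
        proof (rule good_refl[OF l x True gN])
          show "supp_in (set (s # q')) \<gamma>" using p gN by (simp add: inP_def)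
          show "good (s # q') \<gamma> (N x)" using gd Cons by simp
        qed
        then show ?thesis unfolding e1 by (simp only: x1_def)
      qed
      moreover have "length (q' @ [s]) + card (N x1) < length q + card (N x)"
        using card_N_left_down[OF x s(1) True] Cons by (simp add: x1_def)
      ultimately have "sortable (q' @ [s]) x1" using less.hyps l' p1 by blast
      then show ?thesis unfolding Cons x1_def using x True by (intro sortable.acc)
    next
      case False
      have pq: "inP (set q') x"
        unfolding inP_def
      proof (intro conjI ballI x)
        fix \<beta> assume b: "\<beta> \<in> N x"
        show "supp_in (set q') \<beta>"
        proof (rule ccontr)
          assume "\<not> supp_in (set q') \<beta>"
          moreover have "supp_in (set (s # q')) \<beta>" using p b by (simp add: inP_def)
          ultimately have bs0: "\<beta> s \<noteq> 0" by (auto simp: supp_in_def)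
          have bs: "0 < \<beta> s" using bs0 posD[OF proot_pos[OF N_proot[OF b]], of s] by simp
          define \<rho> where "\<rho> = inv x \<beta>"
          have rr: "\<rho> \<in> roots" using roots_W x N_proot[OF b] proot_root inv_W unfolding \<rho>_def by blast
          have rn: "pos (neg \<rho>)" using neg_inv_N x b by (simp add: \<rho>_def)
          \<comment> \<open>\<open>\<beta>\<close> is the image under \<open>x\<close> of a negative
            root, so its positive coordinate at \<open>s\<close> must come from some
            \<open>x (simple i)\<close> with a negative one.\<close>
          have "\<exists>i<n. x (simple i) s < 0"
          proof (rule ccontr)
            assume "\<not> ?thesis"
            then have "\<rho> i * x (simple i) s \<le> 0" if "i < n" for i
              using that posD[OF rn, of i] by (auto simp: neg_apply not_less not_le[symmetric] intro!: mult_nonpos_nonneg)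
            then have "x \<rho> s \<le> 0" unfolding W_expand[OF x root_supp[OF rr], of s] by (intro sum_nonpos) auto
            then show False using bs x by (simp add: \<rho>_def)
          qed
          then obtain i where i: "i < n" "x (simple i) s < 0" by blast
          then have ni: "\<not> pos (x (simple i))" by (auto simp: pos_def not_le)
          define \<gamma> where "\<gamma> = neg (x (simple i))"
          have gN: "\<gamma> \<in> N x" using wall_root_proot[OF x i(1) ni] by (simp add: \<gamma>_def)
          have gp: "\<gamma> \<in> proots" using gN by (rule N_proot)
          have gs: "\<gamma> s \<noteq> 0" using i by (simp add: \<gamma>_def neg_apply)
          have sup: "supp_in (set (s # q')) \<gamma>" using p gN by (simp add: inP_def)
          obtain j k where j: "sortable (s # q') j" "jirr j k" "j (simple k) = neg \<gamma>"
            using ex_sortable_jirr[OF fin l gp sup] by blast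
          have jW: "j \<in> W" and kn: "k < n" and jk: "\<not> pos (j (simple k))" using j by (auto simp: jirr_def)
          have gj: "\<gamma> \<in> N j" using wall_root_proot[OF jW kn jk] j(3) by simp
          have sj: "simple s \<in> N j"
          proof (rule ccontr)
            assume "simple s \<notin> N j"
            then have "sortable q' j" using j(1) by (auto elim: sortable_ConsE)
            then have "inP (set q') j" using sortable_inP lq by blast
            then show False using gj gs s by (auto simp: inP_def supp_in_def)
          qed
          have g1: "good (s # q') \<gamma> (N x)" using good[OF i(1) ni] Cons by (simp add: \<gamma>_def)
          have g2: "good (s # q') \<gamma> (N j)" using sortable_aligned[OF j(1) l] gj by (simp add: aligned_def)
          have xi: "x (simple i) = neg \<gamma>" by (simp add: \<gamma>_def)
          have "N j \<subseteq> N x"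
            using jirr_le_shard[OF fin j(2,3) x i(1) xi] good_agree[OF x i(1) xi g1 gN gj jW kn j(3) g2] by blast
          then show False using sj False by blast
        qed
      qed
      have "good q' (neg (x (simple i))) (N x)" if i: "i < n" "\<not> pos (x (simple i))" for i
      proof -
        have "supp_in (set q') (neg (x (simple i)))" using wall_root_proot[OF x i] pq unfolding inP_def by blast
        then show ?thesis using good[OF i] good_rest[OF s(2)] Cons by blast
      qed
      moreover have "length q' + card (N x) < length q + card (N x)" using Cons by simp
      ultimately have "sortable q' x" using less.hyps lq pq by blast
      then show ?thesis unfolding Cons using False by (intro sortable.rej)
    qed
  qed
qed

theorem sortable_join:
  assumes fin: "finite W" and l: "letters q" "set q = {..<n}" and u: "sortable q u" and v: "sortable q v"
    and x: "x \<in> W" "N u \<subseteq> N x" "N v \<subseteq> N x"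
    and least: "\<And>y. y \<in> W \<Longrightarrow> N u \<subseteq> N y \<Longrightarrow> N v \<subseteq> N y \<Longrightarrow> N x \<subseteq> N y"
  shows "sortable q x"
proof (rule lower_walls_good_sortable[OF fin l(1)])
  show "inP (set q) x" using x l N_proot proot_root root_supp by (auto simp: inP_def)
  fix i assume i: "i < n" "\<not> pos (x (simple i))"
  define \<gamma> where "\<gamma> = neg (x (simple i))"
  have Nx: "N x = insert \<gamma> (N (x \<circ> refl i))" and gn: "\<gamma> \<notin> N (x \<circ> refl i)" using N_right_down[OF x(1) i] by (simp_all only: \<gamma>_def not_False_eq_True)
  have xi: "x \<circ> refl i \<in> W" using x i by blast
  \<comment> \<open>Otherwise \<open>x \<circ> refl i\<close>, which lacks only
    \<open>\<gamma>\<close>, would be a smaller upper bound.\<close>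
  have "\<gamma> \<in> N u \<or> \<gamma> \<in> N v"
  proof (rule ccontr)
    assume "\<not> ?thesis"
    then have "N u \<subseteq> N (x \<circ> refl i)" "N v \<subseteq> N (x \<circ> refl i)" using x(2,3) unfolding Nx by blast+
    then show False using least[OF xi] Nx gn by blast
  qed
  then have "good q \<gamma> (N u) \<and> N u \<subseteq> N x \<or> good q \<gamma> (N v) \<and> N v \<subseteq> N x"
    using sortable_aligned[OF u l(1)] sortable_aligned[OF v l(1)] x unfolding aligned_def by blast
  then show "good q (neg (x (simple i))) (N x)" using good_mono unfolding \<gamma>_def by blast
qed

theorem sortable_meet:
  "letters q \<Longrightarrow> sortable q u \<Longrightarrow> sortable q v \<Longrightarrow> x \<in> W \<Longrightarrow> N x \<subseteq> N u \<Longrightarrow> N x \<subseteq> N v \<Longrightarrow>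
    (\<And>y. y \<in> W \<Longrightarrow> N y \<subseteq> N u \<Longrightarrow> N y \<subseteq> N v \<Longrightarrow> N y \<subseteq> N x) \<Longrightarrow> sortable q x"
proof (induction "length q + card (N u)" arbitrary: q u v x rule: less_induct)
  case less
  note x = less.prems(4,5,6) and greatest = less.prems(7)
  have uW: "u \<in> W" and vW: "v \<in> W" using sortable_W less.prems by blast+
  show ?case
  proof (cases q)
    case Nil
    have "u = id" using less.prems(2) unfolding Nil by (cases rule: sortable.cases) auto
    then have "N x = {}" using x(2) N_id by blast
    then have "x = id" using N_empty x by blast
    then show ?thesis using sortable_id by blast
  next
    case (Cons s q')
    have l: "letters (s # q')" and su: "sortable (s # q') u" and sv: "sortable (s # q') v"
      using less.prems Cons by auto
    have l': "letters (q' @ [s])" and lq: "letters q'" and s: "s < n" "s \<notin> set q'"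
      using l by (auto simp: letters_snoc letters_Cons)
    show ?thesis
    proof (cases "simple s \<in> N u \<and> simple s \<in> N v")
      case True
      have "N (refl s \<circ> id) = insert (simple s) (refl s ` N id)"
        by (rule N_left_up[OF id_W s(1)]) (simp only: N_id empty_iff not_False_eq_True)
      then have "N (refl s) = {simple s}" by (simp only: N_id comp_id image_empty)
      \<comment> \<open>The reflection \<open>refl s\<close> is itself a common lower bound.\<close>
      then have sx: "simple s \<in> N x" using greatest[OF refl_W[OF s(1)]] True by auto
      define u1 v1 x1 where "u1 = refl s \<circ> u" and "v1 = refl s \<circ> v" and "x1 = refl s \<circ> x"
      have W1: "u1 \<in> W" "v1 \<in> W" "x1 \<in> W" unfolding u1_def v1_def x1_def using uW vW x s by blast+
      have so1: "sortable (q' @ [s]) u1" "sortable (q' @ [s]) v1"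
        using su sv True unfolding u1_def v1_def by (auto elim: sortable_ConsE)
      have le: "N (refl s \<circ> a) \<subseteq> N (refl s \<circ> b)" if "a \<in> W" "b \<in> W" "simple s \<in> N a" "simple s \<in> N b" "N a \<subseteq> N b" for a b
      proof
        fix \<beta> assume bb: "\<beta> \<in> N (refl s \<circ> a)"
        have bp: "\<beta> \<in> proots" using N_proot[OF bb] .
        have "simple s \<notin> N (refl s \<circ> a)" using N_left_simple[OF that(1) s(1)] that(3) by blast
        then have bn: "\<beta> \<noteq> simple s" using bb by metis
        then show "\<beta> \<in> N (refl s \<circ> b)" using N_left[OF that(1) s(1) bp bn] N_left[OF that(2) s(1) bp bn] bb that(5) by blast
      qed
      have "N x1 \<subseteq> N u1" "N x1 \<subseteq> N v1" unfolding x1_def u1_def v1_def using le x sx True uW vW by blast+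
      moreover have "N y \<subseteq> N x1" if y: "y \<in> W" "N y \<subseteq> N u1" "N y \<subseteq> N v1" for y
      proof -
        have "simple s \<notin> N u1" using N_left_simple[OF uW s(1)] True unfolding u1_def by blast
        then have ys: "simple s \<notin> N y" using y by blast
        have sy: "refl s \<circ> y \<in> W" using y s by blast
        have sys: "simple s \<in> N (refl s \<circ> y)" using N_left_simple[OF y(1) s(1)] ys by blast
        have up: "N (refl s \<circ> y) \<subseteq> N a" if a: "a \<in> W" "simple s \<in> N a" "N y \<subseteq> N (refl s \<circ> a)" for a
          using N_left_up[OF y(1) s(1) ys] N_left_down[OF a(1) s(1) a(2)] a(3) by blast
        have "N (refl s \<circ> y) \<subseteq> N x"
          using greatest[OF sy] up[OF uW] up[OF vW] y True unfolding u1_def v1_def by blast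
        then have "N (refl s \<circ> (refl s \<circ> y)) \<subseteq> N x1" unfolding x1_def using le sy x sys sx by blast
        then show ?thesis unfolding refl_refl_comp[OF s(1)] .
      qed
      moreover have "length (q' @ [s]) + card (N u1) < length q + card (N u)"
        using card_N_left_down[OF uW s(1)] True Cons by (simp add: u1_def)
      ultimately have "sortable (q' @ [s]) x1" using less.hyps l' so1 W1 by blast
      then show ?thesis unfolding Cons x1_def using x sx by (intro sortable.acc)
    next
      case False
      have sx: "simple s \<notin> N x" using False x by blast
      obtain u1 where u1: "u1 \<in> W" "N u1 = {\<beta> \<in> N u. supp_in (set q') \<beta>}" using parabolic_projection uW by blast
      obtain v1 where v1: "v1 \<in> W" "N v1 = {\<beta> \<in> N v. supp_in (set q') \<beta>}" using parabolic_projection vW by blast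
      have so1: "sortable q' u1" "sortable q' v1"
        using sortable_projection[OF l su u1] sortable_projection[OF l sv v1] .
      \<comment> \<open>One of the two elements rejects \<open>s\<close> and so lies in the
        parabolic subgroup of \<open>q'\<close>. Then so does \<open>x\<close>, which is therefore
        also the meet of the two projections.\<close>
      have "sortable q' u \<or> sortable q' v" using su sv False by (auto elim: sortable_ConsE)
      then have "inP (set q') u \<or> inP (set q') v" using sortable_inP lq by blast
      then have px: "\<forall>\<beta>\<in>N x. supp_in (set q') \<beta>" using x by (auto simp: inP_def)
      have "N x \<subseteq> N u1" "N x \<subseteq> N v1" unfolding u1 v1 using px x by blast+
      moreover have "N y \<subseteq> N x" if "y \<in> W" "N y \<subseteq> N u1" "N y \<subseteq> N v1" for y
        using greatest[OF that(1)] that u1 v1 by blast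
      moreover have "N u1 \<subseteq> N u" using u1 by auto
      then have "length q' + card (N u1) < length q + card (N u)"
        using Cons card_mono[OF finite_N[OF uW]] by (simp add: le_imp_less_Suc)
      ultimately have "sortable q' x" using less.hyps lq so1 x(1) by blast
      then show ?thesis unfolding Cons using sx by (intro sortable.rej)
    qed
  qed
qed

section \<open>The sorting procedure\<close>

lemma extend_word:
  assumes "w \<in> W" "a \<in> words n" "N (act a) \<subseteq> N w"
  shows "\<exists>b\<in>words n. act (a @ b) = w \<and> length b + card (N (act a)) = card (N w)"
  using assms(2,3)
proof (induction "card (N w) - card (N (act a))" arbitrary: a rule: less_induct)
  case less
  have aW: "act a \<in> W" using less.prems by blast
  show ?case
  proof (cases "act a = w")
    case True
    then show ?thesis by (intro bexI[of _ "[]"]) auto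
  next
    case False
    then obtain i where i: "i < n" "pos (act a (simple i))" "act a (simple i) \<in> N w"
      using ascent_below[OF aW assms(1) less.prems(2)] by blast
    define a' where "a' = a @ [i]"
    have aa: "act a' = act a \<circ> refl i" by (simp add: a'_def act_append)
    have a': "a' \<in> words n" using less.prems i by (simp add: a'_def)
    have sub: "N (act a') \<subseteq> N w" unfolding aa N_right_up(1)[OF aW i(1,2)] using less.prems(2) i(3) by blast
    have c: "card (N (act a')) = Suc (card (N (act a)))" unfolding aa using card_N_right_up[OF aW i(1,2)] .
    have "card (N (act a')) \<le> card (N w)" using sub finite_N[OF assms(1)] card_mono by blast
    then have "card (N w) - card (N (act a')) < card (N w) - card (N (act a))" using c by linarith
    from less.hyps[OF this a' sub] obtain b
      where b: "b \<in> words n" "act (a' @ b) = w" "length b + card (N (act a')) = card (N w)" by blast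
    show ?thesis
    proof (intro bexI conjI)
      show "act (a @ i # b) = w" using b(2) by (simp add: a'_def)
      show "length (i # b) + card (N (act a)) = card (N w)" using b(3) c by simp
      show "i # b \<in> words n" using b(1) i by simp
    qed
  qed
qed

text \<open>Each letter changes the number of inversions by one, so no word is shorter than that
  number; climbing from the identity by ascents attains it.\<close>

lemma len_eq_card: "w \<in> words n \<Longrightarrow> len w = card (N (act w))"
proof -
  assume w: "w \<in> words n"
  obtain v where v: "w \<sim> v" "length v = len w" using len_attained[OF w] by blast
  have "v \<in> words n" using v(1) rel_words by blast
  then have "card (N (act w)) \<le> len w" using card_N_le_length rel_act[OF v(1)] v(2) by metis
  moreover have "N (act []) \<subseteq> N (act w)" by simp
  then obtain b where b: "b \<in> words n" "act ([] @ b) = act w" "length b + card (N (act [])) = card (N (act w))"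
    using extend_word[OF act_W[OF w] words_Nil] by blast
  then have "w \<sim> b" using rel_iff_act w by simp
  then have "len w \<le> length b" by (rule len_le)
  moreover have "length b \<le> card (N (act w))" using b(3) by linarith
  ultimately show ?thesis by linarith
qed

lemma reduced_prefix:
  "a @ b \<in> words n \<Longrightarrow> length (a @ b) = card (N (act (a @ b))) \<Longrightarrow>
    N (act a) \<subseteq> N (act (a @ b)) \<and> length a = card (N (act a))"
proof (induction b rule: rev_induct)
  case (snoc i b)
  have w: "a @ b \<in> words n" "i < n" using snoc.prems by auto
  have f: "act (a @ b) \<in> W" using w by blast
  have e: "act (a @ b @ [i]) = act (a @ b) \<circ> refl i" by (simp add: act_append comp_assoc)
  have le: "card (N (act (a @ b))) \<le> length (a @ b)" using card_N_le_length w by blast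
  have len1: "card (N (act (a @ b) \<circ> refl i)) = Suc (length (a @ b))" using snoc.prems(2) unfolding e by (metis append.assoc length_append_singleton)
  have p: "pos (act (a @ b) (simple i))"
  proof (rule ccontr)
    assume "\<not> ?thesis"
    then show False using card_N_right_down[OF f w(2)] len1 le by linarith
  qed
  have "length (a @ b) = card (N (act (a @ b)))" using card_N_right_up[OF f w(2) p] len1 by simp
  from snoc.IH[OF w(1) this] show ?case unfolding e N_right_up(1)[OF f w(2) p] by blast
qed simp

abbreviation cls :: "nat list \<Rightarrow> nat list set" where "cls w \<equiv> cox_class n m w"

lemma mem_cls: "v \<in> cls w \<longleftrightarrow> w \<sim> v"
  by (simp add: cox_class_def)

lemma reduced_word_cls: "reduced_word (cls w) a \<longleftrightarrow> w \<sim> a \<and> length a = len w"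
  by (simp add: reduced_word_def mem_cls clen_def)

lemma cls_coxW: "w \<in> words n \<Longrightarrow> cls w \<in> coxW n m"
  by (simp add: coxW_def)

lemma coxW_cls: "X \<in> coxW n m \<Longrightarrow> \<exists>w\<in>words n. X = cls w"
  by (auto simp: coxW_def)

lemma weak_le_iff:
  assumes "u \<in> words n" "w \<in> words n"
  shows "weak_le n m (cls u) (cls w) \<longleftrightarrow> N (act u) \<subseteq> N (act w)"
proof
  assume "weak_le n m (cls u) (cls w)"
  then obtain a b where ab: "u \<sim> a" "w \<sim> a @ b" "length (a @ b) = len w"
    unfolding weak_le_def reduced_word_cls by blast
  have abw: "a @ b \<in> words n" using ab rel_words by blast
  have "length (a @ b) = card (N (act (a @ b)))" using ab(2,3) len_eq_card[OF assms(2)] rel_act by metis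
  then have "N (act a) \<subseteq> N (act (a @ b))" using reduced_prefix[OF abw] by blast
  then show "N (act u) \<subseteq> N (act w)" unfolding rel_act[OF ab(1)] rel_act[OF ab(2)] .
next
  assume sub: "N (act u) \<subseteq> N (act w)"
  obtain a where a: "u \<sim> a" "length a = len u" using len_attained[OF assms(1)] by blast
  have aw: "a \<in> words n" using a rel_words by blast
  have "N (act a) \<subseteq> N (act w)" using sub unfolding rel_act[OF a(1)] .
  then obtain b where b: "b \<in> words n" "act (a @ b) = act w" "length b + card (N (act a)) = card (N (act w))"
    using extend_word[OF act_W[OF assms(2)] aw] by blast
  have "w \<sim> a @ b" using rel_iff_act assms(2) aw b by simp
  moreover have "length (a @ b) = len w"
    using b(3) a(2) len_eq_card[OF assms(1)] len_eq_card[OF assms(2)] rel_act[OF a(1)] by simp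
  ultimately show "weak_le n m (cls u) (cls w)"
    unfolding weak_le_def reduced_word_cls using assms cls_coxW a by blast
qed

lemma finite_coxW_W: "finite (coxW n m) \<Longrightarrow> finite W"
proof -
  assume fin: "finite (coxW n m)"
  have "act w = act (SOME v. v \<in> cls w)" if "w \<in> words n" for w
  proof -
    have "w \<in> cls w" using cox_rel.refl[OF that] by (simp add: mem_cls)
    then have "(SOME v. v \<in> cls w) \<in> cls w" by (rule someI)
    then show ?thesis using rel_act mem_cls by blast
  qed
  then have "W \<subseteq> (\<lambda>X. act (SOME v. v \<in> X)) ` coxW n m"
    unfolding W_def coxW_def by auto
  then show ?thesis using fin finite_surj by blast
qed

section \<open>The sorting run on group elements\<close>

fun state :: "nat list \<Rightarrow> (vec \<Rightarrow> vec) \<Rightarrow> nat \<Rightarrow> vec \<Rightarrow> vec" where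
  "state p x 0 = x"
| "state p x (Suc t) =
     (if simple (p ! (t mod n)) \<in> N (state p x t) then refl (p ! (t mod n)) \<circ> state p x t else state p x t)"

definition app :: "nat list \<Rightarrow> (vec \<Rightarrow> vec) \<Rightarrow> nat \<Rightarrow> bool" where
  "app p x t \<longleftrightarrow> simple (p ! (t mod n)) \<in> N (state p x t)"

text \<open>Step \<open>t + n\<close> tests the letter of step \<open>t\<close> one pass later, so
  this is the inclusion of successive passes, letter by letter.\<close>

definition nested :: "nat list \<Rightarrow> (vec \<Rightarrow> vec) \<Rightarrow> bool" where
  "nested p x \<longleftrightarrow> (\<forall>t. app p x (t + n) \<longrightarrow> app p x t)"

definition full :: "nat list \<Rightarrow> bool" where
  "full p \<longleftrightarrow> distinct p \<and> set p = {..<n} \<and> length p = n \<and> 0 < n"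

lemma full_nth: "full p \<Longrightarrow> p ! (t mod n) < n"
  unfolding full_def by (metis lessThan_iff mod_less_divisor nth_mem)

lemma full_letter: "full p \<Longrightarrow> s < n \<Longrightarrow> \<exists>i<n. p ! i = s"
  unfolding full_def by (metis in_set_conv_nth lessThan_iff)

lemma full_rotate: "full (s # p) \<Longrightarrow> full (p @ [s])"
  by (auto simp: full_def)

lemma len_Cons_less:
  assumes "v \<in> words n" "s < n"
  shows "len (s # v) < len v \<longleftrightarrow> simple s \<in> N (act v)"
proof -
  have f: "act v \<in> W" using assms by blast
  have c: "len (s # v) = card (N (refl s \<circ> act v))" using len_eq_card[of "s # v"] assms by simp
  show ?thesis
  proof (cases "simple s \<in> N (act v)")
    case True
    then show ?thesis using card_N_left_down[OF f assms(2)] c len_eq_card[OF assms(1)] by linarith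
  next
    case False
    have g: "refl s \<circ> act v \<in> W" using f assms by blast
    have "simple s \<in> N (refl s \<circ> act v)" using N_left_simple[OF f assms(2)] False by blast
    then have "card (N (refl s \<circ> act v)) = Suc (card (N (act v)))"
      using card_N_left_down[OF g assms(2)] unfolding refl_refl_comp[OF assms(2)] by blast
    then show ?thesis using c False len_eq_card[OF assms(1)] by linarith
  qed
qed

lemma sort_state_act:
  assumes "full p" "w \<in> words n"
  shows "sort_state n m p w t \<in> words n \<and> act (sort_state n m p w t) = state p (act w) t"
proof (induction t)
  case (Suc t)
  define v where "v = sort_state n m p w t"
  define s where "s = p ! (t mod n)"
  have s: "s < n" using full_nth[OF assms(1)] by (simp add: s_def)
  have v: "v \<in> words n" "act v = state p (act w) t" using Suc by (simp_all add: v_def)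
  have e: "sort_state n m p w (Suc t) = (if len (s # v) < len v then s # v else v)"
    by (simp add: Let_def v_def s_def)
  have e2: "state p (act w) (Suc t) = (if simple s \<in> N (act v) then refl s \<circ> act v else act v)"
    unfolding v(2) by (simp only: state.simps s_def)
  show ?case unfolding e e2 len_Cons_less[OF v(1) s] using v s by simp
qed (use assms in simp)

lemma sort_appended_app:
  assumes "full p" "w \<in> words n"
  shows "sort_appended n m p w t \<longleftrightarrow> app p (act w) t"
proof -
  have "0 < n" using assms by (simp add: full_def)
  then show ?thesis
    using len_Cons_less[OF _ full_nth[OF assms(1)], of "sort_state n m p w t" t] sort_state_act[OF assms, of t]
    unfolding sort_appended_def app_def by simp
qed

lemma pass_sets_nested:
  assumes "full p" "w \<in> words n"
  shows "(\<forall>j. pass_set n m p w (Suc j) \<subseteq> pass_set n m p w j) \<longleftrightarrow> nested p (act w)"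
proof
  have n: "0 < n" and d: "distinct p" "length p = n" using assms by (auto simp: full_def)
  note ps = pass_set_def sort_appended_app[OF assms]
  {
    assume a: "\<forall>j. pass_set n m p w (Suc j) \<subseteq> pass_set n m p w j"
    show "nested p (act w)"
      unfolding nested_def
    proof (intro allI impI)
      fix t assume t: "app p (act w) (t + n)"
      have "(t + n) div n = Suc (t div n)" "(t + n) mod n = t mod n" using n by simp_all
      then have "p ! (t mod n) \<in> pass_set n m p w (Suc (t div n))" unfolding ps using t by (metis (mono_tags, lifting) mem_Collect_eq)
      then have "p ! (t mod n) \<in> pass_set n m p w (t div n)" using a by blast
      then obtain t' where t': "p ! (t mod n) = p ! (t' mod n)" "t' div n = t div n" "app p (act w) t'"
        unfolding ps by blast
      have "t mod n = t' mod n" using t'(1) d n by (simp add: nth_eq_iff_index_eq)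
      then have "t = t'" using t'(2) by (metis div_mult_mod_eq)
      then show "app p (act w) t" using t' by simp
    qed
  next
    assume a: "nested p (act w)"
    show "\<forall>j. pass_set n m p w (Suc j) \<subseteq> pass_set n m p w j"
    proof (intro allI subsetI)
      fix j s assume "s \<in> pass_set n m p w (Suc j)"
      then obtain t where t: "s = p ! (t mod n)" "t div n = Suc j" "app p (act w) t" unfolding ps by blast
      have tn: "n \<le> t" using t(2) by (metis div_less nat.distinct(1) not_le)
      define t' where "t' = t - n"
      have tt: "t = t' + n" using tn by (simp add: t'_def)
      have "app p (act w) t'" using a t(3) unfolding nested_def tt by blast
      moreover have "t' mod n = t mod n" "t' div n = j" using t(2) n unfolding tt by simp_all
      ultimately show "s \<in> pass_set n m p w j" unfolding ps t(1) by (metis (mono_tags, lifting) mem_Collect_eq)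
    qed
  }
qed

lemma state_Cons:
  assumes "full (s # p)"
  shows "state (s # p) x (Suc t) = state (p @ [s]) (state (s # p) x (Suc 0)) t"
proof (induction t)
  case (Suc t)
  have n: "0 < n" "length (s # p) = n" using assms by (auto simp: full_def)
  have "rotate1 (s # p) ! (t mod n) = (s # p) ! (Suc (t mod n) mod n)"
    using nth_rotate1[of "t mod n" "s # p"] n by simp
  then have e: "(p @ [s]) ! (t mod n) = (s # p) ! (Suc t mod n)" by (simp add: mod_Suc_eq)
  have "state (s # p) x (Suc (Suc t)) = (if simple ((s # p) ! (Suc t mod n)) \<in> N (state (s # p) x (Suc t))
      then refl ((s # p) ! (Suc t mod n)) \<circ> state (s # p) x (Suc t) else state (s # p) x (Suc t))"
    by (rule state.simps(2))
  also have "\<dots> = state (p @ [s]) (state (s # p) x (Suc 0)) (Suc t)"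
    unfolding Suc e[symmetric] by (rule state.simps(2)[symmetric])
  finally show ?case .
qed simp

lemma app_Cons:
  assumes "full (s # p)"
  shows "app (s # p) x (Suc t) \<longleftrightarrow> app (p @ [s]) (state (s # p) x (Suc 0)) t"
proof -
  have n: "0 < n" "length (s # p) = n" using assms by (auto simp: full_def)
  have "rotate1 (s # p) ! (t mod n) = (s # p) ! (Suc (t mod n) mod n)"
    using nth_rotate1[of "t mod n" "s # p"] n by simp
  then have e: "(p @ [s]) ! (t mod n) = (s # p) ! (Suc t mod n)" by (simp add: mod_Suc_eq)
  show ?thesis by (simp only: app_def e state_Cons[OF assms, of x t])
qed

lemma nested_Cons:
  assumes "full (s # p)"
  shows "nested (s # p) x \<longleftrightarrow> (app (s # p) x n \<longrightarrow> app (s # p) x 0) \<and> nested (p @ [s]) (state (s # p) x (Suc 0))"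
proof -
  have "nested (s # p) x \<longleftrightarrow> (app (s # p) x (0 + n) \<longrightarrow> app (s # p) x 0) \<and>
      (\<forall>t. app (s # p) x (Suc t + n) \<longrightarrow> app (s # p) x (Suc t))"
    unfolding nested_def by (metis not0_implies_Suc)
  then show ?thesis unfolding nested_def app_Cons[OF assms, symmetric] by simp
qed

lemma state_inP:
  assumes "full p"
  shows "inP J x \<Longrightarrow> inP J (state p x t)"
proof (induction t)
  case (Suc t)
  have i: "inP J (state p x t)" using Suc by blast
  show ?case
  proof (cases "simple (p ! (t mod n)) \<in> N (state p x t)")
    case True
    then show ?thesis unfolding state.simps(2) if_P[OF True] by (rule inP_left_down(1)[OF i full_nth[OF assms]])
  next
    case False
    show ?thesis unfolding state.simps(2) if_not_P[OF False] by (rule i)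
  qed
qed simp

text \<open>From a step with the fewest inversions on, the state is constant. A left descent of that
  state would still be tested in a later pass and would reduce the number further.\<close>

lemma state_eventually_id:
  assumes "full p" "x \<in> W"
  shows "\<exists>T. state p x T = id"
proof -
  have W: "state p x t \<in> W" for t
    using state_inP[OF assms(1), of UNIV x t] assms(2) by (simp add: inP_def supp_in_def)
  define P where "P c \<longleftrightarrow> (\<exists>t. card (N (state p x t)) = c)" for c
  have "P (LEAST c. P c)" by (rule LeastI[of P "card (N (state p x 0))"]) (unfold P_def, blast)
  then obtain T where T: "card (N (state p x T)) = (LEAST c. P c)" unfolding P_def by blast
  have least: "card (N (state p x T)) \<le> card (N (state p x t))" for t
    unfolding T by (rule Least_le) (unfold P_def, blast)
  have const: "state p x (T + d) = state p x T" for d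
  proof (induction d)
    case (Suc d)
    have "\<not> simple (p ! ((T + d) mod n)) \<in> N (state p x (T + d))"
    proof
      assume a: "simple (p ! ((T + d) mod n)) \<in> N (state p x (T + d))"
      have "state p x (Suc (T + d)) = refl (p ! ((T + d) mod n)) \<circ> state p x (T + d)"
        unfolding state.simps(2) using a by (rule if_P)
      then have "card (N (state p x (Suc (T + d)))) < card (N (state p x (T + d)))"
        using card_N_left_down[OF W full_nth[OF assms(1)] a] by simp
      then show False using least[of "Suc (T + d)"] unfolding Suc by linarith
    qed
    then have "state p x (Suc (T + d)) = state p x (T + d)" unfolding state.simps(2) by (rule if_not_P)
    then show ?case using Suc by simp
  qed simp
  have "state p x T = id"
  proof (rule ccontr)
    assume "state p x T \<noteq> id"
    then obtain s where s: "s < n" "simple s \<in> N (state p x T)" using left_descent[OF W] by blast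
    obtain i where i: "i < n" "p ! i = s" using full_letter[OF assms(1) s(1)] by blast
    have n: "0 < n" using assms by (simp add: full_def)
    \<comment> \<open>A step not before \<open>T\<close> at which the letter at position
      \<open>i\<close> is tested.\<close>
    define t where "t = T * n + i"
    have "T \<le> t" using n by (simp add: t_def trans_le_add1)
    then obtain d where d: "t = T + d" using le_Suc_ex by blast
    have tm: "t mod n = i" using i by (simp add: t_def)
    have a: "simple (p ! (t mod n)) \<in> N (state p x t)" unfolding tm i(2) using s(2) const[of d] d by simp
    have "state p x (Suc t) = refl (p ! (t mod n)) \<circ> state p x t"
      unfolding state.simps(2) using a by (rule if_P)
    then have "card (N (state p x (Suc t))) < card (N (state p x t))"
      using card_N_left_down[OF W full_nth[OF assms(1)] a] by simp
    then show False using least[of "Suc t"] const[of d] d by simp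
  qed
  then show ?thesis by blast
qed

text \<open>A nested run that rejects its first letter never uses it later.\<close>

lemma nested_reject:
  assumes f: "full (s # p)" and x: "inP J x" and ne: "nested (s # p) x" and rj: "simple s \<notin> N x"
  shows "inP (J - {s}) x"
proof -
  have n: "0 < n" using f by (simp add: full_def)
  have never: "\<not> app (s # p) x (k * n)" for k
  proof (induction k)
    case 0 then show ?case using rj by (simp add: app_def)
  next
    case (Suc k)
    then show ?case using ne unfolding nested_def by (metis add.commute mult_Suc)
  qed
  obtain T where T: "state (s # p) x T = id" using state_eventually_id[OF f] x by (auto simp: inP_def)
  \<comment> \<open>The run is undone from its end: the letters put back lie in \<open>J\<close> and
    differ from \<open>s\<close>, which is tested only at multiples of \<open>n\<close>.\<close>
  have "inP (J - {s}) (state (s # p) x t) \<Longrightarrow> inP (J - {s}) x" for t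
  proof (induction t)
    case (Suc t)
    define r where "r = (s # p) ! (t mod n)"
    define y where "y = state (s # p) x t"
    have r: "r < n" using full_nth[OF f] by (simp only: r_def)
    have y: "inP J y" using state_inP[OF f x] by (simp only: y_def)
    have "inP (J - {s}) y"
    proof (cases "simple r \<in> N y")
      case False
      have "state (s # p) x (Suc t) = y" unfolding state.simps(2) y_def using False unfolding r_def y_def by (rule if_not_P)
      then show ?thesis using Suc.prems by simp
    next
      case True
      have e: "state (s # p) x (Suc t) = refl r \<circ> y" unfolding state.simps(2) y_def r_def using True unfolding r_def y_def by (rule if_P)
      have rs: "r \<noteq> s"
      proof
        assume "r = s"
        have "t mod n = 0"
        proof (rule ccontr)
          assume "t mod n \<noteq> 0"
          then obtain i where i: "t mod n = Suc i" using not0_implies_Suc by blast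
          have "i < length p" using f n i by (metis Suc_less_eq full_def length_Cons mod_less_divisor)
          then have "r \<in> set p" using i by (simp add: r_def)
          then show False using f \<open>r = s\<close> by (simp add: full_def)
        qed
        then have "t = (t div n) * n" by (metis add.right_neutral div_mult_mod_eq)
        then have "\<not> app (s # p) x t" using never by metis
        then show False using True by (simp add: app_def r_def y_def)
      qed
      have "r \<in> J" using inP_left_down(2)[OF y r True] .
      moreover have "simple r \<notin> N (refl r \<circ> y)" using N_left_simple[OF _ r] True y by (auto simp only: inP_def)
      moreover have yr: "inP (J - {s}) (refl r \<circ> y)" using Suc.prems unfolding e .
      ultimately have "inP (J - {s}) (refl r \<circ> (refl r \<circ> y))"
        using inP_left_up[OF yr r] rs by blast
      then show ?thesis unfolding refl_refl_comp[OF r] .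
    qed
    then show ?case using Suc.IH by (simp only: y_def)
  qed simp
  from this[of T] show ?thesis using T inP_id by metis
qed

text \<open>\<open>p\<close> stays a rotation of the full word, while \<open>J\<close> holds the
  letters not yet rejected, so the filtered word is the one of the recursion. A letter outside
  \<open>J\<close> is merely rotated past, which the \<open>takeWhile\<close> term of the measure
  counts; that term never exceeds \<open>n\<close>, so the factor \<open>Suc n\<close> outweighs it
  whenever an inversion or a letter is lost.\<close>

lemma nested_iff_sortable:
  "full p \<Longrightarrow> J \<subseteq> {..<n} \<Longrightarrow> inP J x \<Longrightarrow> nested p x \<longleftrightarrow> sortable (filter (\<lambda>s. s \<in> J) p) x"
proof (induction "(card (N x) + card J) * Suc n + length (takeWhile (\<lambda>s. s \<notin> J) p)"
    arbitrary: p J x rule: less_induct)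
  case less
  have f: "full p" and J: "J \<subseteq> {..<n}" and x: "inP J x" by fact+
  have xW: "x \<in> W" using x by (simp add: inP_def)
  have finJ: "finite J" using J finite_subset by blast
  show ?case
  proof (cases "J = {}")
    case True
    have none: "\<not> app p x t" for t
    proof
      assume "app p x t"
      then have "supp_in J (simple (p ! (t mod n)))" using state_inP[OF f x, of t] unfolding app_def inP_def by blast
      then show False using True by simp
    qed
    have "N x = {}"
    proof (rule ccontr)
      assume "N x \<noteq> {}"
      then obtain \<beta> where b: "\<beta> \<in> N x" by blast
      obtain k where "\<beta> k \<noteq> 0" using root_nonzero[OF proot_root[OF N_proot[OF b]]] by blast
      then show False using x b True by (simp add: inP_def supp_in_def)
    qed
    then have "x = id" using N_empty xW by blast
    then have "sortable (filter (\<lambda>s. s \<in> J) p) x" using sortable_id by metis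
    moreover have "nested p x" unfolding nested_def using none by blast
    ultimately show ?thesis by blast
  next
    case False
    obtain s p' where p: "p = s # p'" using f by (cases p) (auto simp: full_def)
    have fc: "full (s # p')" using f p by simp
    have s: "s < n" "s \<notin> set p'" using fc by (auto simp: full_def)
    have fr: "full (p' @ [s])" using full_rotate[OF fc] .
    have lp: "length (p' @ [s]) = n" using fr by (simp add: full_def)
    have tw: "length (takeWhile (\<lambda>s. s \<notin> J) r) \<le> length r" for r by (rule length_takeWhile_le)
    show ?thesis
    proof (cases "s \<in> J")
      case sJ: False
      have no: "\<not> app (s # p') x t" if "t mod n = 0" for t
      proof
        assume "app (s # p') x t"
        then have "supp_in J (simple s)" using state_inP[OF fc x, of t] that unfolding app_def inP_def by (metis nth_Cons_0)
        then show False using sJ by simp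
      qed
      have "simple s \<notin> N x" using no[of 0] by (simp add: app_def)
      then have st: "state (s # p') x (Suc 0) = x" by simp
      have n1: "nested p x \<longleftrightarrow> nested (p' @ [s]) x"
        unfolding p nested_Cons[OF fc] st using no[of n] by simp
      have ex: "\<exists>r\<in>set p'. r \<in> J" using False J fc sJ by (auto simp: full_def)
      then have "takeWhile (\<lambda>s. s \<notin> J) (p' @ [s]) = takeWhile (\<lambda>s. s \<notin> J) p'" by (metis takeWhile_append1)
      then have "length (takeWhile (\<lambda>s. s \<notin> J) (p' @ [s])) < length (takeWhile (\<lambda>s. s \<notin> J) p)" using sJ p by simp
      then have "nested (p' @ [s]) x \<longleftrightarrow> sortable (filter (\<lambda>s. s \<in> J) (p' @ [s])) x"
        using less.hyps[OF _ fr J x] by simp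
      then show ?thesis unfolding n1 using p sJ by simp
    next
      case sJ: True
      have fp: "filter (\<lambda>s. s \<in> J) p = s # filter (\<lambda>s. s \<in> J) p'" using p sJ by simp
      show ?thesis
      proof (cases "simple s \<in> N x")
        case True
        define x1 where "x1 = refl s \<circ> x"
        have x1: "inP J x1" using inP_left_down(1)[OF x s(1) True] by (simp only: x1_def)
        have st: "state (s # p') x (Suc 0) = x1" using True by (simp add: x1_def)
        have a0: "app (s # p') x 0" using True by (simp add: app_def)
        have n1: "nested p x \<longleftrightarrow> nested (p' @ [s]) x1" unfolding p nested_Cons[OF fc] st using a0 by blast
        have c: "card (N x) = Suc (card (N x1))" using card_N_left_down[OF xW s(1) True] by (simp only: x1_def)
        have "(card (N x1) + card J) * Suc n + length (takeWhile (\<lambda>s. s \<notin> J) (p' @ [s]))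
           < (card (N x) + card J) * Suc n + length (takeWhile (\<lambda>s. s \<notin> J) p)"
          using tw[of "p' @ [s]"] lp c by simp
        from less.hyps[OF this fr J x1]
        have n2: "nested (p' @ [s]) x1 \<longleftrightarrow> sortable (filter (\<lambda>s. s \<in> J) p' @ [s]) x1" using sJ by simp
        have "sortable (s # filter (\<lambda>s. s \<in> J) p') x \<longleftrightarrow> sortable (filter (\<lambda>s. s \<in> J) p' @ [s]) x1"
          unfolding x1_def using sortable.acc[OF xW True] True by (blast elim: sortable_ConsE)
        then show ?thesis unfolding n1 n2 fp by blast
      next
        case rj: False
        define J' where "J' = J - {s}"
        have J': "J' \<subseteq> {..<n}" using J by (auto simp: J'_def)
        have fq: "filter (\<lambda>r. r \<in> J') p = filter (\<lambda>r. r \<in> J) p'"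
          unfolding p J'_def using s by (auto intro: filter_cong)
        have so: "sortable (s # filter (\<lambda>s. s \<in> J) p') x \<longleftrightarrow> sortable (filter (\<lambda>s. s \<in> J) p') x"
          using sortable.rej[OF rj] rj by (blast elim: sortable_ConsE)
        show ?thesis
        proof (cases "inP J' x")
          case True
          have "card J = Suc (card J')" using sJ finJ unfolding J'_def by (metis card.remove)
          then have "(card (N x) + card J') * Suc n + length (takeWhile (\<lambda>s. s \<notin> J') p)
             < (card (N x) + card J) * Suc n + length (takeWhile (\<lambda>s. s \<notin> J) p)"
            using length_takeWhile_le[of "\<lambda>s. s \<notin> J'" p] lp p by simp
          from less.hyps[OF this f J' True] show ?thesis unfolding fq fp so .
        next
          case False
          have "\<not> nested p x" using nested_reject[OF fc x _ rj] False unfolding p J'_def by blast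
          moreover have "\<not> sortable (filter (\<lambda>s. s \<in> J) p') x"
          proof
            assume a: "sortable (filter (\<lambda>s. s \<in> J) p') x"
            have "letters (filter (\<lambda>s. s \<in> J) p')" using fc by (auto simp: letters_def full_def)
            then have "inP (set (filter (\<lambda>s. s \<in> J) p')) x" using sortable_inP a by blast
            then show False using False inP_mono[of _ x J'] s by (auto simp: J'_def)
          qed
          ultimately show ?thesis unfolding fp so by blast
        qed
      qed
    qed
  qed
qed

lemma inP_all: "x \<in> W \<Longrightarrow> inP {..<n} x"
  using root_supp proot_root N_proot unfolding inP_def by blast

lemma c_sortable_iff:
  assumes "full p" "w \<in> words n"
  shows "c_sortable n m p (cls w) \<longleftrightarrow> sortable p (act w)"
proof -
  have "filter (\<lambda>s. s \<in> {..<n}) p = p" using assms by (simp add: full_def)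
  then have "nested p (act w) \<longleftrightarrow> sortable p (act w)"
    using nested_iff_sortable[OF assms(1) subset_refl inP_all[OF act_W[OF assms(2)]]] by simp
  moreover have "(\<forall>j. pass_set n m p v (Suc j) \<subseteq> pass_set n m p v j) \<longleftrightarrow> nested p (act w)" if "v \<in> cls w" for v
  proof -
    have v: "w \<sim> v" using that mem_cls by blast
    have vw: "v \<in> words n" using v rel_words by blast
    show ?thesis unfolding pass_sets_nested[OF assms(1) vw] rel_act[OF v] ..
  qed
  moreover have "w \<in> cls w" using cox_rel.refl[OF assms(2)] by (simp add: mem_cls)
  ultimately show ?thesis unfolding c_sortable_def using cls_coxW[OF assms(2)] by blast
qed

lemma c_sortable_meet_join:
  assumes fin: "finite (coxW n m)" and f: "full p"
    and u: "c_sortable n m p X" and v: "c_sortable n m p Y"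
  shows "is_weak_meet n m X Y Z \<Longrightarrow> c_sortable n m p Z" "is_weak_join n m X Y Z \<Longrightarrow> c_sortable n m p Z"
proof -
  obtain a where a: "a \<in> words n" "X = cls a" using coxW_cls[of X] u unfolding c_sortable_def by blast
  obtain b where b: "b \<in> words n" "Y = cls b" using coxW_cls[of Y] v unfolding c_sortable_def by blast
  have sa: "sortable p (act a)" and sb: "sortable p (act b)"
    using c_sortable_iff[OF f] a b u v by simp_all
  have finW: "finite W" using finite_coxW_W fin by blast
  have l: "letters p" "set p = {..<n}" using f by (auto simp: full_def letters_def)
  have ex: "\<exists>w\<in>words n. y = act w" if "y \<in> W" for y using that by (auto simp: W_def)
  {
    assume me: "is_weak_meet n m X Y Z"
    then have "Z \<in> coxW n m" by (auto simp: is_weak_meet_def weak_le_def)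
    then obtain c where c: "c \<in> words n" "Z = cls c" using coxW_cls by blast
    note le = weak_le_iff[OF c(1) a(1)] weak_le_iff[OF c(1) b(1)]
    have "sortable p (act c)"
    proof (rule sortable_meet[OF l(1) sa sb act_W[OF c(1)]])
      show "N (act c) \<subseteq> N (act a)" "N (act c) \<subseteq> N (act b)"
        using me le unfolding is_weak_meet_def a(2) b(2) c(2) by blast+
      fix y assume y: "y \<in> W" "N y \<subseteq> N (act a)" "N y \<subseteq> N (act b)"
      obtain w where w: "w \<in> words n" "y = act w" using ex[OF y(1)] by blast
      have "weak_le n m (cls w) X" "weak_le n m (cls w) Y"
        using weak_le_iff[OF w(1) a(1)] weak_le_iff[OF w(1) b(1)] y w a b by simp_all
      then have "weak_le n m (cls w) Z" using me unfolding is_weak_meet_def by blast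
      then show "N y \<subseteq> N (act c)" using weak_le_iff[OF w(1) c(1)] w c by simp
    qed
    then show "c_sortable n m p Z" using c_sortable_iff[OF f c(1)] c by simp
  next
    assume jo: "is_weak_join n m X Y Z"
    then have "Z \<in> coxW n m" by (auto simp: is_weak_join_def weak_le_def)
    then obtain c where c: "c \<in> words n" "Z = cls c" using coxW_cls by blast
    note le = weak_le_iff[OF a(1) c(1)] weak_le_iff[OF b(1) c(1)]
    have "sortable p (act c)"
    proof (rule sortable_join[OF finW l sa sb act_W[OF c(1)]])
      show "N (act a) \<subseteq> N (act c)" "N (act b) \<subseteq> N (act c)"
        using jo le unfolding is_weak_join_def a(2) b(2) c(2) by blast+
      fix y assume y: "y \<in> W" "N (act a) \<subseteq> N y" "N (act b) \<subseteq> N y"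
      obtain w where w: "w \<in> words n" "y = act w" using ex[OF y(1)] by blast
      have "weak_le n m X (cls w)" "weak_le n m Y (cls w)"
        using weak_le_iff[OF a(1) w(1)] weak_le_iff[OF b(1) w(1)] y w a b by simp_all
      then have "weak_le n m Z (cls w)" using jo unfolding is_weak_join_def by blast
      then show "N (act c) \<subseteq> N y" using weak_le_iff[OF c(1) w(1)] w c by simp
    qed
    then show "c_sortable n m p Z" using c_sortable_iff[OF f c(1)] c by simp
  }
qed

end

theorem theorem4p3:
  fixes n :: nat and m :: "nat \<Rightarrow> nat \<Rightarrow> nat" and p :: "nat list"
  assumes "coxeter_matrix n m"
    and "finite (coxW n m)"
    and "coxeter_word n p"
  shows "\<forall>u v x. c_sortable n m p u \<and> c_sortable n m p v \<longrightarrow>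
           (is_weak_meet n m u v x \<longrightarrow> c_sortable n m p x) \<and>
           (is_weak_join n m u v x \<longrightarrow> c_sortable n m p x)"
proof (cases "n = 0")
  case True
  \<comment> \<open>Without generators the conjunct \<open>0 < n\<close> of
    \<open>sort_appended\<close> fails, so all pass sets are empty.\<close>
  have "c_sortable n m p x" if "x \<in> coxW n m" for x
    using that True by (simp add: c_sortable_def pass_set_def sort_appended_def)
  then show ?thesis by (auto simp: is_weak_meet_def is_weak_join_def weak_le_def)
next
  case False
  interpret coxeter n m by unfold_locales (rule assms(1))
  have "length p = n" using assms(3) distinct_card[of p] by (simp add: coxeter_word_def)
  then have "full p" using assms(3) False by (simp add: full_def coxeter_word_def)
  then show ?thesis using c_sortable_meet_join[OF assms(2)] by blast
qed

end
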